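(* Let $K=K(n)$ satisfy $K\ge 2$ and $K=o(\log n)$, and consider the Achlioptas process on $n$ vertices in which $K$ edges are presented at each round. Then for every fixed $\varepsilon>0$: (i) there is an online algorithm such that, with probability tending to $1$ as $n\to\infty$, the graph of selected edges contains a Hamilton cycle after at most $(1+\varepsilon)\frac{n\log n}{2K}$ rounds; and (ii) for every online algorithm, with probability tending to $1$ the graph of selected edges does not contain a Hamilton cycle after $(1-\varepsilon)\frac{n\log n}{2K}$ rounds. That is, the minimum number of rounds needed for Hamiltonicity is with high probability $\frac{1+o(1)}{2K}n\log n$.
   Context: The Achlioptas process with parameter $K$: start with the empty graph on $n$ labeled vertices. At each round, $K$ distinct edges are chosen uniformly at random among all pairs of vertices that are not edges of the current graph, and an online algorithm must add exactly one of them to the current graph (the others are discarded). The algorithm's choice at a round may depend only on the history up to and including that round (not on future rounds). $\log$ denotes the natural logarithm; "with high probability" means with probability tending to $1$ as $n\to\infty$. *)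

theory Defs
  imports "HOL-Probability.Probability" "HOL-Library.Landau_Symbols"
begin

text \<open>Graphs on the vertex set \<open>{..<n}\<close> are given by their sets of edges, an edge being a
  two-element set of vertices.\<close>

type_synonym edge = "nat set"

definition all_edges :: "nat \<Rightarrow> edge set" where
  "all_edges n = {e. e \<subseteq> {..<n} \<and> card e = 2}"

definition hamilton_cycle :: "nat \<Rightarrow> edge set \<Rightarrow> nat list \<Rightarrow> bool" where
  "hamilton_cycle n E vs \<longleftrightarrow>
     3 \<le> n \<and> distinct vs \<and> set vs = {..<n} \<and>
     (\<forall>i<n. {vs ! i, vs ! (Suc i mod n)} \<in> E)"

definition hamiltonian :: "nat \<Rightarrow> edge set \<Rightarrow> bool" where
  "hamiltonian n E \<longleftrightarrow> (\<exists>vs. hamilton_cycle n E vs)"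

text \<open>A history lists, for each completed round, the set of edges presented and the edge selected.
  An algorithm maps the history of the completed rounds and the set of edges presented in the
  current round to the edge it selects.\<close>

type_synonym history = "(edge set \<times> edge) list"
type_synonym algorithm = "history \<Rightarrow> edge set \<Rightarrow> edge"

definition selected :: "history \<Rightarrow> edge set" where
  "selected h = snd ` set h"

definition offers :: "nat \<Rightarrow> nat \<Rightarrow> edge set \<Rightarrow> edge set set" where
  "offers n K E = {S. S \<subseteq> all_edges n - E \<and> card S = K}"

definition online_algorithm :: "nat \<Rightarrow> nat \<Rightarrow> algorithm \<Rightarrow> bool" where
  "online_algorithm n K A \<longleftrightarrow> (\<forall>h. \<forall>S \<in> offers n K (selected h). A h S \<in> S)"

text \<open>\<open>achlioptas n K A t\<close> is the distribution of the history after \<open>t\<close> rounds. The process halts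
  when fewer than \<open>K\<close> non-edges remain; when \<open>K = o(log n)\<close>, this does not happen within
  \<open>O(n log n / K)\<close> rounds once \<open>n\<close> is large.\<close>

primrec achlioptas :: "nat \<Rightarrow> nat \<Rightarrow> algorithm \<Rightarrow> nat \<Rightarrow> history pmf" where
  "achlioptas n K A 0 = return_pmf []"
| "achlioptas n K A (Suc t) =
     bind_pmf (achlioptas n K A t) (\<lambda>h.
       if offers n K (selected h) = {} then return_pmf h
       else map_pmf (\<lambda>S. h @ [(S, A h S)]) (pmf_of_set (offers n K (selected h))))"

end

theory Submission
  imports Defs "HOL-Real_Asymp.Real_Asymp"
begin

text \<open>
  Lower bound: as long as a vertex has not been offered it is isolated, and the number of non-edges
  after \<open>t\<close> rounds is deterministic. Hence the probabilities that one or two given vertices are never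
  offered are explicit products, and the second moment method yields a vertex that is never offered.

  Upper bound: call a vertex needy while it has been served fewer than 10 times and has degree less
  than \<open>\<eta> n\<close>, and keep at most \<open>\<eta> n / K\<close> needy vertices active. If exactly one offered edge touches an
  active vertex, select it; it serves its active end points. Given that a round serves, the served
  edge is uniform among the available edges at active vertices. After \<open>O(n)\<close> rounds at most
  \<open>\<eta> n / K\<close> vertices are needy, and from then on each of them is served with probability about
  \<open>2 K / n\<close> per round, so that after \<open>(1 + \<epsilon> / 2) n log n / (2 K)\<close> rounds none is left. Since the
  targets of the served edges are nearly uniform, a union bound shows that all sets of at most
  \<open>\<beta> n\<close> vertices then expand by a factor 2. By Posa's rotation argument, a constant fraction of all
  pairs are boosters for such a graph, and \<open>\<epsilon> n log n / (8 K)\<close> further rounds, which is of larger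
  order than \<open>n\<close>, suffice to add the at most \<open>2 n + 1\<close> boosters needed.
\<close>

section \<open>Rotations of longest paths\<close>

text \<open>The obstacle is adaptivity: the selected graph depends on the whole history, so no
  independence is available. The stages of the upper bound are therefore controlled by potentials
  whose one-round averages are computed by counting offers. The cap on active vertices makes two
  edges at active vertices in one offer rare, which yields the rate 2 K / n per vertex. Ten services
  come from the union bound: choosing a bad set of s vertices and a set of size 3 s around it costs
  about (n/s)^(4s), while one service gains only the square root of s/n up to constants, because an
  edge may serve two vertices of the bad set. Ten per vertex gain (s/n)^(5s), which leaves (s/n)^s
  to sum. Asking for ten services instead of one does not change the leading constant, since a needy
  vertex is weighted by a power of the small number \<eta>. The assumption K = o(log n) makes n log
  n / K dominate every multiple of n: the initial stage and the boosting stage get by with linearly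
  many rounds and have to fit into the slack given by \<epsilon>.\<close>

definition nbhd :: "edge set \<Rightarrow> nat set \<Rightarrow> nat set" where
  "nbhd E S = {y. y \<notin> S \<and> (\<exists>x\<in>S. {x, y} \<in> E)}"

definition expander :: "nat \<Rightarrow> nat \<Rightarrow> edge set \<Rightarrow> bool" where
  "expander n k E \<longleftrightarrow>
     (\<forall>S. S \<subseteq> {..<n} \<longrightarrow> S \<noteq> {} \<longrightarrow> card S \<le> k \<longrightarrow> 2 * card S \<le> card (nbhd E S))"

fun path_edges :: "'a list \<Rightarrow> 'a set set" where
  "path_edges (x # y # xs) = insert {x, y} (path_edges (y # xs))"
| "path_edges _ = {}"

definition is_path :: "nat \<Rightarrow> edge set \<Rightarrow> nat list \<Rightarrow> bool" where
  "is_path n E p \<longleftrightarrow> p \<noteq> [] \<and> distinct p \<and> set p \<subseteq> {..<n} \<and> path_edges p \<subseteq> E"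

definition longest_path :: "nat \<Rightarrow> edge set \<Rightarrow> nat list \<Rightarrow> bool" where
  "longest_path n E p \<longleftrightarrow> is_path n E p \<and> (\<forall>q. is_path n E q \<longrightarrow> length q \<le> length p)"

text \<open>Posa rotation with the first vertex fixed: the path edge from \<open>y\<close> to
  \<open>hd bs\<close> is exchanged for the chord from \<open>y\<close> to \<open>last bs\<close>,
  so the former successor of \<open>y\<close> becomes the new end.\<close>

inductive_set rotations :: "edge set \<Rightarrow> nat list \<Rightarrow> nat list set" for E p where
  start: "p \<in> rotations E p"
| rotate: "as @ y # bs \<in> rotations E p \<Longrightarrow> bs \<noteq> [] \<Longrightarrow> {y, last bs} \<in> E \<Longrightarrow>
    as @ y # rev bs \<in> rotations E p"

lemma path_edges_append:
  "xs \<noteq> [] \<Longrightarrow> ys \<noteq> [] \<Longrightarrow>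
   path_edges (xs @ ys) = insert {last xs, hd ys} (path_edges xs \<union> path_edges ys)"
proof (induction xs rule: path_edges.induct)
  case (1 x y xs)
  then show ?case by auto
next
  case "2_1" then show ?case by simp
next
  case ("2_2" v)
  then show ?case by (cases ys) auto
qed

lemma path_edges_rev: "path_edges (rev xs) = path_edges xs"
proof (induction xs rule: path_edges.induct)
  case (1 x y xs)
  have "path_edges (rev (x # y # xs)) = path_edges (rev (y # xs) @ [x])" by simp
  also have "\<dots> = insert {y, x} (path_edges (rev (y # xs)))"
    by (subst path_edges_append) (simp_all add: last_rev)
  finally show ?case using 1 by (simp add: insert_commute)
qed auto

lemma path_edges_split:
  assumes "bs \<noteq> []"
  shows "path_edges (as @ y # bs) = insert {y, hd bs} (path_edges (as @ [y]) \<union> path_edges bs)"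
  using path_edges_append[of "as @ [y]" bs] assms by simp

lemma path_edges_subset: "e \<in> path_edges xs \<Longrightarrow> e \<subseteq> set xs"
  by (induction xs rule: path_edges.induct) auto

lemma path_edges_nth:
  "e \<in> path_edges xs \<longleftrightarrow> (\<exists>i. Suc i < length xs \<and> e = {xs ! i, xs ! Suc i})"
proof (induction xs rule: path_edges.induct)
  case (1 x y xs)
  show ?case
  proof
    assume "e \<in> path_edges (x # y # xs)"
    then consider "e = {x, y}" | "e \<in> path_edges (y # xs)" by auto
    then show "\<exists>i. Suc i < length (x # y # xs) \<and> e = {(x # y # xs) ! i, (x # y # xs) ! Suc i}"
    proof cases
      case 1 then show ?thesis by (intro exI[of _ 0]) simp
    next
      case 2
      then obtain i where "Suc i < length (y # xs)" "e = {(y # xs) ! i, (y # xs) ! Suc i}"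
        using 1 by blast
      then show ?thesis by (intro exI[of _ "Suc i"]) simp
    qed
  next
    assume "\<exists>i. Suc i < length (x # y # xs) \<and> e = {(x # y # xs) ! i, (x # y # xs) ! Suc i}"
    then obtain i where i: "Suc i < length (x # y # xs)"
      "e = {(x # y # xs) ! i, (x # y # xs) ! Suc i}" by blast
    show "e \<in> path_edges (x # y # xs)"
    proof (cases i)
      case 0 then show ?thesis using i by simp
    next
      case (Suc j)
      then have "e \<in> path_edges (y # xs)" using i 1 by (metis Suc_less_eq length_Cons nth_Cons_Suc)
      then show ?thesis by simp
    qed
  qed
qed auto

lemma rotations_path:
  assumes "q \<in> rotations E p" "is_path n E p"
  shows "is_path n E q \<and> set q = set p \<and> hd q = hd p \<and> length q = length p"
  using assms(1)
proof induction
  case start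
  show ?case using assms(2) by simp
next
  case (rotate as y bs)
  have "path_edges (as @ y # rev bs) = insert {y, last bs} (path_edges (as @ [y]) \<union> path_edges bs)"
    using rotate.hyps by (subst path_edges_split) (simp_all add: path_edges_rev hd_rev)
  moreover have "path_edges (as @ [y]) \<union> path_edges bs \<subseteq> E"
    using rotate.IH path_edges_split[OF rotate.hyps(2), of as y] unfolding is_path_def by auto
  ultimately have "path_edges (as @ y # rev bs) \<subseteq> E" using rotate.hyps(3) by auto
  moreover have "hd (as @ y # rev bs) = hd (as @ y # bs)" by (cases as) auto
  moreover have "set (as @ y # rev bs) = set (as @ y # bs)"
    "length (as @ y # rev bs) = length (as @ y # bs)"
    "distinct (as @ y # rev bs) = distinct (as @ y # bs)" by auto
  ultimately show ?case using rotate.IH unfolding is_path_def by (metis append_is_Nil_conv list.discI)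
qed

lemma rotation_ends_subset:
  assumes "is_path n E p" shows "last ` rotations E p \<subseteq> set p"
proof
  fix x assume "x \<in> last ` rotations E p"
  then obtain q where q: "q \<in> rotations E p" "x = last q" by blast
  then have "q \<noteq> []" "set q = set p" using rotations_path[OF q(1) assms] by (auto simp: is_path_def)
  then show "x \<in> set p" using q(2) last_in_set[of q] by simp
qed

lemma longest_path_rotation:
  assumes "q \<in> rotations E p" "longest_path n E p"
  shows "longest_path n E q"
  using rotations_path[OF assms(1), of n] assms(2) unfolding longest_path_def by simp

lemma longest_path_rev:
  assumes "longest_path n E p"
  shows "longest_path n E (rev p)"
  using assms unfolding longest_path_def is_path_def by (simp add: path_edges_rev)

text \<open>A rotation removes the edge from \<open>y\<close> to \<open>hd bs\<close> and adds the
  one from \<open>y\<close> to \<open>last bs\<close>. Both \<open>hd bs\<close> and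
  \<open>last bs\<close> are end vertices, so \<open>w\<close> could only be \<open>y\<close>; but
  then the removed edge, by induction still an original one, would join \<open>w\<close> to an end
  vertex on \<open>p\<close>.\<close>

lemma rotations_edges_at:
  assumes "q \<in> rotations E p"
    and w: "w \<notin> last ` rotations E p"
    and w': "\<And>x. x \<in> last ` rotations E p \<Longrightarrow> {x, w} \<notin> path_edges p"
  shows "{e \<in> path_edges q. w \<in> e} = {e \<in> path_edges p. w \<in> e}"
  using assms(1)
proof induction
  case start
  show ?case by simp
next
  case (rotate as y bs)
  have new: "as @ y # rev bs \<in> rotations E p" by (rule rotations.rotate) (fact rotate)+
  have pe: "path_edges (as @ y # rev bs) = insert {y, last bs} (path_edges (as @ [y]) \<union> path_edges bs)"
    using rotate.hyps by (subst path_edges_split) (simp_all add: path_edges_rev hd_rev)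
  have pe0: "path_edges (as @ y # bs) = insert {y, hd bs} (path_edges (as @ [y]) \<union> path_edges bs)"
    by (rule path_edges_split) (fact rotate)
  have "last bs \<in> last ` rotations E p"
    using rotate.hyps by (intro image_eqI[of _ _ "as @ y # bs"]) auto
  then have 1: "w \<noteq> last bs" using w by auto
  have hd_in: "hd bs \<in> last ` rotations E p"
    using new rotate.hyps(2) by (intro image_eqI[of _ _ "as @ y # rev bs"]) (auto simp: last_rev)
  then have 2: "w \<noteq> hd bs" using w by auto
  have 3: "w \<noteq> y"
  proof
    assume "w = y"
    then have "{y, hd bs} \<in> {e \<in> path_edges (as @ y # bs). w \<in> e}" using pe0 by auto
    then have "{hd bs, w} \<in> path_edges p" using rotate.IH \<open>w = y\<close> by (auto simp: insert_commute)
    then show False using w' hd_in by blast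
  qed
  have "{e \<in> path_edges (as @ y # rev bs). w \<in> e} = {e \<in> path_edges (as @ y # bs). w \<in> e}"
    unfolding pe pe0 using 1 2 3 by auto
  then show ?case using rotate.IH by simp
qed

lemma is_path_snoc:
  assumes "is_path n E p" "{last p, y} \<in> E" "y < n" "y \<notin> set p"
  shows "is_path n E (p @ [y])"
  using assms unfolding is_path_def by (auto simp: path_edges_append)

text \<open>Posa's lemma. Maximality puts \<open>y\<close> on the path \<open>q\<close> whose end it
  is adjacent to, and rotating there turns the successor of \<open>y\<close> on \<open>q\<close>
  into an end vertex. If no neighbour of \<open>y\<close> on \<open>p\<close> were an end, the path
  edges at \<open>y\<close> would have survived all rotations, and this successor would itself be
  such a neighbour.\<close>

lemma posa_neighbours:
  assumes E: "E \<subseteq> all_edges n" and lp: "longest_path n E p"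
    and R: "R = last ` rotations E p" and y: "y \<in> nbhd E R"
  shows "\<exists>x\<in>R. {x, y} \<in> path_edges p"
proof (rule ccontr)
  assume neg: "\<not> ?thesis"
  from y obtain q where q: "q \<in> rotations E p" and edge: "{last q, y} \<in> E" and yR: "y \<notin> R"
    unfolding nbhd_def R by auto
  have lq: "longest_path n E q" by (rule longest_path_rotation[OF q lp])
  have pq: "is_path n E q" using lq unfolding longest_path_def by simp
  have yn: "y < n" using edge E unfolding all_edges_def by auto
  have "y \<in> set q"
  proof (rule ccontr)
    assume "y \<notin> set q"
    then have "is_path n E (q @ [y])" using is_path_snoc[OF pq edge yn] by simp
    then show False using lq unfolding longest_path_def by fastforce
  qed
  then obtain as bs where qs: "q = as @ y # bs" by (meson split_list)
  have "bs \<noteq> []"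
    using yR q unfolding R qs by (metis image_eqI last_snoc)
  have lb: "last q = last bs" using \<open>bs \<noteq> []\<close> qs by simp
  have new: "as @ y # rev bs \<in> rotations E p"
    using rotations.rotate q \<open>bs \<noteq> []\<close> edge qs lb by (metis insert_commute)
  have hd_in: "hd bs \<in> R"
    using new \<open>bs \<noteq> []\<close> unfolding R by (intro image_eqI[of _ _ "as @ y # rev bs"]) (auto simp: last_rev)
  have "{e \<in> path_edges q. y \<in> e} = {e \<in> path_edges p. y \<in> e}"
    using rotations_edges_at[OF q] yR neg unfolding R by blast
  moreover have "{y, hd bs} \<in> path_edges q"
    using path_edges_split[OF \<open>bs \<noteq> []\<close>, of as y] qs by auto
  ultimately have "{hd bs, y} \<in> path_edges p" by (auto simp: insert_commute)
  then show False using neg hd_in by blast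
qed

text \<open>Each vertex of \<open>R\<close> has at most two neighbours on the path and
  \<open>last p\<close> has at most one; this saving makes the inequality strict.\<close>

lemma card_path_neighbours:
  assumes "distinct p" "p \<noteq> []" "R \<subseteq> set p" "last p \<in> R"
  shows "card {y. \<exists>x\<in>R. {x, y} \<in> path_edges p} < 2 * card R"
proof -
  define I where "I = {i. i < length p \<and> p ! i \<in> R}"
  have finI: "finite I" unfolding I_def by simp
  have img: "(!) p ` I = R"
    using assms(3) unfolding I_def by (auto simp: image_iff subset_iff) (metis in_set_conv_nth)
  have inj: "inj_on ((!) p) I" using assms(1) unfolding I_def by (auto simp: inj_on_def nth_eq_iff_index_eq)
  have cI: "card I = card R" using card_image[OF inj] img by simp
  let ?l = "length p - 1"
  have l: "?l \<in> I" using assms unfolding I_def by (auto simp: last_conv_nth)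
  \<comment> \<open>Successors are taken at all positions but the last. Position 0 has no
    predecessor; there \<open>i - 1\<close> is 0, which merely enlarges the bounding set.\<close>
  have sub: "{y. \<exists>x\<in>R. {x, y} \<in> path_edges p} \<subseteq>
      (\<lambda>i. p ! Suc i) ` (I - {?l}) \<union> (\<lambda>i. p ! (i - 1)) ` I"
  proof
    fix y assume "y \<in> {y. \<exists>x\<in>R. {x, y} \<in> path_edges p}"
    then obtain x i where x: "x \<in> R" "Suc i < length p" "{x, y} = {p ! i, p ! Suc i}"
      by (auto simp: path_edges_nth)
    then consider "x = p ! i" "y = p ! Suc i" | "x = p ! Suc i" "y = p ! i"
      by (auto simp: doubleton_eq_iff)
    then show "y \<in> (\<lambda>i. p ! Suc i) ` (I - {?l}) \<union> (\<lambda>i. p ! (i - 1)) ` I"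
    proof cases
      case 1
      then have "i \<in> I - {?l}" using x unfolding I_def by auto
      then show ?thesis using 1 by blast
    next
      case 2
      then have "Suc i \<in> I" using x unfolding I_def by auto
      then show ?thesis using 2 by (intro UnI2 image_eqI[of _ _ "Suc i"]) auto
    qed
  qed
  have "card {y. \<exists>x\<in>R. {x, y} \<in> path_edges p} \<le>
      card ((\<lambda>i. p ! Suc i) ` (I - {?l}) \<union> (\<lambda>i. p ! (i - 1)) ` I)"
    by (rule card_mono[OF _ sub]) (use finI in auto)
  also have "\<dots> \<le> card (I - {?l}) + card I"
    by (meson card_Un_le card_image_le finI finite_Diff add_mono order_trans)
  also have "\<dots> < 2 * card I" using card_Diff1_less[OF finI l] by simp
  finally show ?thesis using cI by simp
qed

text \<open>With at most \<open>k\<close> ends, expansion would give the set of ends at least twice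
  as many outside neighbours, while Posa's lemma places these among fewer than twice as many path
  neighbours.\<close>

lemma card_rotation_ends:
  assumes E: "E \<subseteq> all_edges n" and ex: "expander n k E" and lp: "longest_path n E p"
  shows "k < card (last ` rotations E p)"
proof (rule ccontr)
  define R where "R = last ` rotations E p"
  assume "\<not> k < card (last ` rotations E p)"
  then have le: "card R \<le> k" by (simp add: R_def)
  have pp: "is_path n E p" using lp by (simp add: longest_path_def)
  have Rp: "R \<subseteq> set p"
    unfolding R_def by (rule rotation_ends_subset[OF pp])
  have lR: "last p \<in> R" unfolding R_def using rotations.start by blast
  have "R \<subseteq> {..<n}" using Rp pp by (auto simp: is_path_def)
  then have "2 * card R \<le> card (nbhd E R)"
    using ex le lR unfolding expander_def by blast
  also have "\<dots> \<le> card {y. \<exists>x\<in>R. {x, y} \<in> path_edges p}"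
  proof (rule card_mono)
    have "{y. \<exists>x\<in>R. {x, y} \<in> path_edges p} \<subseteq> set p" using path_edges_subset by fastforce
    then show "finite {y. \<exists>x\<in>R. {x, y} \<in> path_edges p}" by (rule finite_subset) simp
    show "nbhd E R \<subseteq> {y. \<exists>x\<in>R. {x, y} \<in> path_edges p}"
      using posa_neighbours[OF E lp R_def] by auto
  qed
  also have "\<dots> < 2 * card R"
    using card_path_neighbours[OF _ _ Rp lR] pp by (auto simp: is_path_def)
  finally show False by simp
qed

section \<open>End pairs of longest paths\<close>

lemma card_ordered_pairs_le:
  assumes "finite B"
  shows "card {(x, y). {x, y} \<in> B} \<le> 2 * card (B :: 'a set set)"
proof -
  have "{(x, y). {x, y} \<in> B} = (\<Union>e\<in>B. {(x, y). {x, y} = e})" by auto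
  also have "card \<dots> \<le> (\<Sum>e\<in>B. card {(x, y). {x, y} = e})"
    by (rule card_UN_le[OF assms])
  also have "\<dots> \<le> (\<Sum>e\<in>B. 2)"
  proof (rule sum_mono)
    fix e :: "'a set"
    show "card {(x, y). {x, y} = e} \<le> 2"
    proof (cases "\<exists>a b. e = {a, b}")
      case True
      then obtain a b where e: "e = {a, b}" by blast
      have "{(x, y). {x, y} = e} \<subseteq> {(a, b), (b, a)}" by (auto simp: e doubleton_eq_iff)
      then have "card {(x, y). {x, y} = e} \<le> card {(a, b), (b, a)}" by (intro card_mono) auto
      also have "\<dots> \<le> 2" using card_length[of "[(a, b), (b, a)]"] by simp
      finally show ?thesis .
    next
      case False
      then have "{(x, y). {x, y} = e} = {}" by auto
      then show ?thesis by simp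
    qed
  qed
  finally show ?thesis by simp
qed

definition end_pairs :: "nat \<Rightarrow> edge set \<Rightarrow> edge set" where
  "end_pairs n E = {{hd p, last p} | p. longest_path n E p}"

lemma finite_paths: "finite {p. is_path n E p}"
proof -
  have "{p. is_path n E p} \<subseteq> {xs. set xs \<subseteq> {..<n} \<and> distinct xs}"
    unfolding is_path_def by auto
  then show ?thesis using finite_subset_distinct[of "{..<n}"] finite_subset by blast
qed

lemma longest_path_exists:
  assumes "n \<ge> 1" obtains p where "longest_path n E p"
proof -
  let ?P = "{p. is_path n E p}"
  have "[0] \<in> ?P" using assms by (simp add: is_path_def)
  then have "Max (length ` ?P) \<in> length ` ?P"
    by (intro Max_in) (auto simp: finite_paths)
  then obtain p where p: "is_path n E p" "length p = Max (length ` ?P)" by auto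
  have "length q \<le> length p" if "is_path n E q" for q
    unfolding p(2) by (rule Max_ge) (use that in \<open>auto simp: finite_paths\<close>)
  then show thesis using that p(1) unfolding longest_path_def by blast
qed

lemma finite_all_edges: "finite (all_edges n)"
proof -
  have "all_edges n \<subseteq> Pow {..<n}" by (auto simp: all_edges_def)
  then show ?thesis by (rule finite_subset) simp
qed

text \<open>Rotation at both ends: one family of rotations gives more than \<open>k\<close> final
  vertices, and reversing each such path and rotating again gives more than \<open>k\<close>
  partners for each of them. These are ordered pairs, hence the factor 2.\<close>

lemma card_end_pairs:
  assumes E: "E \<subseteq> all_edges n" and ex: "expander n k E" and n: "n \<ge> 1" and k: "k \<ge> 1"
  shows "end_pairs n E \<subseteq> all_edges n" "(k + 1)\<^sup>2 \<le> 2 * card (end_pairs n E)"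
proof -
  obtain p where lp: "longest_path n E p" using longest_path_exists[OF n] .
  \<comment> \<open>Since \<open>k \<ge> 1\<close>, there are at least two rotation ends, all on the
    path; hence a longest path is not a single vertex and its two ends differ.\<close>
  have len: "2 \<le> length q" if "longest_path n E q" for q
  proof -
    have "last ` rotations E q \<subseteq> set q"
      using rotation_ends_subset[of n E q] that by (simp add: longest_path_def)
    then have "card (last ` rotations E q) \<le> length q"
      by (meson List.finite_set card_length card_mono order_trans)
    then show ?thesis using card_rotation_ends[OF E ex that] k by linarith
  qed
  show sub: "end_pairs n E \<subseteq> all_edges n"
  proof
    fix e assume "e \<in> end_pairs n E"
    then obtain q where q: "longest_path n E q" "e = {hd q, last q}" by (auto simp: end_pairs_def)
    have "is_path n E q" using q by (simp add: longest_path_def)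
    moreover have "hd q \<noteq> last q"
      using len[OF q(1)] \<open>is_path n E q\<close> unfolding is_path_def
      by (cases q) (auto split: if_splits)
    moreover have "hd q \<in> set q" "last q \<in> set q"
      using \<open>is_path n E q\<close> by (auto simp: is_path_def)
    moreover have "set q \<subseteq> {..<n}" using \<open>is_path n E q\<close> by (simp add: is_path_def)
    ultimately show "e \<in> all_edges n" unfolding all_edges_def q(2) by auto
  qed
  have fin: "finite (end_pairs n E)" using sub finite_all_edges finite_subset by blast
  define R where "R = last ` rotations E p"
  have ex_q: "\<exists>q. longest_path n E q \<and> hd q = x" if "x \<in> R" for x
  proof -
    from that obtain q where "q \<in> rotations E p" "x = last q" by (auto simp: R_def)
    then have "longest_path n E (rev q)" "hd (rev q) = x"
      using longest_path_rotation[OF _ lp] longest_path_rev by (auto simp: hd_rev)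
    then show ?thesis by blast
  qed
  have inner: "k + 1 \<le> card {y. {x, y} \<in> end_pairs n E}" if x: "x \<in> R" for x
  proof -
    obtain q where q: "longest_path n E q" "hd q = x" using ex_q[OF x] by blast
    have "last ` rotations E q \<subseteq> {y. {x, y} \<in> end_pairs n E}"
    proof
      fix y assume "y \<in> last ` rotations E q"
      then obtain q' where q': "q' \<in> rotations E q" "y = last q'" by blast
      have "longest_path n E q'" by (rule longest_path_rotation[OF q'(1) q(1)])
      moreover have "hd q' = x" using rotations_path[OF q'(1)] q by (auto simp: longest_path_def)
      ultimately show "y \<in> {y. {x, y} \<in> end_pairs n E}" using q'(2) unfolding end_pairs_def by blast
    qed
    moreover have "finite {y. {x, y} \<in> end_pairs n E}"
      by (rule finite_subset[of _ "{..<n}"]) (use sub in \<open>auto simp: all_edges_def\<close>)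
    ultimately have "card (last ` rotations E q) \<le> card {y. {x, y} \<in> end_pairs n E}"
      by (intro card_mono)
    then show ?thesis using card_rotation_ends[OF E ex q(1)] by linarith
  qed
  have finR: "finite R" using card_rotation_ends[OF E ex lp] unfolding R_def[symmetric]
    using card.infinite by fastforce
  have "(k + 1)\<^sup>2 \<le> card R * (k + 1)"
    using card_rotation_ends[OF E ex lp] unfolding R_def[symmetric] power2_eq_square
    by (intro mult_right_mono) auto
  also have "\<dots> = (\<Sum>x\<in>R. k + 1)" by simp
  also have "\<dots> \<le> (\<Sum>x\<in>R. card {y. {x, y} \<in> end_pairs n E})" by (rule sum_mono) (rule inner)
  also have "\<dots> = card (Sigma R (\<lambda>x. {y. {x, y} \<in> end_pairs n E}))"
  proof (rule card_SigmaI[symmetric])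
    show "finite R" by (rule finR)
    show "\<forall>a\<in>R. finite {y. {a, y} \<in> end_pairs n E}"
    proof
      fix a show "finite {y. {a, y} \<in> end_pairs n E}"
        by (rule finite_subset[of _ "{..<n}"]) (use sub in \<open>auto simp: all_edges_def\<close>)
    qed
  qed
  also have "\<dots> \<le> card {(x, y). {x, y} \<in> end_pairs n E}"
  proof (rule card_mono)
    show "finite {(x, y). {x, y} \<in> end_pairs n E}"
      by (rule finite_subset[of _ "{..<n} \<times> {..<n}"]) (use sub in \<open>auto simp: all_edges_def\<close>)
  qed auto
  also have "\<dots> \<le> 2 * card (end_pairs n E)" by (rule card_ordered_pairs_le[OF fin])
  finally show "(k + 1)\<^sup>2 \<le> 2 * card (end_pairs n E)" .
qed


section \<open>Path rank and boosters\<close>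

definition path_length :: "nat \<Rightarrow> edge set \<Rightarrow> nat" where
  "path_length n E = Max (length ` {p. is_path n E p})"

text \<open>Lexicographic order on the pair of maximal path length and existence of a longest path
  that closes up; the factor 2 lets a longer path outweigh the loss of closure. Thus closing a
  longest path and escaping from a closed one both count as progress.\<close>

definition path_rank :: "nat \<Rightarrow> edge set \<Rightarrow> nat" where
  "path_rank n E = 2 * path_length n E +
     (if \<exists>p. longest_path n E p \<and> {hd p, last p} \<in> E then 1 else 0)"

lemma is_path_length_le: "is_path n E p \<Longrightarrow> length p \<le> path_length n E"
  unfolding path_length_def by (rule Max_ge) (auto simp: finite_paths)

lemma longest_path_length:
  assumes "longest_path n E p" shows "length p = path_length n E"
  unfolding path_length_def using assms
  by (intro Max_eqI[symmetric]) (auto simp: finite_paths longest_path_def)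

lemma longest_path_iff:
  "longest_path n E p \<longleftrightarrow> is_path n E p \<and> path_length n E \<le> length p"
proof
  assume "longest_path n E p"
  then show "is_path n E p \<and> path_length n E \<le> length p"
    using longest_path_length[of n E p] by (simp add: longest_path_def)
next
  assume p: "is_path n E p \<and> path_length n E \<le> length p"
  have "length q \<le> length p" if "is_path n E q" for q
    using is_path_length_le[OF that] p by linarith
  then show "longest_path n E p" using p by (simp add: longest_path_def)
qed

lemma is_path_mono: "is_path n E p \<Longrightarrow> E \<subseteq> E' \<Longrightarrow> is_path n E' p"
  unfolding is_path_def by auto

lemma path_length_mono:
  assumes "n \<ge> 1" "E \<subseteq> E'" shows "path_length n E \<le> path_length n E'"
proof -
  obtain p where p: "longest_path n E p" using longest_path_exists[OF assms(1)] .
  then have "is_path n E' p" using is_path_mono assms(2) by (auto simp: longest_path_def)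
  then show ?thesis using longest_path_length[OF p] is_path_length_le by metis
qed

lemma path_rank_mono:
  assumes "n \<ge> 1" "E \<subseteq> E'" shows "path_rank n E \<le> path_rank n E'"
proof (cases "path_length n E < path_length n E'")
  case True then show ?thesis unfolding path_rank_def by auto
next
  case False
  then have eq: "path_length n E = path_length n E'" using path_length_mono[OF assms] by simp
  then have "longest_path n E' p" if "longest_path n E p" for p
    using that is_path_mono[OF _ assms(2)] by (auto simp: longest_path_iff)
  then show ?thesis unfolding path_rank_def eq using assms(2) by auto
qed

lemma path_length_le: assumes "n \<ge> 1" shows "path_length n E \<le> n"
proof -
  obtain p where p: "longest_path n E p" using longest_path_exists[OF assms] .
  then have "length p = card (set p)" "set p \<subseteq> {..<n}"
    by (auto simp: longest_path_def is_path_def distinct_card)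
  then have "length p \<le> n" using card_mono[of "{..<n}" "set p"] by simp
  then show ?thesis using longest_path_length[OF p] by simp
qed

lemma path_rank_le: assumes "n \<ge> 1" shows "path_rank n E \<le> 2 * n + 1"
  using path_length_le[OF assms, of E] unfolding path_rank_def by auto

text \<open>A closed path can be cut open at any vertex: starting just behind \<open>c\<close> makes
  \<open>c\<close> the last vertex, from which the path continues to \<open>w\<close>.\<close>

lemma closed_path_extend:
  assumes p: "is_path n E p" and cl: "{hd p, last p} \<in> E" and E: "E \<subseteq> E'"
    and c: "c \<in> set p" and w: "w < n" "w \<notin> set p" and cw: "{c, w} \<in> E'"
  shows "\<exists>q. is_path n E' q \<and> length q = Suc (length p)"
proof -
  obtain as bs where ps: "p = as @ c # bs" using split_list[OF c] by blast
  define q where "q = bs @ as @ [c]"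
  have "path_edges q \<subseteq> E"
  proof (cases "bs = []")
    case True then show ?thesis using p by (simp add: q_def ps is_path_def)
  next
    case False
    have 1: "path_edges p = insert {c, hd bs} (path_edges (as @ [c]) \<union> path_edges bs)"
      unfolding ps by (rule path_edges_split[OF False])
    have 2: "path_edges q = insert {last bs, hd (as @ [c])} (path_edges bs \<union> path_edges (as @ [c]))"
      unfolding q_def by (rule path_edges_append) (use False in auto)
    have "hd (as @ [c]) = hd p" unfolding ps by (cases as) auto
    moreover have "last bs = last p" unfolding ps using False by simp
    ultimately show ?thesis using 1 2 p cl by (auto simp: is_path_def insert_commute)
  qed
  then have "is_path n E' q" using p E by (auto simp: q_def ps is_path_def)
  moreover have "last q = c" "set q = set p" "length q = length p" by (auto simp: q_def ps)
  ultimately have "is_path n E' (q @ [w]) \<and> length (q @ [w]) = Suc (length p)"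
    using is_path_snoc[of n E' q w] w cw by simp
  then show ?thesis by blast
qed

lemma closed_path_hamiltonian:
  assumes p: "is_path n E p" and cl: "{hd p, last p} \<in> E" and len: "length p = n" and n: "3 \<le> n"
  shows "hamiltonian n E"
proof -
  have d: "distinct p" "set p \<subseteq> {..<n}" "path_edges p \<subseteq> E" "p \<noteq> []" using p by (auto simp: is_path_def)
  have "set p = {..<n}"
    by (rule card_subset_eq) (use d len in \<open>auto simp: distinct_card\<close>)
  moreover have "{p ! i, p ! (Suc i mod n)} \<in> E" if "i < n" for i
  proof (cases "Suc i = n")
    case True
    then have "p ! i = last p" "p ! (Suc i mod n) = hd p"
      using len d(4) by (auto simp: last_conv_nth hd_conv_nth)
    then show ?thesis using cl by (simp add: insert_commute)
  next
    case False
    then have "Suc i < length p" "Suc i mod n = Suc i" using that len by auto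
    then have "{p ! i, p ! (Suc i mod n)} \<in> path_edges p" by (auto simp: path_edges_nth)
    then show ?thesis using d by blast
  qed
  ultimately show ?thesis using d n unfolding hamiltonian_def hamilton_cycle_def by blast
qed

definition boosters :: "nat \<Rightarrow> edge set \<Rightarrow> edge set" where
  "boosters n E = {e \<in> all_edges n - E. path_rank n E < path_rank n (insert e E)}"

text \<open>If no longest path closes up, joining the ends of any of them raises the rank. If one
  does, no edge leaves its vertex set \<open>C\<close>, since that would yield a longer path; then
  \<open>C\<close> and its complement have no outside neighbours, expansion forces both above
  \<open>k\<close>, and every pair across the cut lengthens the path.\<close>

theorem card_boosters:
  assumes E: "E \<subseteq> all_edges n" and ex: "expander n k E" and n: "3 \<le> n" and k: "k \<ge> 1"
    and nh: "\<not> hamiltonian n E"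
  shows "(k + 1)\<^sup>2 \<le> 2 * card (boosters n E)"
proof (cases "\<exists>p. longest_path n E p \<and> {hd p, last p} \<in> E")
  case False
  have n1: "n \<ge> 1" using n by simp
  have rk: "path_rank n E = 2 * path_length n E" using False by (simp add: path_rank_def)
  have "end_pairs n E \<subseteq> boosters n E"
  proof
    fix e assume e: "e \<in> end_pairs n E"
    then obtain p where p: "longest_path n E p" "e = {hd p, last p}" by (auto simp: end_pairs_def)
    have "e \<notin> E" "e \<in> all_edges n" using False p card_end_pairs(1)[OF E ex n1 k] e by auto
    moreover have "path_rank n E < path_rank n (insert e E)"
    proof (cases "path_length n E < path_length n (insert e E)")
      case True then show ?thesis unfolding rk by (simp add: path_rank_def)
    next
      case F: False
      then have eq: "path_length n E = path_length n (insert e E)"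
        using path_length_mono[OF n1, of E "insert e E"] by auto
      have "longest_path n (insert e E) p"
        using p(1) is_path_mono[of n E p "insert e E"] eq by (auto simp: longest_path_iff)
      then have "\<exists>p. longest_path n (insert e E) p \<and> {hd p, last p} \<in> insert e E" using p(2) by blast
      then show ?thesis unfolding rk eq by (simp add: path_rank_def)
    qed
    ultimately show "e \<in> boosters n E" by (simp add: boosters_def)
  qed
  then have "card (end_pairs n E) \<le> card (boosters n E)"
    by (intro card_mono) (auto simp: boosters_def finite_all_edges)
  then show ?thesis using card_end_pairs(2)[OF E ex n1 k] by linarith
next
  case True
  have n1: "n \<ge> 1" using n by simp
  obtain p where p: "longest_path n E p" "{hd p, last p} \<in> E" using True by blast
  have pp: "is_path n E p" using p by (simp add: longest_path_def)
  define C where "C = set p"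
  have Cn: "C \<subseteq> {..<n}" using pp by (auto simp: C_def is_path_def)
  have cC: "card C = length p" using pp by (simp add: C_def is_path_def distinct_card)
  have "length p \<noteq> n" using closed_path_hamiltonian[OF pp p(2) _ n] nh by blast
  then have "C \<noteq> {..<n}" using cC by auto
  then have D0: "{..<n} - C \<noteq> {}" using Cn by blast
  have ext: "path_length n E < path_length n E'"
    if cw: "E \<subseteq> E'" "c \<in> C" "w < n" "w \<notin> C" "{c, w} \<in> E'" for E' c w
  proof -
    obtain q where "is_path n E' q" "length q = Suc (length p)"
      using closed_path_extend[OF pp p(2) cw(1)] cw unfolding C_def by blast
    then show ?thesis using is_path_length_le[of n E' q] longest_path_length[OF p(1)] by simp
  qed
  have cross: "{c, w} \<notin> E" if "c \<in> C" "w < n" "w \<notin> C" for c w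
    using ext[of E c w] that by auto
  have in_n: "y < n" if "{x, y} \<in> E" for x y using that E by (auto simp: all_edges_def)
  have nb: "nbhd E C = {}" "nbhd E ({..<n} - C) = {}"
  proof -
    show "nbhd E C = {}" using cross in_n unfolding nbhd_def by blast
    have "{x, y} \<notin> E" if "x < n" "x \<notin> C" "y \<in> C" for x y
      using cross[OF that(3,1,2)] by (simp add: insert_commute)
    then show "nbhd E ({..<n} - C) = {}" using in_n unfolding nbhd_def by blast
  qed
  have big: "k < card S" if "S \<subseteq> {..<n}" "S \<noteq> {}" "nbhd E S = {}" for S
  proof (rule ccontr)
    assume "\<not> k < card S"
    then have "2 * card S \<le> card (nbhd E S)"
      using ex that(1,2) unfolding expander_def by (meson not_le_imp_less)
    then show False using that finite_subset[OF that(1)] by simp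
  qed
  have "C \<noteq> {}" using pp by (auto simp: C_def is_path_def)
  then have c1: "k < card C" by (intro big Cn nb(1))
  have c2: "k < card ({..<n} - C)" by (intro big D0 nb(2)) auto
  have sub: "(\<lambda>(c, w). {c, w}) ` (C \<times> ({..<n} - C)) \<subseteq> boosters n E"
  proof clarify
    fix c w assume cw: "c \<in> C" "w < n" "w \<notin> C"
    have "{c, w} \<in> all_edges n" using cw Cn by (auto simp: all_edges_def card_insert_if)
    moreover have "path_length n E < path_length n (insert {c, w} E)"
      by (rule ext[of _ c w]) (use cw in auto)
    then have "path_rank n E < path_rank n (insert {c, w} E)" unfolding path_rank_def by simp
    ultimately show "{c, w} \<in> boosters n E" using cross[of c w] cw by (simp add: boosters_def)
  qed
  have "inj_on (\<lambda>(c, w). {c, w}) (C \<times> ({..<n} - C))"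
    by (auto simp: inj_on_def doubleton_eq_iff)
  then have "card C * card ({..<n} - C) \<le> card (boosters n E)"
    using card_mono[OF _ sub] by (simp add: card_image card_cartesian_product boosters_def finite_all_edges)
  moreover have "(k + 1) * (k + 1) \<le> card C * card ({..<n} - C)"
    by (rule mult_mono) (use c1 c2 in auto)
  ultimately show ?thesis by (simp add: power2_eq_square)
qed

section \<open>Random offers and supermartingales\<close>

lemma card_subsets_avoiding:
  assumes "finite X" "F \<subseteq> X"
  shows "card {S. S \<subseteq> X \<and> card S = K \<and> S \<inter> F = {}} = (card X - card F) choose K"
proof -
  have "{S. S \<subseteq> X \<and> card S = K \<and> S \<inter> F = {}} = {S. S \<subseteq> X - F \<and> card S = K}" by blast
  also have "card \<dots> = card (X - F) choose K" by (rule n_subsets) (use assms in auto)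
  finally show ?thesis using assms by (simp add: card_Diff_subset finite_subset)
qed

lemma card_subsets_meeting_once:
  assumes "finite X" "F \<subseteq> X" "e \<in> F" "K \<ge> 1"
  shows "card {S. S \<subseteq> X \<and> card S = K \<and> S \<inter> F = {e}} = (card X - card F) choose (K - 1)"
proof -
  have inj: "inj_on (insert e) {S. S \<subseteq> X - F \<and> card S = K - 1}"
    using assms(3) by (intro inj_onI) (metis (no_types, lifting) DiffE insert_ident mem_Collect_eq subsetD)
  have "{S. S \<subseteq> X \<and> card S = K \<and> S \<inter> F = {e}} = insert e ` {S. S \<subseteq> X - F \<and> card S = K - 1}"
    (is "?L = ?R")
  proof
    show "?L \<subseteq> ?R"
    proof
      fix S assume S: "S \<in> ?L"
      then have "e \<in> S" "finite S" using assms(1) finite_subset by auto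
      then have "S = insert e (S - {e})" "S - {e} \<subseteq> X - F" "card (S - {e}) = K - 1" using S by auto
      then show "S \<in> ?R" by blast
    qed
    show "?R \<subseteq> ?L"
    proof clarify
      fix S assume S: "S \<subseteq> X - F" "card S = K - 1"
      have "finite S" "e \<notin> S" using S assms finite_subset[of S X] by auto
      then have "card (insert e S) = K" using S assms(4) by simp
      then show "insert e S \<subseteq> X \<and> card (insert e S) = K \<and> insert e S \<inter> F = {e}"
        using S assms by blast
    qed
  qed
  then have "card {S. S \<subseteq> X \<and> card S = K \<and> S \<inter> F = {e}} = card {S. S \<subseteq> X - F \<and> card S = K - 1}"
    using card_image[OF inj] by metis
  also have "\<dots> = card (X - F) choose (K - 1)" by (rule n_subsets) (use assms in auto)
  finally show ?thesis using assms by (simp add: card_Diff_subset finite_subset)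
qed

text \<open>Union bound: a given element lies in a fraction \<open>j / N\<close> of all
  \<open>j\<close>-subsets. In the induction, Pascal's rule and monotonicity show that each removed
  element destroys at most that many.\<close>

lemma binomial_diff_ge:
  assumes "i \<le> N"
  shows "real (N choose j) * (1 - real i * real j / real N) \<le> real ((N - i) choose j)"
  using assms
proof (induction i)
  case 0 then show ?case by simp
next
  case (Suc i)
  show ?case
  proof (cases "j = 0")
    case True then show ?thesis by simp
  next
    case False
    have N: "N > 0" using Suc by simp
    have abs: "real ((N - 1) choose (j - 1)) = real j / real N * real (N choose j)"
    proof -
      have "j * (N choose j) = N * ((N - 1) choose (j - 1))" using False by (simp add: times_binomial_minus1_eq)
      then have "real j * real (N choose j) = real N * real ((N - 1) choose (j - 1))"
        by (metis of_nat_mult)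
      then show ?thesis using N by (simp add: field_simps)
    qed
    have red: "(N - i) choose j = ((N - i - 1) choose (j - 1)) + ((N - i - 1) choose j)"
      by (rule choose_reduce_nat) (use False Suc in auto)
    have "((N - i - 1) choose (j - 1)) \<le> ((N - 1) choose (j - 1))"
      by (rule binomial_right_mono) simp
    then have "real ((N - i) choose j) - real j / real N * real (N choose j) \<le> real ((N - Suc i) choose j)"
      using red abs by simp
    moreover have "real (N choose j) * (1 - real i * real j / real N) \<le> real ((N - i) choose j)"
      using Suc by simp
    ultimately show ?thesis by (simp add: field_simps add_divide_distrib)
  qed
qed

text \<open>A fraction \<open>K / M\<close> of all offers contains a prescribed edge. The union
  bound for the other \<open>L - 1\<close> edges against the other \<open>K - 1\<close> places gives
  the last factor, weakened to a form without the subtracted ones.\<close>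

lemma meeting_once_ge:
  assumes "1 \<le> L" "L \<le> M" "1 \<le> K"
  shows "real (M choose K) * (real K / real M) * (1 - real L * real K / real M)
    \<le> real ((M - L) choose (K - 1))"
proof -
  have "K * (M choose K) = M * ((M - 1) choose (K - 1))" using assms by (simp add: times_binomial_minus1_eq)
  then have "real K * real (M choose K) = real M * real ((M - 1) choose (K - 1))"
    by (metis of_nat_mult)
  then have abs: "real (M choose K) * (real K / real M) = real ((M - 1) choose (K - 1))"
    using assms by (simp add: field_simps)
  have "real (L - 1) * real (K - 1) / real (M - 1) \<le> real L * real K / real M"
  proof (cases "M = 1")
    case True then show ?thesis by simp
  next
    case False
    have "(real L - 1) / (real M - 1) \<le> real L / real M"
      using False assms by (simp add: field_simps)
    then have "(real L - 1) / (real M - 1) * (real K - 1) \<le> real L / real M * real K"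
      using assms by (intro mult_mono) auto
    then show ?thesis using assms False by (simp add: of_nat_diff)
  qed
  then have "real ((M - 1) choose (K - 1)) * (1 - real L * real K / real M) \<le>
      real ((M - 1) choose (K - 1)) * (1 - real (L - 1) * real (K - 1) / real (M - 1))"
    by (intro mult_left_mono) auto
  also have "\<dots> \<le> real ((M - 1 - (L - 1)) choose (K - 1))"
    by (rule binomial_diff_ge) (use assms in auto)
  finally show ?thesis using abs assms by simp
qed

text \<open>This keeps only the chance that one of the \<open>K\<close> edges hits, so no factor
  \<open>K\<close> is gained; that suffices for boosters, which have positive density.\<close>

lemma avoiding_le:
  assumes "L \<le> M" "1 \<le> K" "1 \<le> M"
  shows "real ((M - L) choose K) \<le> real (M choose K) * (1 - real L / real M)"
proof -
  have 1: "real K * real (M choose K) = real M * real ((M - 1) choose (K - 1))"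
    using assms times_binomial_minus1_eq[of K M] by (metis of_nat_mult less_eq_Suc_le One_nat_def)
  have 2: "real K * real ((M - L) choose K) = real (M - L) * real ((M - L - 1) choose (K - 1))"
    using assms times_binomial_minus1_eq[of K "M - L"] by (metis of_nat_mult less_eq_Suc_le One_nat_def)
  have "real ((M - L - 1) choose (K - 1)) \<le> real ((M - 1) choose (K - 1))"
    using binomial_right_mono[of "M - L - 1" "M - 1" "K - 1"] by simp
  then have "real K * real ((M - L) choose K) \<le> real (M - L) * real ((M - 1) choose (K - 1))"
    unfolding 2 by (rule mult_left_mono) simp
  also have "\<dots> = (1 - real L / real M) * (real K * real (M choose K))"
    unfolding 1 using assms by (simp add: field_simps of_nat_diff)
  finally have "real K * real ((M - L) choose K) \<le> real K * (real (M choose K) * (1 - real L / real M))"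
    by (simp add: mult_ac)
  then show ?thesis using assms by simp
qed

section \<open>The process: its histories and one-round averages\<close>

lemma card_all_edges: "card (all_edges n) = n choose 2"
  unfolding all_edges_def using n_subsets[of "{..<n}" 2] by simp

lemma finite_offers: "finite (offers n K E)"
proof -
  have "offers n K E \<subseteq> Pow (all_edges n)" by (auto simp: offers_def)
  then show ?thesis by (rule finite_subset) (simp add: finite_all_edges)
qed

lemma card_offers: "card (offers n K E) = card (all_edges n - E) choose K"
  unfolding offers_def by (rule n_subsets) (simp add: finite_all_edges)

lemma selected_snoc: "selected (h @ [(S, e)]) = insert e (selected h)"
  by (simp add: selected_def)

lemma finite_achlioptas: "finite (set_pmf (achlioptas n K A t))"
proof (induction t)
  case (Suc t)
  have "finite (set_pmf (if offers n K (selected h) = {} then return_pmf h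
       else map_pmf (\<lambda>S. h @ [(S, A h S)]) (pmf_of_set (offers n K (selected h)))))" for h
    by (simp add: finite_offers)
  then show ?case using Suc by simp
qed simp

lemma offers_nonempty:
  assumes "card (selected h) + K \<le> card (all_edges n)" "selected h \<subseteq> all_edges n"
  shows "offers n K (selected h) \<noteq> {}"
proof -
  have "card (all_edges n - selected h) = card (all_edges n) - card (selected h)"
    using assms(2) finite_all_edges finite_subset by (intro card_Diff_subset) blast+
  then have "0 < card (offers n K (selected h))" unfolding card_offers using assms by simp
  then show ?thesis by force
qed

text \<open>Invariant of the histories that occur while enough non-edges remain. Distinctness of the
  selected edges makes the number of non-edges a function of the length; the last clause transfers
  avoidance of a vertex from offers to selections.\<close>

definition run :: "nat \<Rightarrow> history \<Rightarrow> bool" where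
  "run n h \<longleftrightarrow> selected h \<subseteq> all_edges n \<and> card (selected h) = length h \<and> (\<forall>(S, e) \<in> set h. e \<in> S)"

text \<open>The bound has \<open>Suc\<close> because round \<open>t\<close> starts with
  \<open>t - 1\<close> selected edges; it ensures that the process has not halted before.\<close>

lemma achlioptas_run:
  assumes A: "online_algorithm n K A" and "t + K \<le> Suc (card (all_edges n))"
    and "h \<in> set_pmf (achlioptas n K A t)"
  shows "length h = t \<and> run n h"
  using assms(2,3)
proof (induction t arbitrary: h)
  case 0
  then show ?case by (auto simp: run_def selected_def)
next
  case (Suc t)
  from Suc.prems(2) obtain g where g: "g \<in> set_pmf (achlioptas n K A t)"
    "h \<in> set_pmf (if offers n K (selected g) = {} then return_pmf g
         else map_pmf (\<lambda>S. g @ [(S, A g S)]) (pmf_of_set (offers n K (selected g))))"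
    by auto
  have IH: "length g = t" "run n g" using Suc.IH[OF _ g(1)] Suc.prems(1) by auto
  have ne: "offers n K (selected g) \<noteq> {}"
    by (rule offers_nonempty) (use IH Suc.prems(1) in \<open>auto simp: run_def\<close>)
  then obtain S where S: "S \<in> offers n K (selected g)" "h = g @ [(S, A g S)]"
    using g(2) by (auto simp: finite_offers)
  have "A g S \<in> S" using A S(1) by (simp add: online_algorithm_def)
  moreover have "S \<subseteq> all_edges n - selected g" using S(1) by (simp add: offers_def)
  moreover have "finite (selected g)" by (simp add: selected_def)
  ultimately show ?case using IH unfolding S(2) run_def selected_snoc by auto
qed

lemma expectation_Suc:
  fixes f :: "history \<Rightarrow> real"
  assumes A: "online_algorithm n K A" and t: "t + K \<le> card (all_edges n)"
  shows "measure_pmf.expectation (achlioptas n K A (Suc t)) f =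
    measure_pmf.expectation (achlioptas n K A t)
      (\<lambda>h. (\<Sum>S\<in>offers n K (selected h). f (h @ [(S, A h S)])) / real (card (offers n K (selected h))))"
proof -
  let ?P = "achlioptas n K A t"
  let ?B = "\<lambda>h. if offers n K (selected h) = {} then return_pmf h
       else map_pmf (\<lambda>S. h @ [(S, A h S)]) (pmf_of_set (offers n K (selected h)))"
  have "measure_pmf.expectation (achlioptas n K A (Suc t)) f =
      (\<Sum>h\<in>set_pmf ?P. pmf ?P h *\<^sub>R measure_pmf.expectation (?B h) f)"
    unfolding achlioptas.simps
    by (rule pmf_expectation_bind) (auto simp: finite_achlioptas finite_offers)
  also have "\<dots> = (\<Sum>h\<in>set_pmf ?P. pmf ?P h *\<^sub>R
      ((\<Sum>S\<in>offers n K (selected h). f (h @ [(S, A h S)])) / real (card (offers n K (selected h)))))"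
  proof (rule sum.cong[OF refl])
    fix h assume "h \<in> set_pmf ?P"
    then have "length h = t \<and> run n h" by (intro achlioptas_run[OF A]) (use t in auto)
    then have "offers n K (selected h) \<noteq> {}"
      by (intro offers_nonempty) (use t in \<open>auto simp: run_def\<close>)
    then show "pmf ?P h *\<^sub>R measure_pmf.expectation (?B h) f = pmf ?P h *\<^sub>R
      ((\<Sum>S\<in>offers n K (selected h). f (h @ [(S, A h S)])) / real (card (offers n K (selected h))))"
      by (simp add: integral_pmf_of_set finite_offers)
  qed
  also have "\<dots> = measure_pmf.expectation ?P
      (\<lambda>h. (\<Sum>S\<in>offers n K (selected h). f (h @ [(S, A h S)])) / real (card (offers n K (selected h))))"
    by (rule integral_measure_pmf[symmetric]) (auto simp: finite_achlioptas)
  finally show ?thesis .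
qed

lemma expectation_mono_support:
  fixes f g :: "'a \<Rightarrow> real"
  assumes "finite (set_pmf p)" "\<And>x. x \<in> set_pmf p \<Longrightarrow> f x \<le> g x"
  shows "measure_pmf.expectation p f \<le> measure_pmf.expectation p g"
  using assms by (intro integral_mono_AE) (auto simp: AE_measure_pmf_iff integrable_measure_pmf_finite)

text \<open>The drift hypothesis is multiplied by the number of offers, so that a potential is
  verified by counting offers. The dependence of \<open>u\<close> on the round leaves room for a
  discount factor.\<close>

lemma supermartingale:
  fixes u :: "nat \<Rightarrow> history \<Rightarrow> real"
  assumes A: "online_algorithm n K A" and T: "T + K \<le> card (all_edges n)" and "T0 \<le> T"
    and step: "\<And>t h. T0 \<le> t \<Longrightarrow> t < T \<Longrightarrow> length h = t \<Longrightarrow> run n h \<Longrightarrow>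
      (\<Sum>S\<in>offers n K (selected h). u (Suc t) (h @ [(S, A h S)]))
        \<le> real (card (offers n K (selected h))) * u t h"
  shows "measure_pmf.expectation (achlioptas n K A T) (u T)
    \<le> measure_pmf.expectation (achlioptas n K A T0) (u T0)"
  using \<open>T0 \<le> T\<close> T step
proof (induction T rule: dec_induct)
  case base then show ?case by simp
next
  case (step t)
  have "measure_pmf.expectation (achlioptas n K A (Suc t)) (u (Suc t)) \<le>
      measure_pmf.expectation (achlioptas n K A t) (u t)"
  proof (subst expectation_Suc[OF A])
    show "t + K \<le> card (all_edges n)" using step.prems by simp
    show "measure_pmf.expectation (achlioptas n K A t)
      (\<lambda>h. (\<Sum>S\<in>offers n K (selected h). u (Suc t) (h @ [(S, A h S)])) / real (card (offers n K (selected h))))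
      \<le> measure_pmf.expectation (achlioptas n K A t) (u t)"
    proof (rule expectation_mono_support[OF finite_achlioptas])
      fix h assume "h \<in> set_pmf (achlioptas n K A t)"
      then have h: "length h = t" "run n h"
        using achlioptas_run[OF A, of t h] step.prems by auto
      then have "offers n K (selected h) \<noteq> {}"
        by (intro offers_nonempty) (use step.prems in \<open>auto simp: run_def\<close>)
      then have "0 < real (card (offers n K (selected h)))"
        by (simp add: card_gt_0_iff finite_offers)
      then show "(\<Sum>S\<in>offers n K (selected h). u (Suc t) (h @ [(S, A h S)])) /
          real (card (offers n K (selected h))) \<le> u t h"
        using step.prems(2)[of t h] h step.hyps by (simp add: divide_le_eq mult.commute)
    qed
  qed
  also have "\<dots> \<le> measure_pmf.expectation (achlioptas n K A T0) (u T0)"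
    by (rule step.IH) (use step.prems in auto)
  finally show ?case .
qed

lemma prob_le_expectation:
  assumes "finite (set_pmf p)" "\<And>x. x \<in> set_pmf p \<Longrightarrow> P x \<Longrightarrow> 1 \<le> f x"
    "\<And>x. x \<in> set_pmf p \<Longrightarrow> (0::real) \<le> f x"
  shows "measure_pmf.prob p {x. P x} \<le> measure_pmf.expectation p f"
proof -
  have "measure_pmf.prob p {x. P x} = measure_pmf.expectation p (indicat_real {x. P x})" by simp
  also have "\<dots> \<le> measure_pmf.expectation p f"
    by (rule expectation_mono_support) (use assms in \<open>auto simp: indicator_def\<close>)
  finally show ?thesis .
qed

text \<open>Truncating the discounted potential at 1 makes it a supermartingale also on the runs that
  violate \<open>Q\<close>, where nothing is known about \<open>f\<close>.\<close>

lemma phase_bound: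
  fixes f :: "history \<Rightarrow> real"
  assumes A: "online_algorithm n K A" and T: "T + K \<le> card (all_edges n)" and T0: "T0 \<le> T"
    and \<rho>: "0 \<le> \<rho>" and B0: "0 \<le> B"
    and f0: "\<And>h. run n h \<Longrightarrow> length h \<le> T \<Longrightarrow> 0 \<le> f h"
    and Q: "\<And>h S. run n h \<Longrightarrow> Q h \<Longrightarrow> S \<in> offers n K (selected h) \<Longrightarrow> length h < T \<Longrightarrow> Q (h @ [(S, A h S)])"
    and step: "\<And>h. T0 \<le> length h \<Longrightarrow> length h < T \<Longrightarrow> run n h \<Longrightarrow> Q h \<Longrightarrow>
      (\<Sum>S\<in>offers n K (selected h). f (h @ [(S, A h S)]))
        \<le> real (card (offers n K (selected h))) * (\<rho> * f h)"
    and B: "\<And>h. length h = T0 \<Longrightarrow> run n h \<Longrightarrow> Q h \<Longrightarrow> f h \<le> B"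
    and G: "\<And>h. length h = T \<Longrightarrow> run n h \<Longrightarrow> Q h \<Longrightarrow> \<not> G h \<Longrightarrow> 1 \<le> f h"
  shows "measure_pmf.prob (achlioptas n K A T) {h. \<not> G h}
    \<le> measure_pmf.prob (achlioptas n K A T0) {h. \<not> Q h} + \<rho> ^ (T - T0) * B"
proof -
  define u where "u = (\<lambda>t h. if Q h then min 1 (\<rho> ^ (T - t) * f h) else (1::real))"
  have run: "length h = t \<and> run n h" if "h \<in> set_pmf (achlioptas n K A t)" "t \<le> T" for t h
    by (rule achlioptas_run[OF A _ that(1)]) (use T that in auto)
  have "measure_pmf.prob (achlioptas n K A T) {h. \<not> G h} \<le>
      measure_pmf.expectation (achlioptas n K A T) (u T)"
  proof (rule prob_le_expectation[OF finite_achlioptas])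
    fix h assume h: "h \<in> set_pmf (achlioptas n K A T)"
    then have h': "length h = T" "run n h" using run[of h T] by auto
    show "0 \<le> u T h" using f0[of h] h' by (simp add: u_def)
    show "1 \<le> u T h" if "\<not> G h" using G[of h] h' that by (simp add: u_def)
  qed
  also have "\<dots> \<le> measure_pmf.expectation (achlioptas n K A T0) (u T0)"
  proof (rule supermartingale[OF A T T0])
    fix t h assume t: "T0 \<le> t" "t < T" and h: "length h = t" "run n h"
    let ?O = "offers n K (selected h)"
    have le1: "u (Suc t) g \<le> 1" for g by (simp add: u_def)
    have one: "(\<Sum>S\<in>?O. u (Suc t) (h @ [(S, A h S)])) \<le> real (card ?O)"
      using sum_mono[of ?O "\<lambda>S. u (Suc t) (h @ [(S, A h S)])" "\<lambda>_. 1"] le1 by simp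
    show "(\<Sum>S\<in>?O. u (Suc t) (h @ [(S, A h S)])) \<le> real (card ?O) * u t h"
    proof (cases "Q h")
      case False
      then show ?thesis using one by (simp add: u_def)
    next
      case True
      have "(\<Sum>S\<in>?O. u (Suc t) (h @ [(S, A h S)])) \<le> (\<Sum>S\<in>?O. \<rho> ^ (T - Suc t) * f (h @ [(S, A h S)]))"
        by (rule sum_mono) (use Q[OF h(2) True] h t in \<open>auto simp: u_def\<close>)
      also have "\<dots> = \<rho> ^ (T - Suc t) * (\<Sum>S\<in>?O. f (h @ [(S, A h S)]))"
        by (simp add: sum_distrib_left)
      also have "\<dots> \<le> \<rho> ^ (T - Suc t) * (real (card ?O) * (\<rho> * f h))"
        by (rule mult_left_mono) (use step[of h] h t True \<rho> in auto)
      also have "\<dots> = real (card ?O) * (\<rho> ^ (T - t) * f h)"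
        using t by (simp add: Suc_diff_Suc[symmetric] mult_ac)
      finally have "(\<Sum>S\<in>?O. u (Suc t) (h @ [(S, A h S)])) \<le> real (card ?O) * (\<rho> ^ (T - t) * f h)" .
      then have "(\<Sum>S\<in>?O. u (Suc t) (h @ [(S, A h S)])) \<le>
          min (real (card ?O) * 1) (real (card ?O) * (\<rho> ^ (T - t) * f h))" using one by simp
      also have "\<dots> = real (card ?O) * u t h" using True by (simp add: u_def min_mult_distrib_left)
      finally show ?thesis .
    qed
  qed
  also have "\<dots> \<le> measure_pmf.expectation (achlioptas n K A T0)
      (\<lambda>h. indicat_real {h. \<not> Q h} h + \<rho> ^ (T - T0) * B)"
  proof (rule expectation_mono_support[OF finite_achlioptas])
    fix h assume "h \<in> set_pmf (achlioptas n K A T0)"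
    then have h: "length h = T0" "run n h" using run[of h T0] T0 by auto
    show "u T0 h \<le> indicat_real {h. \<not> Q h} h + \<rho> ^ (T - T0) * B"
    proof (cases "Q h")
      case True
      then have "\<rho> ^ (T - T0) * f h \<le> \<rho> ^ (T - T0) * B"
        using B[of h] h \<rho> by (intro mult_left_mono) auto
      then show ?thesis using True by (simp add: u_def)
    qed (use \<rho> B0 in \<open>simp add: u_def\<close>)
  qed
  also have "\<dots> = measure_pmf.prob (achlioptas n K A T0) {h. \<not> Q h} + \<rho> ^ (T - T0) * B"
    by (subst Bochner_Integration.integral_add) (auto intro: integrable_measure_pmf_finite simp: finite_achlioptas)
  finally show ?thesis .
qed

section \<open>The serving strategy\<close>

definition needy :: "nat \<Rightarrow> nat \<Rightarrow> edge set \<Rightarrow> (nat \<Rightarrow> nat) \<Rightarrow> nat set" where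
  "needy n d E c = {v. v < n \<and> c v < 10 \<and> card {e \<in> E. v \<in> e} < d}"

text \<open>The cap \<open>m\<close> bounds the number of edges at active vertices, so that an offer
  seldom contains two of them. Without it, no offer of two or more edges could serve as long as
  every vertex is needy.\<close>

definition truncate :: "nat \<Rightarrow> nat set \<Rightarrow> nat set" where
  "truncate m X = (if card X \<le> m then X else (SOME Y. Y \<subseteq> X \<and> card Y = m))"

definition touching :: "nat set \<Rightarrow> edge set \<Rightarrow> edge set" where
  "touching Y S = {e \<in> S. e \<inter> Y \<noteq> {}}"

text \<open>Computed on the reversed history, because histories grow at the end.\<close>

primrec served_rev :: "nat \<Rightarrow> nat \<Rightarrow> nat \<Rightarrow> history \<Rightarrow> nat \<Rightarrow> nat" where
  "served_rev n m d [] = (\<lambda>v. 0)"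
| "served_rev n m d (x # xs) =
     (let Y = truncate m (needy n d (selected xs) (served_rev n m d xs)) in
      (\<lambda>v. served_rev n m d xs v + (if touching Y (fst x) = {snd x} \<and> v \<in> snd x \<inter> Y then 1 else 0)))"

definition served :: "nat \<Rightarrow> nat \<Rightarrow> nat \<Rightarrow> history \<Rightarrow> nat \<Rightarrow> nat" where
  "served n m d h = served_rev n m d (rev h)"

definition needy_after :: "nat \<Rightarrow> nat \<Rightarrow> nat \<Rightarrow> history \<Rightarrow> nat set" where
  "needy_after n m d h = needy n d (selected h) (served n m d h)"

definition active :: "nat \<Rightarrow> nat \<Rightarrow> nat \<Rightarrow> history \<Rightarrow> nat set" where
  "active n m d h = truncate m (needy_after n m d h)"

text \<open>When neither serving nor boosting applies, an arbitrary offered edge is taken: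
  additional edges preserve expansion and never lower the path rank.\<close>

definition strategy :: "nat \<Rightarrow> nat \<Rightarrow> nat \<Rightarrow> nat \<Rightarrow> algorithm" where
  "strategy n m d T1 h S =
     (if length h < T1 \<and> is_singleton (touching (active n m d h) S)
      then the_elem (touching (active n m d h) S)
      else if T1 \<le> length h \<and> S \<inter> boosters n (selected h) \<noteq> {}
      then (SOME e. e \<in> S \<inter> boosters n (selected h))
      else (SOME e. e \<in> S))"

lemma strategy_in:
  assumes "S \<noteq> {}"
  shows "strategy n m d T1 h S \<in> S"
proof -
  consider (serve) "length h < T1" "is_singleton (touching (active n m d h) S)"
    | (boost) "T1 \<le> length h" "S \<inter> boosters n (selected h) \<noteq> {}"
    | (rest) "strategy n m d T1 h S = (SOME e. e \<in> S)"
    unfolding strategy_def by fastforce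
  then show ?thesis
  proof cases
    case serve
    then obtain e where "touching (active n m d h) S = {e}" by (auto elim: is_singletonE)
    then show ?thesis using serve by (auto simp: strategy_def touching_def)
  next
    case boost
    then have "(SOME e. e \<in> S \<inter> boosters n (selected h)) \<in> S \<inter> boosters n (selected h)"
      by (meson equals0I someI_ex)
    then show ?thesis using boost by (auto simp: strategy_def)
  next
    case rest
    then show ?thesis using assms by (simp add: some_in_eq)
  qed
qed

lemma online_strategy:
  assumes "K \<ge> 1" shows "online_algorithm n K (strategy n m d T1)"
  unfolding online_algorithm_def
proof (intro allI ballI)
  fix h S assume "S \<in> offers n K (selected h)"
  then have "S \<noteq> {}" using assms by (auto simp: offers_def)
  then show "strategy n m d T1 h S \<in> S" by (rule strategy_in)
qed

lemma strategy_serve: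
  assumes "length h < T1" "touching (active n m d h) S = {e}"
  shows "strategy n m d T1 h S = e"
  using assms by (simp add: strategy_def)

lemma served_Nil: "served n m d [] v = 0"
  by (simp add: served_def)

lemma selected_rev: "selected (rev h) = selected h"
  by (simp add: selected_def)

lemma served_snoc:
  "served n m d (h @ [(S, e)]) v = served n m d h v +
     (if touching (active n m d h) S = {e} \<and> v \<in> e \<inter> active n m d h then 1 else 0)"
  by (simp add: served_def Let_def active_def needy_after_def selected_rev)

lemma served_mono: "served n m d h v \<le> served n m d (h @ [(S, e)]) v"
  by (simp add: served_snoc)

lemma finite_needy: "finite (needy_after n m d h)"
  unfolding needy_after_def needy_def by simp

lemma needy_subset: "needy_after n m d h \<subseteq> {..<n}"
  unfolding needy_after_def needy_def by auto

lemma truncate_subset: "truncate m X \<subseteq> X \<and> card (truncate m X) = min m (card X)"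
proof (cases "card X \<le> m")
  case True then show ?thesis by (simp add: truncate_def)
next
  case False
  then have "\<exists>Y. Y \<subseteq> X \<and> card Y = m" by (metis obtain_subset_with_card_n nat_le_linear)
  then have "truncate m X \<subseteq> X \<and> card (truncate m X) = m"
    using False someI_ex[of "\<lambda>Y. Y \<subseteq> X \<and> card Y = m"] by (simp add: truncate_def)
  then show ?thesis using False by simp
qed

lemma active_subset: "active n m d h \<subseteq> needy_after n m d h"
  unfolding active_def using truncate_subset by blast

lemma card_active: "card (active n m d h) = min m (card (needy_after n m d h))"
  unfolding active_def using truncate_subset by blast

lemma active_eq: "card (needy_after n m d h) \<le> m \<Longrightarrow> active n m d h = needy_after n m d h"
  unfolding active_def truncate_def by simp

lemma needy_snoc: "needy_after n m d (h @ [(S, e)]) \<subseteq> needy_after n m d h"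
proof
  fix v assume v: "v \<in> needy_after n m d (h @ [(S, e)])"
  have "card {e \<in> selected h. v \<in> e} \<le> card {e' \<in> selected (h @ [(S, e)]). v \<in> e'}"
    by (rule card_mono) (auto simp: selected_snoc selected_def)
  then show "v \<in> needy_after n m d h"
    using v served_mono[of n m d h v S e] unfolding needy_after_def needy_def by auto
qed

text \<open>Only active, hence needy, vertices are served, and their count is below 10. The
  potentials below are normalised by this maximum.\<close>

lemma served_le: "served n m d h v \<le> 10"
proof (induction h rule: rev_induct)
  case Nil then show ?case by (simp add: served_Nil)
next
  case (snoc x h)
  obtain S e where x: "x = (S, e)" by (cases x)
  have "served n m d h v < 10" if "v \<in> active n m d h"
    using that active_subset unfolding needy_after_def needy_def by fastforce
  then show ?case using snoc unfolding x served_snoc by auto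
qed

section \<open>Counting edges at a set of vertices\<close>

lemma card_edges_at:
  assumes "v < n" shows "card {e \<in> all_edges n. v \<in> e} = n - 1"
proof -
  have "{e \<in> all_edges n. v \<in> e} = (\<lambda>w. {v, w}) ` ({..<n} - {v})"
  proof
    show "{e \<in> all_edges n. v \<in> e} \<subseteq> (\<lambda>w. {v, w}) ` ({..<n} - {v})"
    proof
      fix e assume "e \<in> {e \<in> all_edges n. v \<in> e}"
      then have e: "e \<subseteq> {..<n}" "card e = 2" "v \<in> e" by (auto simp: all_edges_def)
      then obtain a b where "e = {a, b}" "a \<noteq> b" by (auto simp: card_2_iff)
      then show "e \<in> (\<lambda>w. {v, w}) ` ({..<n} - {v})" using e by (auto simp: image_iff doubleton_eq_iff)
    qed
    show "(\<lambda>w. {v, w}) ` ({..<n} - {v}) \<subseteq> {e \<in> all_edges n. v \<in> e}"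
      using assms by (auto simp: all_edges_def)
  qed
  moreover have "inj_on (\<lambda>w. {v, w}) ({..<n} - {v})" by (auto simp: inj_on_def doubleton_eq_iff)
  ultimately show ?thesis using assms by (simp add: card_image)
qed

lemma card_free_edges_at:
  assumes "v < n" "E \<subseteq> all_edges n"
  shows "card {e \<in> all_edges n - E. v \<in> e} = n - 1 - card {e \<in> E. v \<in> e}"
proof -
  have "{e \<in> all_edges n - E. v \<in> e} = {e \<in> all_edges n. v \<in> e} - {e \<in> E. v \<in> e}" by blast
  moreover have "finite {e \<in> E. v \<in> e}" using assms(2) finite_all_edges finite_subset by fastforce
  ultimately show ?thesis using assms card_edges_at[OF assms(1)]
    by (simp add: card_Diff_subset Collect_mono_iff subset_iff)
qed

text \<open>Double counting of incidences: an edge has at most two end points in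
  \<open>Z\<close>.\<close>

lemma card_touching_ge:
  assumes "finite Z" "X \<subseteq> all_edges n" "\<And>v. v \<in> Z \<Longrightarrow> a \<le> card {e \<in> X. v \<in> e}"
  shows "card Z * a \<le> 2 * card (touching Z X)"
proof -
  have finX: "finite X" using assms(2) finite_all_edges finite_subset by blast
  have "card Z * a = (\<Sum>v\<in>Z. a)" by simp
  also have "\<dots> \<le> (\<Sum>v\<in>Z. card {e \<in> X. v \<in> e})" by (rule sum_mono) (rule assms(3))
  also have "\<dots> = (\<Sum>v\<in>Z. card {e \<in> touching Z X. v \<in> e})"
    by (rule sum.cong[OF refl]) (auto simp: touching_def intro: arg_cong[where f = card])
  also have "\<dots> = (\<Sum>e\<in>touching Z X. card {v \<in> Z. v \<in> e})"
    by (rule sum_multicount_gen) (use assms(1) finX in \<open>auto simp: touching_def\<close>)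
  also have "\<dots> \<le> (\<Sum>e\<in>touching Z X. 2)"
  proof (rule sum_mono)
    fix e assume "e \<in> touching Z X"
    then have "finite e" "card e = 2"
      using assms(2) by (auto simp: touching_def all_edges_def intro: card_ge_0_finite)
    then show "card {v \<in> Z. v \<in> e} \<le> 2" using card_mono[of e "{v \<in> Z. v \<in> e}"] by auto
  qed
  finally show ?thesis by simp
qed

lemma card_touching_le:
  assumes "finite Z" "Z \<subseteq> {..<n}" "X \<subseteq> all_edges n"
  shows "card (touching Z X) \<le> card Z * n"
proof -
  have "touching Z X \<subseteq> (\<Union>v\<in>Z. {e \<in> all_edges n. v \<in> e})" using assms(3) by (auto simp: touching_def)
  then have "card (touching Z X) \<le> card (\<Union>v\<in>Z. {e \<in> all_edges n. v \<in> e})"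
    by (rule card_mono[rotated]) (use assms(1) in \<open>auto simp: finite_all_edges\<close>)
  also have "\<dots> \<le> (\<Sum>v\<in>Z. card {e \<in> all_edges n. v \<in> e})" by (rule card_UN_le[OF assms(1)])
  also have "\<dots> \<le> (\<Sum>v\<in>Z. n)" by (rule sum_mono) (use assms(2) card_edges_at in auto)
  finally show ?thesis by simp
qed

text \<open>The drift of a potential \<open>\<phi>\<close> under service: \<open>F\<close> will be
  the set of hot edges and \<open>F'\<close> those that matter for the potential. For each
  \<open>e\<close> in \<open>F'\<close> exactly \<open>g\<close> offers meet \<open>F\<close> in
  \<open>e\<close> alone, and these families are disjoint; all remaining offers are charged the
  default \<open>b\<close>.\<close>

lemma sum_meeting_once_le:
  fixes \<phi> :: "'a set \<Rightarrow> real"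
  assumes "finite X" "F \<subseteq> X" "F' \<subseteq> F" "K \<ge> 1"
    and W: "W = {S. S \<subseteq> X \<and> card S = K}" and g: "g = (card X - card F) choose (K - 1)"
    and once: "\<And>S e. S \<in> W \<Longrightarrow> e \<in> F' \<Longrightarrow> S \<inter> F = {e} \<Longrightarrow> \<phi> S \<le> \<psi> e"
    and rest: "\<And>S. S \<in> W \<Longrightarrow> (\<And>e. e \<in> F' \<Longrightarrow> S \<inter> F \<noteq> {e}) \<Longrightarrow> \<phi> S \<le> b"
  shows "(\<Sum>S\<in>W. \<phi> S) \<le> real g * (\<Sum>e\<in>F'. \<psi> e) + b * (real (card W) - real g * real (card F'))"
proof -
  define We where "We = (\<lambda>e. {S \<in> W. S \<inter> F = {e}})"
  have finW: "finite W" unfolding W using assms(1) by simp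
  have finF': "finite F'" using assms(1-3) finite_subset by metis
  have cWe: "card (We e) = g" if "e \<in> F'" for e
    using card_subsets_meeting_once[of X F e K] that assms(1-4) unfolding We_def W g
    by (auto simp: conj_ac)
  have finWe: "finite (We e)" for e using finW by (simp add: We_def)
  define U where "U = (\<Union>e\<in>F'. We e)"
  have disj: "\<forall>i\<in>F'. \<forall>j\<in>F'. i \<noteq> j \<longrightarrow> We i \<inter> We j = {}" by (auto simp: We_def)
  have UW: "U \<subseteq> W" by (auto simp: U_def We_def)
  have cU: "card U = card F' * g"
    unfolding U_def by (subst card_UN_disjoint) (use finF' finWe disj cWe in auto)
  have "(\<Sum>S\<in>W. \<phi> S) = (\<Sum>S\<in>U. \<phi> S) + (\<Sum>S\<in>W - U. \<phi> S)"
    by (rule sum.subset_diff[OF UW finW, THEN trans]) simp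
  also have "(\<Sum>S\<in>U. \<phi> S) = (\<Sum>e\<in>F'. \<Sum>S\<in>We e. \<phi> S)"
    unfolding U_def by (rule sum.UNION_disjoint) (use finF' finWe disj in auto)
  also have "\<dots> \<le> (\<Sum>e\<in>F'. \<Sum>S\<in>We e. \<psi> e)"
    by (intro sum_mono once) (auto simp: We_def)
  also have "\<dots> = real g * (\<Sum>e\<in>F'. \<psi> e)" using cWe by (simp add: sum_distrib_left)
  also have "(\<Sum>S\<in>W - U. \<phi> S) \<le> (\<Sum>S\<in>W - U. b)"
    by (intro sum_mono rest) (auto simp: U_def We_def)
  also have "\<dots> = b * (real (card W) - real g * real (card F'))"
    using UW finW cU card_mono[OF finW UW] by (simp add: card_Diff_subset finite_subset of_nat_diff mult_ac)
  finally show ?thesis by simp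
qed

lemma real_card_all_edges: "real (card (all_edges n)) = real n * (real n - 1) / 2"
proof (cases n)
  case 0 then show ?thesis by (simp add: card_all_edges)
next
  case (Suc k)
  have "2 * (n choose 2) = n * ((n - 1) choose 1)" using times_binomial_minus1_eq[of 2 n] by simp
  then have "2 * real (n choose 2) = real n * real k"
    using Suc by (metis binomial_1 choose_one diff_Suc_1 of_nat_mult of_nat_numeral)
  then show ?thesis using Suc by (simp add: card_all_edges)
qed

text \<open>The relative error of the service rate is governed by \<open>\<eta>\<close>. A product
  \<open>m * K\<close> of order \<open>\<eta> * n\<close> keeps double hits rare and yet lets a
  constant fraction of the rounds serve; the bound on \<open>d\<close> leaves an active vertex
  almost all of its edges; and the last bound keeps at least \<open>(real n)\<^sup>2 / 4\<close>
  pairs free up to \<open>T1\<close>.\<close>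

locale serving =
  fixes n K m d T1 :: nat and \<eta> :: real
  assumes K1: "1 \<le> K" and \<eta>0: "0 < \<eta>" and \<eta>1: "\<eta> \<le> 1 / 10" and n4: "4 \<le> n"
    and mK: "real m * real K \<le> \<eta> * real n" and mK': "\<eta> / 2 * real n \<le> real m * real K"
    and d: "(1 - 2 * \<eta>) * real n \<le> real n - 1 - real d"
    and T1K: "T1 + K \<le> card (all_edges n)"
    and T1: "(real n)\<^sup>2 \<le> 4 * (real (card (all_edges n)) - real T1)"
begin

abbreviation "cnt h \<equiv> served n m d h"
abbreviation "ndy h \<equiv> needy_after n m d h"
abbreviation "act h \<equiv> active n m d h"
abbreviation "alg \<equiv> strategy n m d T1"

text \<open>\<open>hot h\<close> are the available edges at an active vertex, and \<open>once h\<close> is the number of offers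
  that meet them in one prescribed edge. It does not depend on that edge: given that a round serves,
  the served edge is uniform on \<open>hot h\<close>.\<close>

definition free :: "history \<Rightarrow> edge set" where "free h = all_edges n - selected h"
definition hot :: "history \<Rightarrow> edge set" where "hot h = touching (act h) (free h)"
definition once :: "history \<Rightarrow> nat" where
  "once h = (card (free h) - card (hot h)) choose (K - 1)"

lemma finite_free: "finite (free h)" by (simp add: free_def finite_all_edges)
lemma hot_sub: "hot h \<subseteq> free h" by (auto simp: hot_def touching_def)
lemma finite_act: "finite (act h)" by (rule finite_subset[OF active_subset finite_needy])
lemma act_sub: "act h \<subseteq> {..<n}" by (rule order_trans[OF active_subset needy_subset])

lemma m_pos: "0 < m"
proof (rule ccontr)
  assume "\<not> 0 < m"
  then have "\<eta> / 2 * real n \<le> 0" using mK' by simp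
  moreover have "0 < \<eta> / 2 * real n" using \<eta>0 n4 by (intro mult_pos_pos) auto
  ultimately show False by simp
qed

lemma offers_eq: "offers n K (selected h) = {S. S \<subseteq> free h \<and> card S = K}"
  by (simp add: offers_def free_def)

lemma touching_hot: "S \<in> offers n K (selected h) \<Longrightarrow> touching (act h) S = S \<inter> hot h"
  by (auto simp: offers_eq touching_def hot_def)

lemma alg_online: "online_algorithm n K alg"
  by (rule online_strategy[OF K1])

lemma serve_once:
  assumes "length h < T1" "S \<in> offers n K (selected h)" "S \<inter> hot h = {e}"
  shows "alg h S = e"
    "cnt (h @ [(S, alg h S)]) v = cnt h v + (if v \<in> e \<inter> act h then 1 else 0)"
proof -
  have t: "touching (act h) S = {e}" using assms touching_hot by simp
  show 1: "alg h S = e" by (rule strategy_serve[OF assms(1) t])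
  show "cnt (h @ [(S, alg h S)]) v = cnt h v + (if v \<in> e \<inter> act h then 1 else 0)"
    unfolding 1 served_snoc using t by simp
qed

lemma serve_none:
  assumes "S \<in> offers n K (selected h)" "v \<in> V" "\<And>e. e \<inter> V \<inter> act h \<noteq> {} \<Longrightarrow> e \<in> hot h \<Longrightarrow> S \<inter> hot h \<noteq> {e}"
  shows "cnt (h @ [(S, alg h S)]) v = cnt h v"
proof -
  have "\<not> (touching (act h) S = {alg h S} \<and> v \<in> alg h S \<inter> act h)"
  proof
    assume a: "touching (act h) S = {alg h S} \<and> v \<in> alg h S \<inter> act h"
    then have "S \<inter> hot h = {alg h S}" using touching_hot[OF assms(1)] by simp
    moreover have "alg h S \<inter> V \<inter> act h \<noteq> {}" using a assms(2) by blast
    ultimately show False using assms(3)[of "alg h S"] by blast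
  qed
  then show ?thesis unfolding served_snoc by auto
qed

lemma card_free:
  assumes "run n h" "length h \<le> T1"
  shows "(real n)\<^sup>2 / 4 \<le> real (card (free h))" "real (card (free h)) \<le> (real n)\<^sup>2 / 2"
proof -
  have "card (free h) = card (all_edges n) - length h"
    using assms finite_all_edges finite_subset unfolding free_def run_def by (metis card_Diff_subset)
  moreover have "length h \<le> card (all_edges n)" using assms T1K by simp
  ultimately have *: "real (card (free h)) = real (card (all_edges n)) - real (length h)" by simp
  show "(real n)\<^sup>2 / 4 \<le> real (card (free h))" using * T1 assms(2) by simp
  have "real (card (all_edges n)) \<le> (real n)\<^sup>2 / 2"
    by (simp add: real_card_all_edges power2_eq_square algebra_simps)
  then show "real (card (free h)) \<le> (real n)\<^sup>2 / 2" using * by simp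
qed

lemma card_free_at_active:
  assumes "run n h" "v \<in> act h"
  shows "(1 - 2 * \<eta>) * real n \<le> real (card {e \<in> free h. v \<in> e})"
proof -
  have "v < n" "card {e \<in> selected h. v \<in> e} < d"
    using assms(2) active_subset[of n m d h] by (auto simp: needy_after_def needy_def)
  then have "n - 1 - d \<le> card {e \<in> free h. v \<in> e}"
    unfolding free_def using card_free_edges_at[of v n "selected h"] assms(1) by (simp add: run_def)
  then show ?thesis using d by linarith
qed

lemma card_hot_ge:
  assumes "run n h"
  shows "real (card (act h)) * ((1 - 2 * \<eta>) * real n) \<le> 2 * real (card (hot h))"
proof -
  have "card (act h) * nat \<lceil>(1 - 2 * \<eta>) * real n\<rceil> \<le> 2 * card (hot h)"
    unfolding hot_def
  proof (rule card_touching_ge[OF finite_act])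
    show "free h \<subseteq> all_edges n" by (auto simp: free_def)
    fix v assume "v \<in> act h"
    from card_free_at_active[OF assms this] show "nat \<lceil>(1 - 2 * \<eta>) * real n\<rceil> \<le> card {e \<in> free h. v \<in> e}"
      by linarith
  qed
  then have "real (card (act h)) * real (nat \<lceil>(1 - 2 * \<eta>) * real n\<rceil>) \<le> 2 * real (card (hot h))"
    by (metis of_nat_mult of_nat_le_iff of_nat_numeral)
  moreover have "(1 - 2 * \<eta>) * real n \<le> real (nat \<lceil>(1 - 2 * \<eta>) * real n\<rceil>)" by linarith
  ultimately show ?thesis by (meson mult_left_mono of_nat_0_le_iff order_trans)
qed

text \<open>A free edge is offered with probability \<open>K\<close> over the number of free pairs,
  which is at most \<open>(real n)\<^sup>2 / 2\<close>. There are at most \<open>m * n\<close> hot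
  edges, so \<open>m * K \<le> \<eta> * n\<close> together with at least
  \<open>(real n)\<^sup>2 / 4\<close> free pairs bounds the expected number of other hits by
  \<open>4 * \<eta>\<close>.\<close>

lemma once_ge:
  assumes "run n h" "length h \<le> T1" "act h \<noteq> {}"
  shows "real (card (offers n K (selected h))) * (2 * real K / (real n)\<^sup>2 * (1 - 4 * \<eta>)) \<le> real (once h)"
proof (cases "hot h = {}")
  case True
  then have "real (card (act h)) * ((1 - 2 * \<eta>) * real n) \<le> 0" using card_hot_ge[OF assms(1)] by simp
  moreover have "0 < real (card (act h)) * ((1 - 2 * \<eta>) * real n)"
    using assms(3) finite_act \<eta>1 n4 by (intro mult_pos_pos) (auto simp: card_gt_0_iff)
  ultimately show ?thesis by linarith
next
  case False
  let ?M = "card (free h)" and ?L = "card (hot h)"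
  have finh: "finite (hot h)" using finite_free hot_sub finite_subset by blast
  have L1: "1 \<le> ?L" using False finh by (simp add: Suc_le_eq card_gt_0_iff)
  have LM: "?L \<le> ?M" by (rule card_mono[OF finite_free hot_sub])
  have M: "(real n)\<^sup>2 / 4 \<le> real ?M" "real ?M \<le> (real n)\<^sup>2 / 2" using card_free[OF assms(1,2)] by auto
  have M0: "0 < real ?M" using L1 LM by simp
  have n0: "0 < real n" using n4 by simp
  have "?L \<le> card (act h) * n"
    unfolding hot_def by (rule card_touching_le[OF finite_act act_sub]) (auto simp: free_def)
  also have "\<dots> \<le> m * n" using card_active[of n m d h] by simp
  finally have "real ?L \<le> real (m * n)" by (rule of_nat_mono)
  then have "real ?L * real K \<le> real (m * n) * real K" by (rule mult_right_mono) simp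
  also have "\<dots> = real m * real K * real n" by simp
  also have "\<dots> \<le> \<eta> * real n * real n" by (rule mult_right_mono[OF mK]) simp
  also have "\<dots> = 4 * \<eta> * ((real n)\<^sup>2 / 4)" by (simp add: power2_eq_square)
  also have "\<dots> \<le> 4 * \<eta> * real ?M" by (rule mult_left_mono[OF M(1)]) (use \<eta>0 in simp)
  finally have LK: "real ?L * real K / real ?M \<le> 4 * \<eta>" using M0 by (simp add: divide_le_eq)
  have KM: "2 * real K / (real n)\<^sup>2 \<le> real K / real ?M"
  proof -
    have "real K / ((real n)\<^sup>2 / 2) \<le> real K / real ?M"
      by (rule divide_left_mono[OF M(2)]) (use M0 n0 in auto)
    then show ?thesis by (simp add: mult.commute)
  qed
  have "2 * real K / (real n)\<^sup>2 * (1 - 4 * \<eta>) \<le> real K / real ?M * (1 - real ?L * real K / real ?M)"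
    by (rule mult_mono[OF KM]) (use LK \<eta>1 in auto)
  then have "real (?M choose K) * (2 * real K / (real n)\<^sup>2 * (1 - 4 * \<eta>)) \<le>
      real (?M choose K) * (real K / real ?M * (1 - real ?L * real K / real ?M))"
    by (rule mult_left_mono) simp
  also have "\<dots> \<le> real (once h)"
    using meeting_once_ge[OF L1 LM K1] by (simp add: once_def mult.assoc)
  finally show ?thesis by (simp add: card_offers free_def)
qed

text \<open>At most \<open>10 * n\<close> services can ever happen. While more than \<open>m\<close>
  vertices are needy, exactly \<open>m\<close> are active, a round serves with probability at least
  \<open>\<eta> / 5\<close>, and a service at least halves the potential: hence the rate
  \<open>\<eta> / 10\<close>.\<close>

lemma needy_few:
  assumes "TA \<le> T1"
  shows "measure_pmf.prob (achlioptas n K alg TA) {h. \<not> card (ndy h) \<le> m} \<le> (1 - \<eta> / 10) ^ TA * 2 ^ (10 * n)"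
proof -
  \<comment> \<open>This is 2 to the number of services still possible, and 0 once few vertices are
    needy; the latter state persists because the needy set only shrinks.\<close>
  define f where "f = (\<lambda>h. if card (ndy h) \<le> m then 0 else 2 ^ (10 * n) * (1 / 2 :: real) ^ (\<Sum>v<n. cnt h v))"
  have "measure_pmf.prob (achlioptas n K alg TA) {h. \<not> card (ndy h) \<le> m} \<le>
    measure_pmf.prob (achlioptas n K alg 0) {h. \<not> True} + (1 - \<eta> / 10) ^ (TA - 0) * 2 ^ (10 * n)"
  proof (rule phase_bound[OF alg_online, where f = f and Q = "\<lambda>_. True"])
    show "TA + K \<le> card (all_edges n)" using assms T1K by simp
    show "0 \<le> 1 - \<eta> / 10" using \<eta>1 by simp
    show "0 \<le> f h" for h by (simp add: f_def)
    show "f h \<le> 2 ^ (10 * n)" for h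
      by (auto simp: f_def power_le_one intro!: mult_left_le)
    fix h :: history
    show "1 \<le> f h" if nG: "\<not> card (ndy h) \<le> m"
    proof -
      have "(\<Sum>v<n. cnt h v) \<le> (\<Sum>v<n. 10)" by (rule sum_mono) (rule served_le)
      then have "(1 / 2 :: real) ^ (10 * n) \<le> (1 / 2) ^ (\<Sum>v<n. cnt h v)"
        by (intro power_decreasing) (auto simp: mult.commute)
      then have "2 ^ (10 * n) * (1 / 2 :: real) ^ (10 * n) \<le> f h" using nG by (simp add: f_def)
      then show ?thesis by (simp add: power_mult_distrib[symmetric])
    qed
    assume len: "length h < TA" and run: "run n h"
    let ?O = "offers n K (selected h)"
    show "(\<Sum>S\<in>?O. f (h @ [(S, alg h S)])) \<le> real (card ?O) * ((1 - \<eta> / 10) * f h)"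
    proof (cases "card (ndy h) \<le> m")
      case True
      have "f (h @ [(S, alg h S)]) = 0" for S
        using card_mono[OF finite_needy needy_snoc, of n m d h S "alg h S"] True by (simp add: f_def)
      moreover have "f h = 0" using True by (simp add: f_def)
      ultimately show ?thesis by simp
    next
      case False
      have fh: "f h = 2 ^ (10 * n) * (1 / 2 :: real) ^ (\<Sum>v<n. cnt h v)" using False by (simp add: f_def)
      have mono: "f (h @ [(S, alg h S)]) \<le> 2 ^ (10 * n) * (1 / 2 :: real) ^ (\<Sum>v<n. cnt (h @ [(S, alg h S)]) v)" for S
        by (simp add: f_def)
      have cact: "card (act h) = m" using False card_active[of n m d h] by simp
      have "(\<Sum>S\<in>?O. f (h @ [(S, alg h S)])) \<le> real (once h) * (\<Sum>e\<in>hot h. f h / 2) +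
          f h * (real (card ?O) - real (once h) * real (card (hot h)))"
      proof (rule sum_meeting_once_le[OF finite_free hot_sub order_refl K1 offers_eq once_def])
        fix S e assume S: "S \<in> ?O" "e \<in> hot h" "S \<inter> hot h = {e}"
        have len': "length h < T1" using len assms by simp
        note cs = serve_once(2)[OF len' S(1,3)]
        obtain v where v: "v \<in> e \<inter> act h" using S(2) by (auto simp: hot_def touching_def)
        have "Suc (\<Sum>v<n. cnt h v) \<le> (\<Sum>v<n. cnt (h @ [(S, alg h S)]) v)"
        proof -
          have "v < n" using v act_sub by auto
          have "(\<Sum>w<n. cnt h w) + (\<Sum>w<n. if w = v then 1 else 0) \<le> (\<Sum>v<n. cnt (h @ [(S, alg h S)]) v)"
            unfolding sum.distrib[symmetric] by (rule sum_mono) (use cs v in auto)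
          then show ?thesis using \<open>v < n\<close> by simp
        qed
        then have "(1 / 2 :: real) ^ (\<Sum>v<n. cnt (h @ [(S, alg h S)]) v) \<le> (1 / 2) ^ Suc (\<Sum>v<n. cnt h v)"
          by (intro power_decreasing) auto
        then have "2 ^ (10 * n) * (1 / 2 :: real) ^ (\<Sum>v<n. cnt (h @ [(S, alg h S)]) v) \<le>
            2 ^ (10 * n) * (1 / 2) ^ Suc (\<Sum>v<n. cnt h v)" by (rule mult_left_mono) simp
        also have "\<dots> = f h / 2" using fh by simp
        finally show "f (h @ [(S, alg h S)]) \<le> f h / 2" by (rule order_trans[OF mono])
      next
        fix S
        have "(\<Sum>v<n. cnt h v) \<le> (\<Sum>v<n. cnt (h @ [(S, alg h S)]) v)"
          by (rule sum_mono) (rule served_mono)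
        then have "(1 / 2 :: real) ^ (\<Sum>v<n. cnt (h @ [(S, alg h S)]) v) \<le> (1 / 2) ^ (\<Sum>v<n. cnt h v)"
          by (intro power_decreasing) auto
        then have "2 ^ (10 * n) * (1 / 2 :: real) ^ (\<Sum>v<n. cnt (h @ [(S, alg h S)]) v) \<le> f h"
          unfolding fh by (rule mult_left_mono) simp
        then show "f (h @ [(S, alg h S)]) \<le> f h" by (rule order_trans[OF mono])
      qed
      also have "\<dots> = f h * (real (card ?O) - real (once h) * real (card (hot h)) / 2)"
        by (simp add: algebra_simps)
      also have "\<dots> \<le> f h * (real (card ?O) * (1 - \<eta> / 10))"
      proof (rule mult_left_mono)
        have n0: "0 < real n" using n4 by simp
        have "act h \<noteq> {}" using cact m_pos by auto
        then have o: "real (card ?O) * (2 * real K / (real n)\<^sup>2 * (1 - 4 * \<eta>)) \<le> real (once h)"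
          using once_ge[OF run] len assms by simp
        have ht: "real m * ((1 - 2 * \<eta>) * real n) / 2 \<le> real (card (hot h))"
          using card_hot_ge[OF run] cact by simp
        \<comment> \<open>Here \<open>\<eta> / 2\<close> stands for the lower bound on
          \<open>m * K / n\<close>; the two correction factors are at least 8/10 and 6/10, with
          product above 2/5.\<close>
        have "\<eta> / 5 \<le> (\<eta> / 2) * (1 - 2 * \<eta>) * (1 - 4 * \<eta>)"
        proof -
          have "(8 / 10) * (6 / 10) \<le> (1 - 2 * \<eta>) * (1 - 4 * \<eta>)" by (rule mult_mono) (use \<eta>1 in auto)
          then have "\<eta> * (2 / 5) \<le> \<eta> * ((1 - 2 * \<eta>) * (1 - 4 * \<eta>))"
            by (intro mult_left_mono) (use \<eta>0 in auto)
          then show ?thesis by simp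
        qed
        also have "\<dots> \<le> (real m * real K / real n) * (1 - 2 * \<eta>) * (1 - 4 * \<eta>)"
        proof -
          have "\<eta> / 2 \<le> real m * real K / real n" using mK' n0 by (simp add: le_divide_eq)
          then show ?thesis by (intro mult_right_mono) (use \<eta>1 in auto)
        qed
        also have "\<dots> = (2 * real K / (real n)\<^sup>2 * (1 - 4 * \<eta>)) * (real m * ((1 - 2 * \<eta>) * real n) / 2)"
          using n0 by (simp add: power2_eq_square field_simps)
        finally have c: "\<eta> / 5 \<le> (2 * real K / (real n)\<^sup>2 * (1 - 4 * \<eta>)) * (real m * ((1 - 2 * \<eta>) * real n) / 2)" .
        have "real (card ?O) * (\<eta> / 5) \<le> real (card ?O) * ((2 * real K / (real n)\<^sup>2 * (1 - 4 * \<eta>)) * (real m * ((1 - 2 * \<eta>) * real n) / 2))"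
          by (rule mult_left_mono[OF c]) simp
        also have "\<dots> = (real (card ?O) * (2 * real K / (real n)\<^sup>2 * (1 - 4 * \<eta>))) * (real m * ((1 - 2 * \<eta>) * real n) / 2)"
          by (simp add: mult_ac)
        also have "\<dots> \<le> real (once h) * real (card (hot h))"
          by (rule mult_mono[OF o ht]) (use \<eta>1 in auto)
        finally show "real (card ?O) - real (once h) * real (card (hot h)) / 2 \<le> real (card ?O) * (1 - \<eta> / 10)"
          by (simp add: algebra_simps)
        show "0 \<le> f h" by (simp add: f_def)
      qed
      finally show ?thesis by (simp add: mult_ac)
    qed
  qed auto
  then show ?thesis by simp
qed

text \<open>Each needy vertex has weight \<open>\<eta>\<close> to the number of its services. A
  service removes all but a fraction \<open>\<eta>\<close> of its weight, almost as good as removing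
  the vertex, so asking for ten services costs only the factor \<open>1 - \<eta>\<close> in the rate
  and the constant \<open>\<eta> ^ 10\<close>. With base 1/2 the rate would be halved and the
  leading constant lost.\<close>

lemma needy_none:
  assumes "TA \<le> T1"
  shows "measure_pmf.prob (achlioptas n K alg T1) {h. \<not> ndy h = {}} \<le>
    measure_pmf.prob (achlioptas n K alg TA) {h. \<not> card (ndy h) \<le> m} +
    (1 - (1 - \<eta>) * (2 * real K / real n * (1 - 2 * \<eta>) * (1 - 4 * \<eta>))) ^ (T1 - TA) * (real n / \<eta> ^ 10)"
proof (rule phase_bound[OF alg_online T1K assms, where f = "\<lambda>h. (\<Sum>v\<in>ndy h. \<eta> ^ cnt h v) / \<eta> ^ 10"])
  let ?p = "2 * real K / real n * (1 - 2 * \<eta>) * (1 - 4 * \<eta>)"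
  have n0: "0 < real n" using n4 by simp
  show "0 \<le> real n / \<eta> ^ 10" using \<eta>0 by simp
  show "0 \<le> (\<Sum>v\<in>ndy h. \<eta> ^ cnt h v) / \<eta> ^ 10" for h
    using \<eta>0 by (intro divide_nonneg_nonneg sum_nonneg) auto
  show "(\<Sum>v\<in>ndy h. \<eta> ^ cnt h v) / \<eta> ^ 10 \<le> real n / \<eta> ^ 10" for h
  proof (rule divide_right_mono)
    have "(\<Sum>v\<in>ndy h. \<eta> ^ cnt h v) \<le> (\<Sum>v\<in>ndy h. 1)"
      by (rule sum_mono) (use \<eta>0 \<eta>1 in \<open>auto intro: power_le_one\<close>)
    also have "\<dots> \<le> real n" using card_mono[OF _ needy_subset[of n m d h]] by simp
    finally show "(\<Sum>v\<in>ndy h. \<eta> ^ cnt h v) \<le> real n" .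
  qed (use \<eta>0 in simp)
  show "card (ndy (h @ [(S, alg h S)])) \<le> m" if "card (ndy h) \<le> m" for h S
    using card_mono[OF finite_needy needy_snoc, of n m d h S "alg h S"] that by simp
  have "2 * real K / real n \<le> 1 / 2"
  proof -
    have "1 * real K \<le> real m * real K" by (rule mult_right_mono) (use m_pos in auto)
    then have "real K \<le> real m * real K" by simp
    also have "\<dots> \<le> \<eta> * real n" by (rule mK)
    also have "\<dots> \<le> 1 / 10 * real n" by (rule mult_right_mono[OF \<eta>1]) simp
    finally show ?thesis using n0 by (simp add: divide_le_eq)
  qed
  moreover have p0: "0 \<le> ?p" using \<eta>0 \<eta>1 n0 by (intro mult_nonneg_nonneg divide_nonneg_nonneg) auto
  ultimately have "?p \<le> 1 / 2 * 1 * 1" using \<eta>0 \<eta>1 n0 by (intro mult_mono) auto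
  then have "?p \<le> 1" by linarith
  then have "(1 - \<eta>) * ?p \<le> 1 * 1" by (rule mult_mono[rotated]) (use \<eta>0 \<eta>1 p0 in linarith)+
  then show "0 \<le> 1 - (1 - \<eta>) * ?p" by linarith
  fix h :: history
  show "1 \<le> (\<Sum>v\<in>ndy h. \<eta> ^ cnt h v) / \<eta> ^ 10" if ne: "\<not> ndy h = {}"
  proof -
    obtain v where v: "v \<in> ndy h" using ne by blast
    have "\<eta> ^ 10 \<le> \<eta> ^ cnt h v"
      by (rule power_decreasing[OF served_le]) (use \<eta>0 \<eta>1 in auto)
    also have "\<dots> \<le> (\<Sum>v\<in>ndy h. \<eta> ^ cnt h v)"
      by (rule member_le_sum[OF v]) (use \<eta>0 finite_needy in auto)
    finally show ?thesis using \<eta>0 by simp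
  qed
  assume len: "length h < T1" and run: "run n h" and Q: "card (ndy h) \<le> m"
  let ?O = "offers n K (selected h)"
  have act: "act h = ndy h" by (rule active_eq[OF Q])
  have one: "(\<Sum>S\<in>?O. if v \<in> ndy (h @ [(S, alg h S)]) then \<eta> ^ cnt (h @ [(S, alg h S)]) v else 0) \<le>
      real (card ?O) * (1 - (1 - \<eta>) * ?p) * \<eta> ^ cnt h v" if v: "v \<in> ndy h" for v
  proof -
    let ?t = "\<eta> ^ cnt h v" and ?F = "{e \<in> hot h. v \<in> e}"
    have t0: "0 \<le> ?t" using \<eta>0 by simp
    have "(\<Sum>S\<in>?O. if v \<in> ndy (h @ [(S, alg h S)]) then \<eta> ^ cnt (h @ [(S, alg h S)]) v else 0) \<le>
      real (once h) * (\<Sum>e\<in>?F. \<eta> * ?t) + ?t * (real (card ?O) - real (once h) * real (card ?F))"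
    proof (rule sum_meeting_once_le[OF finite_free hot_sub _ K1 offers_eq once_def])
      show "?F \<subseteq> hot h" by auto
      fix S e assume S: "S \<in> ?O" "e \<in> ?F" "S \<inter> hot h = {e}"
      have "cnt (h @ [(S, alg h S)]) v = Suc (cnt h v)"
        using serve_once(2)[OF len S(1,3), of v] S(2) v act by simp
      then show "(if v \<in> ndy (h @ [(S, alg h S)]) then \<eta> ^ cnt (h @ [(S, alg h S)]) v else 0) \<le> \<eta> * ?t"
        using \<eta>0 by simp
    next
      fix S
      have "\<eta> ^ cnt (h @ [(S, alg h S)]) v \<le> ?t"
        by (rule power_decreasing[OF served_mono]) (use \<eta>0 \<eta>1 in auto)
      then show "(if v \<in> ndy (h @ [(S, alg h S)]) then \<eta> ^ cnt (h @ [(S, alg h S)]) v else 0) \<le> ?t"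
        using t0 by simp
    qed
    also have "\<dots> = ?t * (real (card ?O) - (1 - \<eta>) * (real (once h) * real (card ?F)))"
      by (simp add: algebra_simps)
    also have "\<dots> \<le> ?t * (real (card ?O) - (1 - \<eta>) * (real (card ?O) * ?p))"
    proof (rule mult_left_mono[OF _ t0], rule diff_left_mono, rule mult_left_mono)
      have "act h \<noteq> {}" using act v by auto
      then have o: "real (card ?O) * (2 * real K / (real n)\<^sup>2 * (1 - 4 * \<eta>)) \<le> real (once h)"
        using once_ge[OF run] len by simp
      \<comment> \<open>All needy vertices are active at this stage, so every free edge at
        \<open>v\<close> is hot.\<close>
      have "{e \<in> free h. v \<in> e} = ?F" using v act by (auto simp: hot_def touching_def)
      then have F: "(1 - 2 * \<eta>) * real n \<le> real (card ?F)"
        using card_free_at_active[OF run, of v] v act by simp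
      have "real (card ?O) * ?p = (real (card ?O) * (2 * real K / (real n)\<^sup>2 * (1 - 4 * \<eta>))) * ((1 - 2 * \<eta>) * real n)"
        using n0 by (simp add: power2_eq_square field_simps)
      also have "\<dots> \<le> real (once h) * real (card ?F)"
        by (rule mult_mono[OF o F]) (use \<eta>1 in auto)
      finally show "real (card ?O) * ?p \<le> real (once h) * real (card ?F)" .
    qed (use \<eta>1 in simp)
    finally show ?thesis by (simp add: algebra_simps)
  qed
  \<comment> \<open>The new needy set depends on the offer. Summing over the old one with vanishing
    extra terms fixes the index set, so that the order of summation can be exchanged.\<close>
  have "(\<Sum>S\<in>?O. \<Sum>v\<in>ndy (h @ [(S, alg h S)]). \<eta> ^ cnt (h @ [(S, alg h S)]) v) =
     (\<Sum>S\<in>?O. \<Sum>v\<in>ndy h. if v \<in> ndy (h @ [(S, alg h S)]) then \<eta> ^ cnt (h @ [(S, alg h S)]) v else 0)"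
  proof (rule sum.cong[OF refl])
    fix S
    have "ndy h \<inter> ndy (h @ [(S, alg h S)]) = ndy (h @ [(S, alg h S)])" using needy_snoc by blast
    then show "(\<Sum>v\<in>ndy (h @ [(S, alg h S)]). \<eta> ^ cnt (h @ [(S, alg h S)]) v) =
      (\<Sum>v\<in>ndy h. if v \<in> ndy (h @ [(S, alg h S)]) then \<eta> ^ cnt (h @ [(S, alg h S)]) v else 0)"
      by (simp add: sum.inter_restrict[OF finite_needy, symmetric])
  qed
  also have "\<dots> = (\<Sum>v\<in>ndy h. \<Sum>S\<in>?O. if v \<in> ndy (h @ [(S, alg h S)]) then \<eta> ^ cnt (h @ [(S, alg h S)]) v else 0)"
    by (rule sum.swap)
  also have "\<dots> \<le> (\<Sum>v\<in>ndy h. real (card ?O) * (1 - (1 - \<eta>) * ?p) * \<eta> ^ cnt h v)"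
    by (rule sum_mono) (rule one)
  also have "\<dots> = real (card ?O) * (1 - (1 - \<eta>) * ?p) * (\<Sum>v\<in>ndy h. \<eta> ^ cnt h v)"
    by (simp add: sum_distrib_left)
  finally have "(\<Sum>S\<in>?O. \<Sum>v\<in>ndy (h @ [(S, alg h S)]). \<eta> ^ cnt (h @ [(S, alg h S)]) v) / \<eta> ^ 10 \<le>
     real (card ?O) * (1 - (1 - \<eta>) * ?p) * (\<Sum>v\<in>ndy h. \<eta> ^ cnt h v) / \<eta> ^ 10"
    using \<eta>0 by (intro divide_right_mono) auto
  then show "(\<Sum>S\<in>?O. (\<Sum>v\<in>ndy (h @ [(S, alg h S)]). \<eta> ^ cnt (h @ [(S, alg h S)]) v) / \<eta> ^ 10) \<le>
    real (card ?O) * ((1 - (1 - \<eta>) * ?p) * ((\<Sum>v\<in>ndy h. \<eta> ^ cnt h v) / \<eta> ^ 10))"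
    by (simp add: sum_divide_distrib[symmetric] mult.assoc)
qed

end

section \<open>Expansion and boosters\<close>

lemma all_edges_pair: "e \<in> all_edges n \<Longrightarrow> \<exists>a b. e = {a, b}"
  by (auto simp: all_edges_def card_2_iff)

lemma nbhd_finite:
  assumes "E \<subseteq> all_edges n" shows "nbhd E S \<subseteq> {..<n}" "finite (nbhd E S)"
proof -
  show "nbhd E S \<subseteq> {..<n}" using assms by (force simp: nbhd_def all_edges_def)
  then show "finite (nbhd E S)" by (rule finite_subset) simp
qed

lemma expander_mono:
  assumes "expander n k E" "E \<subseteq> E'" "E' \<subseteq> all_edges n"
  shows "expander n k E'"
  unfolding expander_def
proof (intro allI impI)
  fix S assume S: "S \<subseteq> {..<n}" "S \<noteq> {}" "card S \<le> k"
  have "2 * card S \<le> card (nbhd E S)" using assms(1) S unfolding expander_def by blast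
  also have "\<dots> \<le> card (nbhd E' S)"
    by (rule card_mono) (use nbhd_finite[OF assms(3)] assms(2) in \<open>auto simp: nbhd_def\<close>)
  finally show "2 * card S \<le> card (nbhd E' S)" .
qed

lemma hamiltonian_mono: "hamiltonian n E \<Longrightarrow> E \<subseteq> E' \<Longrightarrow> hamiltonian n E'"
  unfolding hamiltonian_def hamilton_cycle_def by blast

context serving begin

text \<open>A failure of expansion confines all edges at some \<open>S0\<close> to a set \<open>U\<close> of size \<open>3 |S0|\<close>. A served
  edge at an active vertex of \<open>S0\<close> stays inside \<open>U\<close> with probability at most \<open>q = 12 |S0| / n\<close> and
  serves at most two vertices of \<open>S0\<close>, so each of the \<open>10 |S0|\<close> services costs a factor \<open>\<surd>q\<close>.\<close>

definition confined :: "nat set \<Rightarrow> nat set \<Rightarrow> history \<Rightarrow> bool" where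
  "confined S0 U h \<longleftrightarrow> (\<forall>e\<in>selected h. e \<inter> S0 \<noteq> {} \<longrightarrow> e \<subseteq> U)"

lemma confined_bound:
  assumes S0: "S0 \<subseteq> {..<n}" "card S0 = s" "1 \<le> s" "12 * s \<le> n" and U: "finite U" "card U = 3 * s"
  shows "measure_pmf.prob (achlioptas n K alg T1) {h. confined S0 U h \<and> (\<forall>v\<in>S0. 10 \<le> cnt h v)}
    \<le> (12 * real s / real n) ^ (5 * s)"
proof -
  \<comment> \<open>At the active part of \<open>S0\<close>, with z vertices, at most
    \<open>3 * s\<close> z free edges lie inside \<open>U\<close>, while at least z
    \<open>n / 4\<close> edges are free in total; the ratio of these bounds is
    \<open>q\<close>.\<close>
  define q where "q = 12 * real s / real n"
  have n0: "0 < real n" using n4 by simp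
  have q0: "0 < q" using n0 S0 by (simp add: q_def)
  have q1: "q \<le> 1"
  proof -
    have "12 * real s \<le> real n" using S0(4) by linarith
    then show ?thesis using n0 by (simp add: q_def divide_le_eq)
  qed
  define r where "r = sqrt q"
  have r0: "0 < r" and r1: "r \<le> 1" and r2: "r\<^sup>2 = q" using q0 q1 by (auto simp: r_def)
  have i1: "1 \<le> 1 / r" using r0 r1 by simp
  \<comment> \<open>It starts at no more than \<open>q ^ (5 * s)\<close> and is 1 once every vertex
    of \<open>S0\<close> has ten services; an edge of \<open>S0\<close> that leaves \<open>U\<close>
    sends it to 0. A service inside \<open>U\<close> multiplies it by at most
    \<open>1 / r\<^sup>2 = 1 / q\<close>, which is offset by the chance \<open>q\<close> of staying
    inside.\<close>
  define f where "f = (\<lambda>h. if confined S0 U h then r ^ (10 * s) * (1 / r) ^ (\<Sum>v\<in>S0. cnt h v) else 0)"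
  have finS0: "finite S0" using S0(1) finite_subset by blast
  have rq: "r ^ (10 * s) = q ^ (5 * s)"
  proof -
    have "10 * s = 2 * (5 * s)" by simp
    then show ?thesis by (metis power_mult r2)
  qed
  \<comment> \<open>\<open>phase_bound\<close> bounds the failure of a goal, so the bad event enters
    doubly negated. The rate is 1: nothing decays, and the whole bound is the initial value of the
    potential.\<close>
  have "measure_pmf.prob (achlioptas n K alg T1) {h. \<not> \<not> (confined S0 U h \<and> (\<forall>v\<in>S0. 10 \<le> cnt h v))} \<le>
    measure_pmf.prob (achlioptas n K alg 0) {h. \<not> True} + 1 ^ (T1 - 0) * q ^ (5 * s)"
  proof (rule phase_bound[OF alg_online T1K, where f = f and Q = "\<lambda>_. True"])
    show "0 \<le> q ^ (5 * s)" using q0 by simp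
    show f0: "0 \<le> f h" for h using r0 by (simp add: f_def)
    fix h :: history
    show "f h \<le> q ^ (5 * s)" if "length h = 0"
    proof -
      have "(\<Sum>v\<in>S0. cnt h v) = 0" using that by (simp add: served_Nil)
      then show ?thesis using rq q0 by (simp add: f_def)
    qed
    show "1 \<le> f h" if "\<not> \<not> (confined S0 U h \<and> (\<forall>v\<in>S0. 10 \<le> cnt h v))"
    proof -
      have "cnt h v = 10" if "v \<in> S0" for v
        using served_le[of n m d h v] \<open>\<not> \<not> _\<close> that by (simp add: le_antisym)
      then have "(\<Sum>v\<in>S0. cnt h v) = 10 * s" using S0(2) by simp
      then show ?thesis using that r0 by (simp add: f_def power_one_over)
    qed
    assume len: "length h < T1" and run: "run n h"
    let ?O = "offers n K (selected h)"
    have "(\<Sum>S\<in>?O. f (h @ [(S, alg h S)])) \<le> real (card ?O) * f h"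
    proof (cases "confined S0 U h")
      case False
      then have "f (h @ [(S, alg h S)]) = 0" for S by (auto simp: f_def confined_def selected_snoc)
      then show ?thesis using f0 by simp
    next
      case conf: True
      have fh: "f h = r ^ (10 * s) * (1 / r) ^ (\<Sum>v\<in>S0. cnt h v)" using conf by (simp add: f_def)
      have mono: "f (h @ [(S, alg h S)]) \<le> r ^ (10 * s) * (1 / r) ^ (\<Sum>v\<in>S0. cnt (h @ [(S, alg h S)]) v)" for S
        using r0 by (simp add: f_def)
      define Z where "Z = S0 \<inter> act h"
      define F where "F = touching Z (free h)"
      define FU where "FU = {e \<in> F. e \<subseteq> U}"
      have finF: "finite F" using finite_free by (simp add: F_def touching_def)
      have finZ: "finite Z" using finS0 by (simp add: Z_def)
      have Fhot: "F \<subseteq> hot h" by (auto simp: F_def hot_def touching_def Z_def)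
      have two: "\<exists>w. e = {v, w} \<and> w \<in> e" if "e \<in> all_edges n" "v \<in> e" for e v
      proof -
        obtain a b where "e = {a, b}" using all_edges_pair \<open>e \<in> all_edges n\<close> by blast
        then show ?thesis using that by auto
      qed
      have "(\<Sum>S\<in>?O. f (h @ [(S, alg h S)])) \<le> real (once h) * (\<Sum>e\<in>F. if e \<subseteq> U then f h / q else 0) +
          f h * (real (card ?O) - real (once h) * real (card F))"
      proof (rule sum_meeting_once_le[OF finite_free hot_sub Fhot K1 offers_eq once_def])
        fix S e assume S: "S \<in> ?O" "e \<in> F" "S \<inter> hot h = {e}"
        note so = serve_once[OF len S(1,3)]
        have eX: "e \<in> all_edges n" using S(2) by (auto simp: F_def touching_def free_def)
        then have ce: "card e = 2" "finite e" by (auto simp: all_edges_def intro: card_ge_0_finite)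
        show "f (h @ [(S, alg h S)]) \<le> (if e \<subseteq> U then f h / q else 0)"
        proof (cases "e \<subseteq> U")
          case False
          have "e \<inter> S0 \<noteq> {}" using S(2) by (auto simp: F_def touching_def Z_def)
          then have "\<not> confined S0 U (h @ [(S, alg h S)])"
            using False by (auto simp: confined_def selected_snoc so(1))
          then show ?thesis using False by (simp add: f_def)
        next
          case True
          have "(\<Sum>v\<in>S0. cnt (h @ [(S, alg h S)]) v) =
              (\<Sum>v\<in>S0. cnt h v) + (\<Sum>v\<in>S0. if v \<in> e \<inter> act h then 1 else 0)"
            by (simp add: so(2) sum.distrib)
          also have "(\<Sum>v\<in>S0. if v \<in> e \<inter> act h then 1 else 0) = card (S0 \<inter> (e \<inter> act h))"
            using sum.inter_restrict[OF finS0, of "\<lambda>_. 1::nat" "e \<inter> act h"] by simp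
          also have "\<dots> \<le> card e" by (rule card_mono) (use ce in auto)
          finally have "(\<Sum>v\<in>S0. cnt (h @ [(S, alg h S)]) v) \<le> (\<Sum>v\<in>S0. cnt h v) + 2" using ce by simp
          then have "(1 / r) ^ (\<Sum>v\<in>S0. cnt (h @ [(S, alg h S)]) v) \<le> (1 / r) ^ ((\<Sum>v\<in>S0. cnt h v) + 2)"
            by (rule power_increasing[OF _ i1])
          then have "r ^ (10 * s) * (1 / r) ^ (\<Sum>v\<in>S0. cnt (h @ [(S, alg h S)]) v) \<le>
              r ^ (10 * s) * (1 / r) ^ ((\<Sum>v\<in>S0. cnt h v) + 2)"
            by (rule mult_left_mono) (use r0 in simp)
          also have "\<dots> = f h / q" by (simp add: fh power_add power_one_over r2[symmetric] power2_eq_square)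
          finally show ?thesis using True order_trans[OF mono] by simp
        qed
      next
        fix S assume S: "S \<in> ?O" "\<And>e. e \<in> F \<Longrightarrow> S \<inter> hot h \<noteq> {e}"
        have "cnt (h @ [(S, alg h S)]) v = cnt h v" if "v \<in> S0" for v
        proof (rule serve_none[OF S(1) that])
          fix e assume "e \<inter> S0 \<inter> act h \<noteq> {}" "e \<in> hot h"
          then have "e \<in> F" by (auto simp: F_def touching_def Z_def hot_def)
          then show "S \<inter> hot h \<noteq> {e}" by (rule S(2))
        qed
        then have "(\<Sum>v\<in>S0. cnt (h @ [(S, alg h S)]) v) = (\<Sum>v\<in>S0. cnt h v)" by simp
        then show "f (h @ [(S, alg h S)]) \<le> f h" using mono[of S] fh by simp
      qed
      also have "(\<Sum>e\<in>F. if e \<subseteq> U then f h / q else 0) = real (card FU) * (f h / q)"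
        unfolding FU_def using finF by (simp add: sum.If_cases Int_def)
      also have "real (once h) * (real (card FU) * (f h / q)) + f h * (real (card ?O) - real (once h) * real (card F))
        = f h * (real (card ?O) + real (once h) * (real (card FU) / q - real (card F)))"
        by (simp add: algebra_simps)
      also have "\<dots> \<le> f h * real (card ?O)"
      proof (rule mult_left_mono[OF _ f0])
        \<comment> \<open>Confinement itself bounds the degree, since all selected edges at
          \<open>v\<close> end in \<open>U\<close>. Hence at least \<open>n / 2\<close> edges at
          \<open>v\<close> are still free.\<close>
        have deg: "card {e \<in> selected h. v \<in> e} \<le> 3 * s" if "v \<in> S0" for v
        proof -
          have "{e \<in> selected h. v \<in> e} \<subseteq> (\<lambda>w. {v, w}) ` U"
          proof clarify
            fix e assume e: "e \<in> selected h" "v \<in> e"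
            then have "e \<in> all_edges n" using run by (auto simp: run_def)
            then obtain w where "e = {v, w}" "w \<in> e" using two e(2) by blast
            moreover have "e \<subseteq> U" using conf e that by (auto simp: confined_def)
            ultimately show "e \<in> (\<lambda>w. {v, w}) ` U" by blast
          qed
          then have "card {e \<in> selected h. v \<in> e} \<le> card ((\<lambda>w. {v, w}) ` U)"
            by (rule card_mono[rotated]) (use U in simp)
          also have "\<dots> \<le> 3 * s" using card_image_le[OF U(1)] U(2) by metis
          finally show ?thesis .
        qed
        have "card Z * (n - 1 - 3 * s) \<le> 2 * card F"
          unfolding F_def
        proof (rule card_touching_ge[OF finZ])
          show "free h \<subseteq> all_edges n" by (auto simp: free_def)
          fix v assume v: "v \<in> Z"
          then have "v < n" "card {e \<in> selected h. v \<in> e} \<le> 3 * s" using deg S0(1) by (auto simp: Z_def)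
          then show "n - 1 - 3 * s \<le> card {e \<in> free h. v \<in> e}"
            unfolding free_def using card_free_edges_at[of v n "selected h"] run by (simp add: run_def)
        qed
        moreover have "n \<le> 2 * (n - 1 - 3 * s)" using S0(4) n4 by linarith
        then have "card Z * n \<le> card Z * (2 * (n - 1 - 3 * s))" by (rule mult_left_mono) simp
        ultimately have "card Z * n \<le> 4 * card F" by linarith
        then have b: "real (card Z) * real n \<le> 4 * real (card F)"
          by (metis of_nat_mult of_nat_le_iff of_nat_numeral)
        have "FU \<subseteq> (\<lambda>(v, w). {v, w}) ` (Z \<times> U)"
        proof
          fix e assume "e \<in> FU"
          then have e: "e \<in> all_edges n" "e \<subseteq> U" "e \<inter> Z \<noteq> {}"
            by (auto simp: FU_def F_def touching_def free_def)
          then obtain v where v: "v \<in> e" "v \<in> Z" by blast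
          then obtain w where "e = {v, w}" "w \<in> e" using two e(1) by blast
          then show "e \<in> (\<lambda>(v, w). {v, w}) ` (Z \<times> U)" using v e(2) by (auto simp: image_iff)
        qed
        then have "card FU \<le> card ((\<lambda>(v, w). {v, w}) ` (Z \<times> U))"
          by (rule card_mono[rotated]) (use U finZ in simp)
        also have "\<dots> \<le> card (Z \<times> U)" by (rule card_image_le) (use U finZ in simp)
        also have "\<dots> = card Z * (3 * s)" by (simp add: card_cartesian_product U)
        finally have "real (card FU) \<le> real (card Z * (3 * s))" by (rule of_nat_mono)
        then have "real (card FU) / q \<le> real (card Z * (3 * s)) / q"
          by (rule divide_right_mono) (use q0 in simp)
        also have "\<dots> = real (card Z) * real n / 4" using n0 S0(3) by (simp add: q_def field_simps)
        also have "\<dots> \<le> real (card F)" using b by simp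
        finally have "real (once h) * (real (card FU) / q - real (card F)) \<le> 0"
          by (intro mult_nonneg_nonpos) auto
        then show "real (card ?O) + real (once h) * (real (card FU) / q - real (card F)) \<le> real (card ?O)"
          by simp
      qed
      finally show ?thesis by (simp add: mult.commute)
    qed
    then show "(\<Sum>S\<in>?O. f (h @ [(S, alg h S)])) \<le> real (card ?O) * (1 * f h)" by simp
  qed auto
  then show ?thesis by (simp add: q_def)
qed

text \<open>If a set \<open>S0\<close> of size \<open>s\<close> fails to expand, it fits together
  with its neighbourhood into \<open>3 * s\<close> vertices, and its vertices have degree at most
  \<open>3 * s < d\<close>. When nobody is needy, they must have left the needy set through ten
  services, which is the event of \<open>confined_bound\<close>.\<close>

lemma expander_prob:
  assumes k: "3 * k < d" "12 * k \<le> n"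
  shows "measure_pmf.prob (achlioptas n K alg T1) {h. \<not> expander n k (selected h)} \<le>
    measure_pmf.prob (achlioptas n K alg T1) {h. \<not> ndy h = {}} +
    (\<Sum>s=1..k. real (n choose s) * real (n choose (3 * s)) * (12 * real s / real n) ^ (5 * s))"
proof -
  let ?P = "achlioptas n K alg T1"
  define D where "D = (\<lambda>s. {S. S \<subseteq> {..<n} \<and> card S = s})"
  define Bad where "Bad = (\<lambda>S0 U. {h. confined S0 U h \<and> (\<forall>v\<in>S0. 10 \<le> cnt h v)})"
  have finD: "finite (D s)" for s by (simp add: D_def)
  have sub: "set_pmf ?P \<inter> {h. \<not> expander n k (selected h)} \<subseteq>
    {h. \<not> ndy h = {}} \<union> (\<Union>s\<in>{1..k}. \<Union>S0\<in>D s. \<Union>U\<in>D (3 * s). Bad S0 U)"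
  proof clarify
    fix h assume h: "h \<in> set_pmf ?P" and ne: "\<not> expander n k (selected h)"
      and notin: "h \<notin> (\<Union>s\<in>{1..k}. \<Union>S0\<in>D s. \<Union>U\<in>D (3 * s). Bad S0 U)" and nd: "ndy h = {}"
    have run: "run n h" using achlioptas_run[OF alg_online _ h] T1K by auto
    then have E: "selected h \<subseteq> all_edges n" by (simp add: run_def)
    obtain S0 where S0: "S0 \<subseteq> {..<n}" "S0 \<noteq> {}" "card S0 \<le> k" "card (nbhd (selected h) S0) < 2 * card S0"
      using ne unfolding expander_def by (meson not_le_imp_less)
    define s where "s = card S0"
    have finS0: "finite S0" using S0(1) finite_subset by blast
    have s1: "1 \<le> s" using S0(2) finS0 by (simp add: s_def Suc_le_eq card_gt_0_iff)
    have sk: "s \<le> k" using S0(3) by (simp add: s_def)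
    have "card (S0 \<union> nbhd (selected h) S0) \<le> 3 * s"
      using card_Un_le[of S0 "nbhd (selected h) S0"] S0(4) by (simp add: s_def)
    moreover have "3 * s \<le> card {..<n}" using sk k(2) by simp
    moreover have "S0 \<union> nbhd (selected h) S0 \<subseteq> {..<n}" using S0(1) nbhd_finite[OF E] by blast
    \<comment> \<open>Padding to exactly \<open>3 * s\<close> vertices lets the union bound range
      over sets of one size.\<close>
    ultimately obtain U where U: "S0 \<union> nbhd (selected h) S0 \<subseteq> U" "U \<subseteq> {..<n}" "card U = 3 * s"
      using exists_subset_between[of "S0 \<union> nbhd (selected h) S0" "3 * s" "{..<n}"] by auto
    have finU: "finite U" using U(2) finite_subset by blast
    have conf: "confined S0 U h" unfolding confined_def
    proof (intro ballI impI)
      fix e assume e: "e \<in> selected h" "e \<inter> S0 \<noteq> {}"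
      obtain a b where ab: "e = {a, b}" using all_edges_pair E e(1) by blast
      consider "a \<in> S0" | "b \<in> S0" using e(2) ab by blast
      then show "e \<subseteq> U"
      proof cases
        case 1
        then have "b \<in> S0 \<union> nbhd (selected h) S0" using e(1) ab by (auto simp: nbhd_def)
        then show ?thesis using U(1) 1 ab by blast
      next
        case 2
        then have "a \<in> S0 \<union> nbhd (selected h) S0" using e(1) ab by (auto simp: nbhd_def insert_commute)
        then show ?thesis using U(1) 2 ab by blast
      qed
    qed
    have "10 \<le> cnt h v" if v: "v \<in> S0" for v
    proof -
      have "{e \<in> selected h. v \<in> e} \<subseteq> (\<lambda>w. {v, w}) ` U"
      proof clarify
        fix e assume e: "e \<in> selected h" "v \<in> e"
        obtain a b where ab: "e = {a, b}" using all_edges_pair E e(1) by blast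
        have "e \<subseteq> U" using conf e v by (auto simp: confined_def)
        then show "e \<in> (\<lambda>w. {v, w}) ` U" using ab e(2) by (auto simp: image_iff doubleton_eq_iff)
      qed
      then have "card {e \<in> selected h. v \<in> e} \<le> card ((\<lambda>w. {v, w}) ` U)"
        by (rule card_mono[rotated]) (use finU in simp)
      also have "\<dots> \<le> 3 * s" using card_image_le[OF finU] U(3) by metis
      also have "\<dots> < d" using sk k(1) by simp
      finally have "card {e \<in> selected h. v \<in> e} < d" .
      moreover have "v < n" using v S0(1) by auto
      moreover have "v \<notin> ndy h" using nd by simp
      ultimately show ?thesis unfolding needy_after_def needy_def by auto
    qed
    then have "h \<in> Bad S0 U" using conf by (simp add: Bad_def)
    moreover have "S0 \<in> D s" "U \<in> D (3 * s)" using S0 U by (auto simp: D_def s_def)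
    moreover have "s \<in> {1..k}" using s1 sk by simp
    ultimately have "h \<in> (\<Union>s\<in>{1..k}. \<Union>S0\<in>D s. \<Union>U\<in>D (3 * s). Bad S0 U)" by blast
    then show False using notin by simp
  qed
  have "measure_pmf.prob ?P {h. \<not> expander n k (selected h)} \<le>
    measure_pmf.prob ?P ({h. \<not> ndy h = {}} \<union> (\<Union>s\<in>{1..k}. \<Union>S0\<in>D s. \<Union>U\<in>D (3 * s). Bad S0 U))"
  proof (rule measure_pmf.finite_measure_mono_AE)
    show "AE h in ?P. h \<in> {h. \<not> expander n k (selected h)} \<longrightarrow>
        h \<in> {h. \<not> ndy h = {}} \<union> (\<Union>s\<in>{1..k}. \<Union>S0\<in>D s. \<Union>U\<in>D (3 * s). Bad S0 U)"
      unfolding AE_measure_pmf_iff using sub by blast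
  qed simp
  also have "\<dots> \<le> measure_pmf.prob ?P {h. \<not> ndy h = {}} +
      measure_pmf.prob ?P (\<Union>s\<in>{1..k}. \<Union>S0\<in>D s. \<Union>U\<in>D (3 * s). Bad S0 U)"
    by (rule measure_Un_le) auto
  also have "measure_pmf.prob ?P (\<Union>s\<in>{1..k}. \<Union>S0\<in>D s. \<Union>U\<in>D (3 * s). Bad S0 U) \<le>
      (\<Sum>s=1..k. measure_pmf.prob ?P (\<Union>S0\<in>D s. \<Union>U\<in>D (3 * s). Bad S0 U))"
    by (rule measure_UNION_le) auto
  also have "\<dots> \<le> (\<Sum>s=1..k. real (n choose s) * real (n choose (3 * s)) * (12 * real s / real n) ^ (5 * s))"
  proof (rule sum_mono)
    fix s assume s: "s \<in> {1..k}"
    let ?b = "(12 * real s / real n) ^ (5 * s)"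
    have "measure_pmf.prob ?P (\<Union>S0\<in>D s. \<Union>U\<in>D (3 * s). Bad S0 U) \<le>
        (\<Sum>S0\<in>D s. measure_pmf.prob ?P (\<Union>U\<in>D (3 * s). Bad S0 U))"
      by (rule measure_UNION_le) (auto simp: finD)
    also have "\<dots> \<le> (\<Sum>S0\<in>D s. \<Sum>U\<in>D (3 * s). measure_pmf.prob ?P (Bad S0 U))"
      by (intro sum_mono measure_UNION_le) (auto simp: finD)
    also have "\<dots> \<le> (\<Sum>S0\<in>D s. \<Sum>U\<in>D (3 * s). ?b)"
    proof (intro sum_mono)
      fix S0 U assume "S0 \<in> D s" "U \<in> D (3 * s)"
      then show "measure_pmf.prob ?P (Bad S0 U) \<le> ?b"
        unfolding Bad_def
        by (intro confined_bound) (use s k(2) in \<open>auto simp: D_def intro: finite_subset\<close>)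
    qed
    also have "\<dots> = real (n choose s) * real (n choose (3 * s)) * ?b"
      using n_subsets[of "{..<n}" s] n_subsets[of "{..<n}" "3 * s"] by (simp add: D_def)
    finally show "measure_pmf.prob ?P (\<Union>S0\<in>D s. \<Union>U\<in>D (3 * s). Bad S0 U) \<le>
      real (n choose s) * real (n choose (3 * s)) * ?b" .
  qed
  finally show ?thesis by simp
qed

text \<open>The potential is 2 to the number of rank increments still possible, at most
  \<open>2 * n + 1\<close>. At least half of \<open>(real k + 1)\<^sup>2\<close> among at most
  \<open>(real n)\<^sup>2 / 2\<close> free pairs are boosters, so an offer contains one with
  probability at least \<open>\<gamma>\<close>, and taking it at least halves the potential.
  Expansion persists as edges are added.\<close>

lemma boosting:
  assumes T: "T1 \<le> T" "T + K \<le> card (all_edges n)" and k: "1 \<le> k"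
    and \<gamma>: "0 \<le> \<gamma>" "\<gamma> \<le> 1" "\<gamma> * (real n)\<^sup>2 \<le> (real k + 1)\<^sup>2"
  shows "measure_pmf.prob (achlioptas n K alg T) {h. \<not> hamiltonian n (selected h)} \<le>
    measure_pmf.prob (achlioptas n K alg T1) {h. \<not> expander n k (selected h)} +
    (1 - \<gamma> / 2) ^ (T - T1) * 2 ^ (2 * n + 1)"
proof -
  define f where "f = (\<lambda>h. if hamiltonian n (selected h) then 0 else
    2 ^ (2 * n + 1) * (1 / 2 :: real) ^ path_rank n (selected h))"
  have n1: "1 \<le> n" using n4 by simp
  show ?thesis
  proof (rule phase_bound[OF alg_online T(2,1), where f = f and Q = "\<lambda>h. expander n k (selected h)"])
    show "0 \<le> 1 - \<gamma> / 2" using \<gamma> by simp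
    show f0: "0 \<le> f h" for h by (simp add: f_def)
    show "f h \<le> 2 ^ (2 * n + 1)" for h by (auto simp: f_def power_le_one intro!: mult_left_le)
    show "expander n k (selected (h @ [(S, alg h S)]))"
      if "run n h" "expander n k (selected h)" "S \<in> offers n K (selected h)" for h S
    proof (rule expander_mono[OF that(2)])
      show "selected h \<subseteq> selected (h @ [(S, alg h S)])" by (auto simp: selected_snoc)
      have "alg h S \<in> S" using alg_online that(3) by (auto simp: online_algorithm_def)
      then show "selected (h @ [(S, alg h S)]) \<subseteq> all_edges n"
        using that(1,3) by (auto simp: selected_snoc run_def offers_def)
    qed
    fix h :: history
    show "1 \<le> f h" if "\<not> hamiltonian n (selected h)"
    proof -
      have "(1 / 2 :: real) ^ (2 * n + 1) \<le> (1 / 2) ^ path_rank n (selected h)"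
        by (rule power_decreasing[OF path_rank_le[OF n1]]) auto
      then have "2 ^ (2 * n + 1) * (1 / 2 :: real) ^ (2 * n + 1) \<le> 2 ^ (2 * n + 1) * (1 / 2) ^ path_rank n (selected h)"
        by (rule mult_left_mono) simp
      also have "\<dots> = f h" using that by (simp add: f_def)
      finally show ?thesis by (simp only: power_mult_distrib[symmetric]) simp
    qed
    assume len: "T1 \<le> length h" "length h < T" and run: "run n h" and ex: "expander n k (selected h)"
    let ?O = "offers n K (selected h)" and ?B = "boosters n (selected h)"
    let ?X = "all_edges n - selected h"
    show "(\<Sum>S\<in>?O. f (h @ [(S, alg h S)])) \<le> real (card ?O) * ((1 - \<gamma> / 2) * f h)"
    proof (cases "hamiltonian n (selected h)")
      case True
      have "f (h @ [(S, alg h S)]) = 0" for S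
        using hamiltonian_mono[OF True, of "selected (h @ [(S, alg h S)])"] by (auto simp: f_def selected_snoc)
      moreover have "f h = 0" using True by (simp add: f_def)
      ultimately show ?thesis by simp
    next
      case False
      have E: "selected h \<subseteq> all_edges n" using run by (simp add: run_def)
      have fh: "f h = 2 ^ (2 * n + 1) * (1 / 2 :: real) ^ path_rank n (selected h)" using False by (simp add: f_def)
      have mono: "f (h @ [(S, alg h S)]) \<le> 2 ^ (2 * n + 1) * (1 / 2 :: real) ^ path_rank n (selected (h @ [(S, alg h S)]))" for S
        by (simp add: f_def)
      define W where "W = {S \<in> ?O. S \<inter> ?B = {}}"
      have WO: "W \<subseteq> ?O" by (auto simp: W_def)
      have BX: "?B \<subseteq> ?X" by (auto simp: boosters_def)
      have finX: "finite ?X" by (simp add: finite_all_edges)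
      have cW: "card W = (card ?X - card ?B) choose K"
        using card_subsets_avoiding[OF finX BX, of K] unfolding W_def offers_def by (simp add: conj_ac)
      have nk: "(k + 1)\<^sup>2 \<le> 2 * card ?B"
        by (rule card_boosters[OF E ex _ k False]) (use n4 in simp)
      then have "real ((k + 1)\<^sup>2) \<le> real (2 * card ?B)" by (rule of_nat_mono)
      then have nk': "(real k + 1)\<^sup>2 \<le> 2 * real (card ?B)" by (simp add: add.commute)
      have BleX: "card ?B \<le> card ?X" by (rule card_mono[OF finX BX])
      have B1: "1 \<le> card ?B" using nk by (cases "card ?B") auto
      have "card ?X \<le> card (all_edges n)" by (rule card_mono[OF finite_all_edges]) auto
      then have "real (card ?X) \<le> (real n)\<^sup>2 / 2"
        using real_card_all_edges[of n] by (simp add: power2_eq_square algebra_simps)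
      then have "\<gamma> * real (card ?X) \<le> \<gamma> * ((real n)\<^sup>2 / 2)" by (rule mult_left_mono) (rule \<gamma>(1))
      also have "\<dots> \<le> real (card ?B)" using \<gamma>(3) nk' by simp
      finally have ratio: "\<gamma> \<le> real (card ?B) / real (card ?X)" using B1 BleX by (simp add: le_divide_eq)
      have cW': "real (card W) \<le> real (card ?O) * (1 - \<gamma>)"
      proof -
        have "real (card W) \<le> real (card ?X choose K) * (1 - real (card ?B) / real (card ?X))"
          unfolding cW by (rule avoiding_le[OF BleX K1]) (use B1 BleX in simp)
        also have "\<dots> \<le> real (card ?X choose K) * (1 - \<gamma>)" by (rule mult_left_mono) (use ratio in auto)
        finally show ?thesis by (simp add: card_offers)
      qed
      have "(\<Sum>S\<in>?O. f (h @ [(S, alg h S)])) =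
          (\<Sum>S\<in>?O - W. f (h @ [(S, alg h S)])) + (\<Sum>S\<in>W. f (h @ [(S, alg h S)]))"
        by (rule sum.subset_diff[OF WO finite_offers])
      also have "(\<Sum>S\<in>?O - W. f (h @ [(S, alg h S)])) \<le> (\<Sum>S\<in>?O - W. f h / 2)"
      proof (rule sum_mono)
        fix S assume "S \<in> ?O - W"
        then have hit: "S \<inter> ?B \<noteq> {}" by (simp add: W_def)
        then have "(SOME e. e \<in> S \<inter> ?B) \<in> S \<inter> ?B" by (meson equals0I someI_ex)
        then have "alg h S \<in> ?B" using len hit by (simp add: strategy_def)
        then have "Suc (path_rank n (selected h)) \<le> path_rank n (selected (h @ [(S, alg h S)]))"
          by (simp add: boosters_def selected_snoc)
        then have "(1 / 2 :: real) ^ path_rank n (selected (h @ [(S, alg h S)])) \<le> (1 / 2) ^ Suc (path_rank n (selected h))"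
          by (rule power_decreasing) auto
        then have "2 ^ (2 * n + 1) * (1 / 2 :: real) ^ path_rank n (selected (h @ [(S, alg h S)])) \<le>
            2 ^ (2 * n + 1) * (1 / 2) ^ Suc (path_rank n (selected h))" by (rule mult_left_mono) simp
        also have "\<dots> = f h / 2" by (simp add: fh)
        finally show "f (h @ [(S, alg h S)]) \<le> f h / 2" by (rule order_trans[OF mono])
      qed
      also have "(\<Sum>S\<in>W. f (h @ [(S, alg h S)])) \<le> (\<Sum>S\<in>W. f h)"
      proof (rule sum_mono)
        fix S
        have "path_rank n (selected h) \<le> path_rank n (selected (h @ [(S, alg h S)]))"
          by (rule path_rank_mono[OF n1]) (auto simp: selected_snoc)
        then have "(1 / 2 :: real) ^ path_rank n (selected (h @ [(S, alg h S)])) \<le> (1 / 2) ^ path_rank n (selected h)"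
          by (rule power_decreasing) auto
        then have "2 ^ (2 * n + 1) * (1 / 2 :: real) ^ path_rank n (selected (h @ [(S, alg h S)])) \<le> f h"
          unfolding fh by (rule mult_left_mono) simp
        then show "f (h @ [(S, alg h S)]) \<le> f h" by (rule order_trans[OF mono])
      qed
      also have "(\<Sum>S\<in>?O - W. f h / 2) + (\<Sum>S\<in>W. f h) = f h * ((real (card ?O) + real (card W)) / 2)"
        using card_mono[OF finite_offers WO] finite_subset[OF WO finite_offers]
        by (simp add: card_Diff_subset[OF _ WO] of_nat_diff field_simps)
      also have "\<dots> \<le> f h * (real (card ?O) * (1 - \<gamma> / 2))"
        by (rule mult_left_mono[OF _ f0]) (use cW' in \<open>simp add: field_simps\<close>)
      finally show ?thesis by (simp add: mult_ac)
    qed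
  qed auto
qed

end

section \<open>Vertices that are never offered\<close>

text \<open>Formulated for offers and not for selections: the algorithm influences the latter, while
  the probability of never being offered is the same for every algorithm.\<close>

definition untouched :: "nat set \<Rightarrow> history \<Rightarrow> bool" where
  "untouched W h \<longleftrightarrow> (\<forall>(S, e) \<in> set h. touching W S = {})"

lemma untouched_snoc: "untouched W (h @ [(S, e)]) \<longleftrightarrow> untouched W h \<and> touching W S = {}"
  by (auto simp: untouched_def)

lemma untouched_selected:
  assumes "run n h" "untouched W h" shows "touching W (selected h) = {}"
  using assms unfolding run_def untouched_def selected_def touching_def by fastforce

text \<open>While \<open>W\<close> is untouched, none of its edges has been selected, so all
  \<open>a\<close> of them are still available among \<open>card (all_edges n) - i\<close> pairs
  after \<open>i\<close> rounds; the conditional probability of another miss depends on the round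
  alone.\<close>

lemma expectation_untouched:
  assumes A: "online_algorithm n K A" and T: "t + K \<le> Suc (card (all_edges n))"
    and a: "card (touching W (all_edges n)) = a"
  shows "measure_pmf.expectation (achlioptas n K A t) (\<lambda>h. of_bool (untouched W h)) =
    (\<Prod>i<t. real ((card (all_edges n) - i - a) choose K) / real ((card (all_edges n) - i) choose K))"
  using T
proof (induction t)
  case 0
  then show ?case by (simp add: untouched_def)
next
  case (Suc t)
  let ?p = "real ((card (all_edges n) - t - a) choose K) / real ((card (all_edges n) - t) choose K)"
  have "measure_pmf.expectation (achlioptas n K A (Suc t)) (\<lambda>h. of_bool (untouched W h)) =
    measure_pmf.expectation (achlioptas n K A t)
      (\<lambda>h. (\<Sum>S\<in>offers n K (selected h). of_bool (untouched W (h @ [(S, A h S)]))) /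
        real (card (offers n K (selected h))))"
    by (rule expectation_Suc[OF A]) (use Suc.prems in simp)
  also have "\<dots> = measure_pmf.expectation (achlioptas n K A t) (\<lambda>h. of_bool (untouched W h) * ?p)"
  proof (rule integral_cong_AE)
    show "AE h in achlioptas n K A t. (\<Sum>S\<in>offers n K (selected h). of_bool (untouched W (h @ [(S, A h S)]))) /
        real (card (offers n K (selected h))) = of_bool (untouched W h) * ?p"
      unfolding AE_measure_pmf_iff
    proof
      fix h assume "h \<in> set_pmf (achlioptas n K A t)"
      then have h: "length h = t" "run n h" using achlioptas_run[OF A, of t h] Suc.prems by auto
      let ?X = "all_edges n - selected h"
      have finX: "finite ?X" by (simp add: finite_all_edges)
      have sel: "selected h \<subseteq> all_edges n" "card (selected h) = t" using h by (auto simp: run_def)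
      then have cX: "card ?X = card (all_edges n) - t"
        using finite_all_edges finite_subset by (metis card_Diff_subset)
      show "(\<Sum>S\<in>offers n K (selected h). of_bool (untouched W (h @ [(S, A h S)]))) /
        real (card (offers n K (selected h))) = of_bool (untouched W h) * ?p"
      proof (cases "untouched W h")
        case False then show ?thesis by (simp add: untouched_snoc)
      next
        case True
        have "touching W ?X = touching W (all_edges n)"
          using untouched_selected[OF h(2) True] by (auto simp: touching_def)
        then have cF: "card (touching W ?X) = a" using a by simp
        have sub: "touching W ?X \<subseteq> ?X" by (auto simp: touching_def)
        have "(\<Sum>S\<in>offers n K (selected h). of_bool (untouched W (h @ [(S, A h S)]))) =
            real (card {S \<in> offers n K (selected h). touching W S = {}})"
          using True finite_offers by (simp add: untouched_snoc of_bool_def sum.If_cases Int_def)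
        also have "{S \<in> offers n K (selected h). touching W S = {}} =
            {S. S \<subseteq> ?X \<and> card S = K \<and> S \<inter> touching W ?X = {}}"
          unfolding offers_def touching_def by blast
        also have "card \<dots> = (card (all_edges n) - t - a) choose K"
          unfolding card_subsets_avoiding[OF finX sub] cF cX ..
        finally show ?thesis using True by (simp add: card_offers cX)
      qed
    qed
  qed simp_all
  also have "\<dots> = measure_pmf.expectation (achlioptas n K A t) (\<lambda>h. of_bool (untouched W h)) * ?p"
    by (rule integral_mult_left_zero)
  finally show ?case using Suc by simp
qed

text \<open>The product form allows the probabilities for two vertices and for one to be compared
  factor by factor.\<close>

lemma binomial_ratio:
  assumes "a + K \<le> M"
  shows "real ((M - a) choose K) / real (M choose K) = (\<Prod>i<K. (real M - real i - real a) / (real M - real i))"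
  using assms
proof (induction K)
  case (Suc K)
  have up: "real (x choose Suc K) = real (x choose K) * (real x - real K) / real (Suc K)" if "K \<le> x" for x
  proof -
    have "Suc K * (x choose Suc K) = (x - K) * (x choose K)"
      by (metis binomial_absorption binomial_absorb_comp)
    then have "real (Suc K) * real (x choose Suc K) = real (x - K) * real (x choose K)"
      by (metis of_nat_mult)
    then have "real (x choose Suc K) = real (x - K) * real (x choose K) / real (Suc K)"
      by (simp add: field_simps)
    then show ?thesis using that by (simp add: of_nat_diff mult.commute)
  qed
  have "real ((M - a) choose Suc K) / real (M choose Suc K) =
      real ((M - a) choose K) / real (M choose K) * ((real (M - a) - real K) / (real M - real K))"
    using Suc.prems by (subst up, simp, subst up, simp) simp
  also have "real (M - a) - real K = real M - real K - real a" using Suc.prems by (simp add: of_nat_diff)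
  finally show ?case using Suc by simp
qed simp

lemma card_touching_pair:
  assumes "u < n" "v < n" "u \<noteq> v"
  shows "card (touching {u, v} (all_edges n)) = 2 * n - 3"
proof -
  let ?E = "\<lambda>v. {e \<in> all_edges n. v \<in> e}"
  have "touching {u, v} (all_edges n) = ?E u \<union> ?E v" by (auto simp: touching_def)
  moreover have "?E u \<inter> ?E v = {{u, v}}"
  proof
    show "{{u, v}} \<subseteq> ?E u \<inter> ?E v" using assms by (auto simp: all_edges_def)
    show "?E u \<inter> ?E v \<subseteq> {{u, v}}" using assms by (auto simp: all_edges_def card_2_iff)
  qed
  ultimately have "card (touching {u, v} (all_edges n)) + 1 = (n - 1) + (n - 1)"
    using card_Un_Int[of "?E u" "?E v"] card_edges_at assms by (simp add: finite_all_edges)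
  then show ?thesis by simp
qed

lemma card_touching_single: "v < n \<Longrightarrow> card (touching {v} (all_edges n)) = n - 1"
  using card_edges_at[of v n] by (simp add: touching_def)

lemma untouched_pair: "untouched {u, v} h \<longleftrightarrow> untouched {u} h \<and> untouched {v} h"
  by (auto simp: untouched_def touching_def)

lemma untouched_not_hamiltonian:
  assumes "run n h" "untouched {v} h" "v < n"
  shows "\<not> hamiltonian n (selected h)"
proof
  assume "hamiltonian n (selected h)"
  then obtain vs where vs: "set vs = {..<n}" "distinct vs"
    "\<forall>i<n. {vs ! i, vs ! (Suc i mod n)} \<in> selected h"
    unfolding hamiltonian_def hamilton_cycle_def by blast
  have "length vs = n" using vs(1,2) distinct_card by fastforce
  then obtain i where "i < n" "vs ! i = v" using vs(1) assms(3) by (metis in_set_conv_nth lessThan_iff)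
  then have "{v, vs ! (Suc i mod n)} \<in> touching {v} (selected h)" using vs(3) by (auto simp: touching_def)
  then show False using untouched_selected[OF assms(1,2)] by simp
qed

text \<open>Second moment method for the number \<open>X\<close> of untouched vertices. The first
  term bounds the inverse of the mean of \<open>X\<close>; the other exponential minus 1 bounds the
  relative covariance. In every factor, \<open>y\<close> bounds the share of one vertex's edges
  among the available pairs.\<close>

lemma hamiltonian_prob_le:
  assumes A: "online_algorithm n K A" and T: "T + K \<le> card (all_edges n)" and n: "8 \<le> n"
    and big: "(real n)\<^sup>2 / 4 \<le> real (card (all_edges n)) - real T - real K"
    and y: "real n / (real (card (all_edges n)) - real T - real K) \<le> y" "y < 1"
  shows "measure_pmf.prob (achlioptas n K A T) {h. hamiltonian n (selected h)} \<le>
    exp (y / (1 - y) * (real K * real T)) / real n + exp (16 * (real K * real T) / (real n)\<^sup>2) - 1"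
proof -
  let ?P = "achlioptas n K A T" and ?N = "card (all_edges n)"
  define R where "R = (\<lambda>a. \<Prod>i<T. real ((?N - i - a) choose K) / real ((?N - i) choose K))"
  define R1 where "R1 = R (n - 1)"
  define R2 where "R2 = R (2 * n - 3)"
  define X where "X = (\<lambda>h. \<Sum>v<n. of_bool (untouched {v} h) :: real)"
  have n0: "0 < real n" using n by simp
  have big2: "2 * real n \<le> (real n)\<^sup>2 / 4"
  proof -
    have "8 * real n \<le> real n * real n" by (rule mult_right_mono) (use n in auto)
    then show ?thesis by (simp add: power2_eq_square)
  qed
  have prodR: "R a = (\<Prod>i<T. \<Prod>j<K. (real (?N - i) - real j - real a) / (real (?N - i) - real j))"
    if "a \<le> 2 * n" for a
    unfolding R_def
  proof (rule prod.cong[OF refl])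
    fix i assume "i \<in> {..<T}"
    then have "real a + real K \<le> real (?N - i)" using big big2 that T by (simp add: of_nat_diff)
    then have "a + K \<le> ?N - i" by linarith
    then show "real ((?N - i - a) choose K) / real ((?N - i) choose K) =
      (\<Prod>j<K. (real (?N - i) - real j - real a) / (real (?N - i) - real j))" by (rule binomial_ratio)
  qed
  have xge: "real ?N - real T - real K \<le> real (?N - i) - real j" if "i < T" "j < K" for i j
    using that T by (simp add: of_nat_diff)
  let ?f = "\<lambda>a i j. (real (?N - i) - real j - real a) / (real (?N - i) - real j)"
  have one: "exp (- (y / (1 - y))) \<le> ?f (n - 1) i j" if ij: "i < T" "j < K" for i j
  proof -
    let ?x = "real (?N - i) - real j"
    have x0: "0 < real ?N - real T - real K" using big big2 n0 by linarith
    have "real (n - 1) / ?x \<le> real n / (real ?N - real T - real K)"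
      by (rule frac_le) (use xge[OF ij] x0 in auto)
    also have "\<dots> \<le> y" by (rule y(1))
    finally have "1 - y \<le> 1 - real (n - 1) / ?x" by simp
    also have "\<dots> = ?f (n - 1) i j" using xge[OF ij] x0 by (simp add: diff_divide_distrib)
    finally have 1: "1 - y \<le> ?f (n - 1) i j" .
    \<comment> \<open>The left side equals \<open>1 + y / (1 - y)\<close>, to which the exponential
      inequality applies; inverting gives the lower bound for \<open>1 - y\<close>.\<close>
    have "inverse (1 - y) \<le> exp (y / (1 - y))"
      using exp_ge_add_one_self[of "y / (1 - y)"] y(2) by (simp add: field_simps)
    then have "exp (- (y / (1 - y))) \<le> 1 - y"
      using y(2) by (simp add: exp_minus inverse_le_iff_le inverse_le_imp_le)
    then show ?thesis using 1 by simp
  qed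
  have R1_ge: "exp (- (y / (1 - y) * (real K * real T))) \<le> R1"
  proof -
    have "exp (- (y / (1 - y) * (real K * real T))) = (\<Prod>i<T. \<Prod>j<K. exp (- (y / (1 - y))))"
      by (simp add: exp_of_nat_mult[symmetric] mult_ac)
    also have "\<dots> \<le> (\<Prod>i<T. \<Prod>j<K. ?f (n - 1) i j)"
      by (intro prod_mono conjI one prod_nonneg) auto
    also have "\<dots> = R1" unfolding R1_def by (rule prodR[symmetric]) simp
    finally show ?thesis .
  qed
  have R1_pos: "0 < R1" using R1_ge by (rule less_le_trans[rotated]) simp
  have two: "0 \<le> ?f (2 * n - 3) i j" "?f (2 * n - 3) i j \<le> (?f (n - 1) i j)\<^sup>2 * exp (16 / (real n)\<^sup>2)"
    if ij: "i < T" "j < K" for i j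
  proof -
    define x where "x = real (?N - i) - real j"
    define b where "b = real n - 1"
    have x: "(real n)\<^sup>2 / 4 \<le> x" using xge[OF ij] big by (simp add: x_def)
    have x0: "0 < x" using x big2 n0 by linarith
    have b: "0 \<le> b" "2 * b \<le> x" using x big2 n by (auto simp: b_def)
    have r: "real (n - 1) = b" "real (2 * n - 3) = 2 * b - 1" using n by (auto simp: b_def of_nat_diff)
    show "0 \<le> ?f (2 * n - 3) i j" unfolding r x_def[symmetric] using b x0 by simp
    have xb: "x / 2 \<le> x - b" using b by simp
    have "x\<^sup>2 / 4 \<le> (x - b)\<^sup>2" using power_mono[OF xb, of 2] x0 by (simp add: power_divide)
    \<comment> \<open>Two vertices meet \<open>2 * b - 1\<close> edges and not \<open>2 * b\<close>,
      since their common edge counts once. The resulting surplus \<open>x\<close> is absorbed by the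
      multiple \<open>4 / x\<close> of the square, because \<open>b\<close> is at most
      \<open>x / 2\<close>.\<close>
    then have "x \<le> 4 / x * (x - b)\<^sup>2" using x0 by (simp add: field_simps power2_eq_square)
    moreover have "(x - (2 * b - 1)) * x = (x - b)\<^sup>2 - b\<^sup>2 + x"
      by (simp add: power2_eq_square algebra_simps)
    moreover have "(x - b)\<^sup>2 * (1 + 4 / x) = (x - b)\<^sup>2 + 4 / x * (x - b)\<^sup>2" by (simp add: distrib_left)
    ultimately have "(x - (2 * b - 1)) * x \<le> (x - b)\<^sup>2 * (1 + 4 / x)"
      using zero_le_power2[of b] by linarith
    then have "(x - (2 * b - 1)) / x \<le> ((x - b) / x)\<^sup>2 * (1 + 4 / x)"
      using x0 by (simp add: power_divide divide_simps power2_eq_square)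
    also have "\<dots> \<le> ((x - b) / x)\<^sup>2 * exp (16 / (real n)\<^sup>2)"
    proof (rule mult_left_mono)
      have "4 / x \<le> 4 / ((real n)\<^sup>2 / 4)" by (rule divide_left_mono[OF x]) (use x0 n0 in auto)
      then have "1 + 4 / x \<le> 1 + 16 / (real n)\<^sup>2" by simp
      also have "\<dots> \<le> exp (16 / (real n)\<^sup>2)" by (rule exp_ge_add_one_self)
      finally show "1 + 4 / x \<le> exp (16 / (real n)\<^sup>2)" .
    qed simp
    finally show "?f (2 * n - 3) i j \<le> (?f (n - 1) i j)\<^sup>2 * exp (16 / (real n)\<^sup>2)"
      unfolding r x_def[symmetric] .
  qed
  have R2_le: "R2 \<le> R1\<^sup>2 * exp (16 * (real K * real T) / (real n)\<^sup>2)"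
  proof -
    have "R2 = (\<Prod>i<T. \<Prod>j<K. ?f (2 * n - 3) i j)" unfolding R2_def by (rule prodR) simp
    also have "\<dots> \<le> (\<Prod>i<T. \<Prod>j<K. (?f (n - 1) i j)\<^sup>2 * exp (16 / (real n)\<^sup>2))"
      by (intro prod_mono conjI two prod_nonneg) auto
    also have "\<dots> = (\<Prod>i<T. \<Prod>j<K. ?f (n - 1) i j)\<^sup>2 * (\<Prod>i<T. \<Prod>j<K. exp (16 / (real n)\<^sup>2))"
      by (simp only: prod.distrib prod_power_distrib)
    also have "(\<Prod>i<T. \<Prod>j<K. ?f (n - 1) i j) = R1" unfolding R1_def by (rule prodR[symmetric]) simp
    also have "(\<Prod>i<T. \<Prod>j<K. exp (16 / (real n)\<^sup>2)) = exp (16 * (real K * real T) / (real n)\<^sup>2)"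
      by (simp add: exp_of_nat_mult[symmetric] mult_ac)
    finally show ?thesis .
  qed
  have int: "integrable ?P g" for g :: "history \<Rightarrow> real"
    by (rule integrable_measure_pmf_finite[OF finite_achlioptas])
  have T': "T + K \<le> Suc ?N" using T by simp
  have EX: "measure_pmf.expectation ?P X = real n * R1"
  proof -
    have "measure_pmf.expectation ?P X = (\<Sum>v<n. measure_pmf.expectation ?P (\<lambda>h. of_bool (untouched {v} h)))"
      unfolding X_def by (rule Bochner_Integration.integral_sum) (rule int)
    also have "\<dots> = (\<Sum>v<n. R1)"
      by (rule sum.cong[OF refl]) (simp add: expectation_untouched[OF A T' card_touching_single] R1_def R_def)
    finally show ?thesis by simp
  qed
  have EX2: "measure_pmf.expectation ?P (\<lambda>h. (X h)\<^sup>2) \<le> real n * R1 + (real n)\<^sup>2 * R2"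
  proof -
    have "(\<lambda>h. (X h)\<^sup>2) = (\<lambda>h. \<Sum>u<n. \<Sum>v<n. of_bool (untouched {u, v} h))"
      by (rule ext) (simp only: X_def power2_eq_square sum_product untouched_pair of_bool_conj)
    then have "measure_pmf.expectation ?P (\<lambda>h. (X h)\<^sup>2) =
        (\<Sum>u<n. \<Sum>v<n. measure_pmf.expectation ?P (\<lambda>h. of_bool (untouched {u, v} h)))"
      by (simp only: Bochner_Integration.integral_sum int)
    also have "\<dots> \<le> (\<Sum>u<n. \<Sum>v<n. of_bool (v = u) * R1 + R2)"
    proof (intro sum_mono)
      fix u v assume uv: "u \<in> {..<n}" "v \<in> {..<n}"
      have R2_nonneg: "0 \<le> R2" unfolding R2_def R_def by (intro prod_nonneg) auto
      show "measure_pmf.expectation ?P (\<lambda>h. of_bool (untouched {u, v} h)) \<le> of_bool (v = u) * R1 + R2"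
      proof (cases "u = v")
        case True
        then show ?thesis
          using expectation_untouched[OF A T' card_touching_single, of v] uv R2_nonneg by (simp add: R1_def R_def)
      next
        case False
        then show ?thesis
          using expectation_untouched[OF A T' card_touching_pair, of u v] uv by (simp add: R2_def R_def)
      qed
    qed
    also have "\<dots> = real n * R1 + (real n)\<^sup>2 * R2"
      by (simp add: sum.distrib of_bool_def if_distrib[where f = "\<lambda>x. x * R1"] power2_eq_square cong: if_cong)
         (simp add: algebra_simps)
    finally show ?thesis .
  qed
  let ?\<mu> = "real n * R1"
  have \<mu>: "0 < ?\<mu>" using n0 R1_pos by simp
  \<comment> \<open>Chebyshev's inequality: a Hamilton cycle forces \<open>X h = 0\<close>, where
    the squared relative deviation is 1.\<close>
  have "measure_pmf.prob ?P {h. hamiltonian n (selected h)} \<le>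
      measure_pmf.expectation ?P (\<lambda>h. (X h / ?\<mu> - 1)\<^sup>2)"
  proof (rule prob_le_expectation[OF finite_achlioptas])
    fix h assume "h \<in> set_pmf ?P" and ham: "hamiltonian n (selected h)"
    then have "run n h" using achlioptas_run[OF A T'] by blast
    then have "X h = 0" using untouched_not_hamiltonian[of n h] ham by (simp add: X_def) blast
    then show "1 \<le> (X h / ?\<mu> - 1)\<^sup>2" by simp
  qed simp
  also have "\<dots> = measure_pmf.expectation ?P (\<lambda>h. (X h)\<^sup>2 / ?\<mu>\<^sup>2 - 2 / ?\<mu> * X h + 1)"
    by (rule Bochner_Integration.integral_cong[OF refl])
       (simp add: power2_diff power_divide power_mult_distrib)
  also have "\<dots> = measure_pmf.expectation ?P (\<lambda>h. (X h)\<^sup>2) / ?\<mu>\<^sup>2 - 2 / ?\<mu> * measure_pmf.expectation ?P X + 1"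
    by (simp add: int)
  also have "\<dots> = measure_pmf.expectation ?P (\<lambda>h. (X h)\<^sup>2) / ?\<mu>\<^sup>2 - 1" using n0 R1_pos by (simp add: EX)
  also have "\<dots> \<le> (real n * R1 + (real n)\<^sup>2 * R2) / ?\<mu>\<^sup>2 - 1"
    by (intro diff_right_mono divide_right_mono EX2) simp
  also have "\<dots> = 1 / ?\<mu> + R2 / R1\<^sup>2 - 1"
    using n0 R1_pos by (simp add: power2_eq_square field_simps)
  also have "\<dots> \<le> exp (y / (1 - y) * (real K * real T)) / real n + exp (16 * (real K * real T) / (real n)\<^sup>2) - 1"
  proof (intro diff_right_mono add_mono)
    have "1 / ?\<mu> \<le> 1 / (real n * exp (- (y / (1 - y) * (real K * real T))))"
      by (intro divide_left_mono mult_left_mono R1_ge mult_pos_pos) (use n0 R1_pos in auto)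
    then show "1 / ?\<mu> \<le> exp (y / (1 - y) * (real K * real T)) / real n"
      by (simp add: exp_minus field_simps)
    show "R2 / R1\<^sup>2 \<le> exp (16 * (real K * real T) / (real n)\<^sup>2)"
      using R2_le R1_pos by (simp add: divide_le_eq mult.commute)
  qed
  finally show ?thesis .
qed

section \<open>Asymptotics\<close>

text \<open>Stirling-type bound with 3 in place of e, from
  \<open>(1 + 1 / s) ^ s \<le> exp 1\<close>.\<close>

lemma power_self_le_fact: "real s ^ s \<le> 3 ^ s * fact s"
proof (induction s)
  case (Suc s)
  show ?case
  proof (cases "s = 0")
    case False
    have "(1 + 1 / real s) ^ s \<le> exp (1 / real s) ^ s"
      by (rule power_mono[OF exp_ge_add_one_self]) simp
    also have "\<dots> = exp 1" using False by (simp add: exp_of_nat_mult[symmetric])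
    also have "\<dots> \<le> 3" by (rule exp_le)
    finally have e: "(1 + 1 / real s) ^ s \<le> 3" .
    have "real (Suc s) ^ s = real s ^ s * (1 + 1 / real s) ^ s"
      using False by (simp add: power_mult_distrib[symmetric] distrib_left add.commute)
    also have "\<dots> \<le> (3 ^ s * fact s) * 3" by (rule mult_mono[OF Suc e]) auto
    finally have "real (Suc s) * real (Suc s) ^ s \<le> real (Suc s) * ((3 ^ s * fact s) * 3)"
      by (rule mult_left_mono) simp
    then show ?thesis by (simp add: mult_ac)
  qed simp
qed simp

lemma binomial_le_power:
  assumes "1 \<le> s" shows "real (n choose s) \<le> (3 * real n / real s) ^ s"
proof -
  have "real (n choose s) * fact s \<le> real n ^ s"
    using of_nat_mono[OF binomial_fact_pow[of n s], where 'a = real] by simp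
  then have "real (n choose s) \<le> real n ^ s / fact s" by (simp add: le_divide_eq)
  also have "\<dots> \<le> real n ^ s / (real s ^ s / 3 ^ s)"
    using power_self_le_fact[of s] assms by (intro divide_left_mono) (auto simp: field_simps)
  also have "\<dots> = (3 * real n / real s) ^ s" by (simp add: power_divide power_mult_distrib)
  finally show ?thesis .
qed

lemma sum_nat_half_power: "(\<Sum>s=1..k. real s * (1 / 2) ^ (s - 1)) \<le> 4"
proof -
  have "(\<Sum>s=1..k. real s * (1 / 2) ^ (s - 1)) = 4 - (2 * real k + 4) * (1 / 2) ^ k"
    by (induction k) (auto simp: algebra_simps add_divide_distrib)
  then show ?thesis by simp
qed

text \<open>With \<open>a = n / s\<close> the binomials contribute at most
  \<open>(3 * a ^ 4) ^ s\<close> and confinement \<open>(12 / a) ^ (5 * s)\<close>, together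
  \<open>(746496 / a) ^ s\<close> with \<open>746496 = 3 * 12 ^ 5\<close>. Requiring
  \<open>n / k\<close> to be at least twice this constant makes every base at most 1/2; one base
  kept aside supplies the factor \<open>1 / n\<close>, and the remaining series sums to at most
  4.\<close>

lemma expansion_sum_le:
  assumes n: "1492992 * k \<le> n" "1 \<le> n"
  shows "(\<Sum>s=1..k. real (n choose s) * real (n choose (3 * s)) * (12 * real s / real n) ^ (5 * s))
    \<le> 2985984 / real n"
proof -
  have "(\<Sum>s=1..k. real (n choose s) * real (n choose (3 * s)) * (12 * real s / real n) ^ (5 * s))
      \<le> (\<Sum>s=1..k. 746496 / real n * (real s * (1 / 2) ^ (s - 1)))"
  proof (rule sum_mono)
    fix s assume s: "s \<in> {1..k}"
    have s0: "0 < real s" "0 < real n" using s n by auto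
    define a where "a = real n / real s"
    have a0: "0 < a" using s0 by (simp add: a_def)
    have "real (n choose s) * real (n choose (3 * s)) \<le>
        (3 * real n / real s) ^ s * (3 * real n / real (3 * s)) ^ (3 * s)"
      by (intro mult_mono binomial_le_power) (use s in auto)
    also have "\<dots> = (3 * a) ^ s * (a ^ 3) ^ s" by (simp add: a_def power_mult)
    also have "\<dots> = (3 * a * a ^ 3) ^ s" by (rule power_mult_distrib[symmetric])
    also have "3 * a * a ^ 3 = 3 * a ^ 4" by (simp add: eval_nat_numeral)
    finally have "real (n choose s) * real (n choose (3 * s)) * (12 * real s / real n) ^ (5 * s) \<le>
        (3 * a ^ 4) ^ s * (12 * real s / real n) ^ (5 * s)"
      by (rule mult_right_mono) (use s0 in auto)
    also have "\<dots> = (3 * a ^ 4) ^ s * ((12 / a) ^ 5) ^ s" by (simp add: a_def power_mult)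
    also have "\<dots> = (3 * a ^ 4 * (12 / a) ^ 5) ^ s" by (rule power_mult_distrib[symmetric])
    also have "3 * a ^ 4 * (12 / a) ^ 5 = 746496 / a"
      using a0 by (simp add: power_divide eval_nat_numeral)
    also have "746496 / a = 746496 * real s / real n" by (simp add: a_def)
    also have "(746496 * real s / real n) ^ s = (746496 * real s / real n) * (746496 * real s / real n) ^ (s - 1)"
      using s by (cases s) auto
    also have "\<dots> \<le> (746496 * real s / real n) * (1 / 2) ^ (s - 1)"
    proof (intro mult_left_mono power_mono)
      have "1492992 * real s \<le> real n" using s n(1) by (simp flip: of_nat_mult)
      then show "746496 * real s / real n \<le> 1 / 2" using s0 by (simp add: divide_le_eq)
    qed (use s0 in auto)
    finally show "real (n choose s) * real (n choose (3 * s)) * (12 * real s / real n) ^ (5 * s) \<le>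
        746496 / real n * (real s * (1 / 2) ^ (s - 1))" by (simp add: mult_ac)
  qed
  also have "\<dots> = 746496 / real n * (\<Sum>s=1..k. real s * (1 / 2) ^ (s - 1))"
    by (simp only: sum_distrib_left)
  also have "\<dots> \<le> 746496 / real n * 4" by (rule mult_left_mono[OF sum_nat_half_power]) simp
  finally show ?thesis by simp
qed

text \<open>Common tail bound for the two stages of linear length: a total decay of
  \<open>(b + 1) * n\<close> in the exponent beats a potential that starts at \<open>2 ^ L\<close>.
  The \<open>- 1\<close> leaves room for rounding the number of rounds.\<close>

lemma decay_bound:
  fixes c b :: real
  assumes "0 \<le> c" "c \<le> 1" "(b + 1) * real n - 1 \<le> c * real t" "real L \<le> b * real n"
  shows "(1 - c) ^ t * 2 ^ L \<le> exp (1 - real n)"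
proof -
  have "(1 - c) ^ t \<le> exp (- c) ^ t" by (rule power_mono) (use assms exp_ge_add_one_self[of "- c"] in auto)
  also have "\<dots> = exp (- (c * real t))" by (simp add: exp_of_nat_mult[symmetric] mult.commute)
  also have "\<dots> \<le> exp (1 - (b + 1) * real n)" using assms(3) by simp
  finally have 1: "(1 - c) ^ t \<le> exp (1 - (b + 1) * real n)" .
  have "(2::real) ^ L \<le> exp 1 ^ L" by (rule power_mono) (use exp_ge_add_one_self[of 1] in auto)
  also have "\<dots> = exp (real L)" by (simp add: exp_of_nat_mult[symmetric])
  also have "\<dots> \<le> exp (b * real n)" using assms(4) by simp
  finally have "(2::real) ^ L \<le> exp (b * real n)" .
  then have "(1 - c) ^ t * 2 ^ L \<le> exp (1 - (b + 1) * real n) * exp (b * real n)"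
    by (intro mult_mono 1) auto
  also have "\<dots> = exp (1 - real n)" by (simp add: exp_add[symmetric] algebra_simps)
  finally show ?thesis .
qed

lemma (in serving) not_hamiltonian_prob:
  assumes "TA \<le> T1" "T1 \<le> T" "T + K \<le> card (all_edges n)"
    and k: "1 \<le> k" "3 * k < d" "1492992 * k \<le> n" and \<gamma>: "0 \<le> \<gamma>" "\<gamma> \<le> 1" "\<gamma> * (real n)\<^sup>2 \<le> (real k + 1)\<^sup>2"
  shows "measure_pmf.prob (achlioptas n K alg T) {h. \<not> hamiltonian n (selected h)} \<le>
    (1 - \<gamma> / 2) ^ (T - T1) * 2 ^ (2 * n + 1) + 2985984 / real n +
    (1 - (1 - \<eta>) * (2 * real K / real n * (1 - 2 * \<eta>) * (1 - 4 * \<eta>))) ^ (T1 - TA) * (real n / \<eta> ^ 10) +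
    (1 - \<eta> / 10) ^ TA * 2 ^ (10 * n)"
  using boosting[OF assms(2,3) k(1) \<gamma>] expander_prob[OF k(2)] expansion_sum_le[OF k(3)]
    needy_none[OF assms(1)] needy_few[OF assms(1)] k(3) n4 by simp

lemma tendsto_one_of_complement:
  fixes p :: "nat \<Rightarrow> 'a pmf" and b :: "nat \<Rightarrow> real"
  assumes "b \<longlonglongrightarrow> 0" "\<forall>\<^sub>F n in sequentially. measure_pmf.prob (p n) (- X n) \<le> b n"
  shows "(\<lambda>n. measure_pmf.prob (p n) (X n)) \<longlonglongrightarrow> 1"
proof (rule tendsto_sandwich)
  show "(\<lambda>n. 1 - b n) \<longlonglongrightarrow> 1" using tendsto_diff[OF tendsto_const assms(1), of 1] by simp
  show "\<forall>\<^sub>F n in sequentially. 1 - b n \<le> measure_pmf.prob (p n) (X n)"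
    using assms(2)
  proof eventually_elim
    case (elim n)
    have "measure_pmf.prob (p n) (- X n) = 1 - measure_pmf.prob (p n) (X n)"
      using measure_pmf.prob_compl[of "X n" "p n"] by (simp add: Compl_eq_Diff_UNIV)
    then show ?case using elim by simp
  qed
qed auto

text \<open>The form in which K = o(log n) is used: \<open>n * ln n / K\<close> exceeds every fixed
  multiple of \<open>n\<close>.\<close>

lemma ln_over_K_at_top:
  fixes K :: "nat \<Rightarrow> nat"
  assumes K2: "\<And>n. K n \<ge> 2" and o: "(\<lambda>n. real (K n)) \<in> o(\<lambda>n. ln (real n))"
  shows "filterlim (\<lambda>n. ln (real n) / real (K n)) at_top sequentially"
proof -
  have "(\<lambda>n. real (K n) / ln (real n)) \<longlonglongrightarrow> 0" by (rule smalloD_tendsto[OF o])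
  moreover have "\<forall>\<^sub>F n in sequentially. 0 < real (K n) / ln (real n)"
    using eventually_gt_at_top[of 1]
  proof eventually_elim
    case (elim n)
    then show ?case using K2[of n] by simp
  qed
  ultimately have "filterlim (\<lambda>n. inverse (real (K n) / ln (real n))) at_top sequentially"
    by (intro filterlim_inverse_at_top) auto
  then show ?thesis by (simp add: inverse_eq_divide)
qed

section \<open>Lower bound: choice of parameters\<close>

lemma not_hamiltonian_tendsto:
  fixes K :: "nat \<Rightarrow> nat" and \<epsilon> :: real and A :: "nat \<Rightarrow> algorithm"
  assumes K2: "\<And>n. K n \<ge> 2" and o: "(\<lambda>n. real (K n)) \<in> o(\<lambda>n. ln (real n))" and \<epsilon>: "\<epsilon> > 0"
    and A: "\<And>n. online_algorithm n (K n) (A n)"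
  shows "(\<lambda>n. measure_pmf.prob
      (achlioptas n (K n) (A n) (nat \<lfloor>(1 - \<epsilon>) * (real n * ln (real n) / (2 * real (K n)))\<rfloor>))
      {h. \<not> hamiltonian n (selected h)}) \<longlonglongrightarrow> 1"
proof -
  \<comment> \<open>Passing to \<open>\<delta> \<le> \<epsilon>\<close> only weakens the bound on
    the number of rounds and covers \<open>\<epsilon> \<ge> 1\<close>, where no round is played.
    With \<open>\<eta> = \<delta> / 8\<close> one has
    \<open>(1 - \<eta>)\<^sup>2 \<ge> 1 - \<delta> / 4\<close>, and
    \<open>(1 - \<delta> / 2) * (1 - \<delta> / 4) \<ge> 1 - \<delta>\<close> then leaves the
    exponent \<open>1 - \<delta> / 2\<close>.\<close>
  define \<delta> where "\<delta> = min \<epsilon> (1 / 2)"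
  define \<eta> where "\<eta> = \<delta> / 8"
  have \<delta>: "0 < \<delta>" "\<delta> \<le> 1 / 2" "\<delta> \<le> \<epsilon>" using \<epsilon> by (auto simp: \<delta>_def)
  have \<eta>: "0 < \<eta>" "\<eta> \<le> 1 / 16" using \<delta> by (auto simp: \<eta>_def)
  define T where "T = (\<lambda>n. nat \<lfloor>(1 - \<epsilon>) * (real n * ln (real n) / (2 * real (K n)))\<rfloor>)"
  define b where "b = (\<lambda>n. real n powr (- (\<delta> / 2)) + exp (8 * ln (real n) / real n) - 1)"
  have "b \<longlonglongrightarrow> 0" unfolding b_def using \<delta> by real_asymp
  moreover have "\<forall>\<^sub>F n in sequentially.
      measure_pmf.prob (achlioptas n (K n) (A n) (T n)) (- {h. \<not> hamiltonian n (selected h)}) \<le> b n"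
  proof -
    have ev1: "\<forall>\<^sub>F n in sequentially. 1 < ln (real n) / real (K n)"
      using ln_over_K_at_top[OF K2 o] by (simp add: filterlim_at_top_dense)
    have "(\<lambda>n. (real n * ln (real n) + ln (real n) + real n) / (real n)\<^sup>2) \<longlonglongrightarrow> 0" by real_asymp
    then have ev2: "\<forall>\<^sub>F n in sequentially. (real n * ln (real n) + ln (real n) + real n) / (real n)\<^sup>2 < \<eta> / 2"
      by (rule order_tendstoD(2)) (use \<eta> in simp)
    have "(\<lambda>n. 4 / real n) \<longlonglongrightarrow> 0" by real_asymp
    then have ev3: "\<forall>\<^sub>F n in sequentially. 4 / real n < \<eta>"
      by (rule order_tendstoD(2)) (use \<eta> in simp)
    show ?thesis using ev1 ev2 ev3 eventually_ge_at_top[of 8]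
    proof eventually_elim
      case (elim n)
      have n0: "0 < real n" using elim by simp
      have ln0: "0 < ln (real n)" using elim(4) by simp
      have K0: "0 < real (K n)" using K2[of n] by simp
      have Kln: "real (K n) \<le> ln (real n)" using elim(1) K0 by (simp add: less_divide_eq)
      let ?x = "real n * ln (real n) / (2 * real (K n))"
      have x0: "0 \<le> ?x" using n0 ln0 K0 by simp
      have "(1 - \<epsilon>) * ?x \<le> (1 - \<delta>) * ?x" by (rule mult_right_mono[OF _ x0]) (use \<delta> in simp)
      \<comment> \<open>Nonnegativity matters because \<open>nat\<close> turns a negative floor into
        0.\<close>
      moreover have "0 \<le> (1 - \<delta>) * ?x" by (rule mult_nonneg_nonneg[OF _ x0]) (use \<delta> in simp)
      ultimately have Tx: "real (T n) \<le> (1 - \<delta>) * ?x" unfolding T_def by linarith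
      then have "real (K n) * real (T n) \<le> real (K n) * ((1 - \<delta>) * ?x)" by (rule mult_left_mono) simp
      also have "\<dots> = (1 - \<delta>) * (real n * ln (real n)) / 2" using K0 by simp
      finally have KT: "real (K n) * real (T n) \<le> (1 - \<delta>) * (real n * ln (real n)) / 2" .
      have "1 * real (T n) \<le> real (K n) * real (T n)" by (rule mult_right_mono) (use K2[of n] in auto)
      moreover have "(1 - \<delta>) * (real n * ln (real n)) \<le> 1 * (real n * ln (real n))"
        by (rule mult_right_mono) (use \<delta> n0 ln0 in auto)
      ultimately have Tn: "real (T n) \<le> real n * ln (real n) / 2" using KT by simp
      have small: "real n * ln (real n) + ln (real n) + real n < \<eta> / 2 * (real n)\<^sup>2"
        using elim(2) n0 by (simp add: divide_less_eq)
      let ?N = "real (card (all_edges n))"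
      have N: "?N = (real n)\<^sup>2 / 2 - real n / 2"
        by (simp add: real_card_all_edges power2_eq_square algebra_simps diff_divide_distrib)
      have nl: "0 \<le> real n * ln (real n)" using n0 ln0 by simp
      have rest: "(1 - \<eta>) * ((real n)\<^sup>2 / 2) \<le> ?N - real (T n) - real (K n)"
      proof -
        have "(1 - \<eta>) * ((real n)\<^sup>2 / 2) = (real n)\<^sup>2 / 2 - \<eta> / 2 * (real n)\<^sup>2"
          by (simp add: left_diff_distrib)
        then show ?thesis using small N Tn Kln nl n0 ln0 by linarith
      qed
      have sq0: "0 < (real n)\<^sup>2" using n0 by simp
      have half: "(real n)\<^sup>2 / 4 \<le> (1 - \<eta>) * ((real n)\<^sup>2 / 2)"
        using mult_right_mono[of "1 / 2" "1 - \<eta>" "(real n)\<^sup>2 / 2"] \<eta> by simp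
      \<comment> \<open>This is \<open>n\<close> divided by the lower bound
        \<open>(1 - \<eta>) * (n\<^sup>2 / 2)\<close> for the number of available pairs.\<close>
      define y where "y = 2 / ((1 - \<eta>) * real n)"
      have y0: "0 < y" using n0 \<eta> by (simp add: y_def)
      have y_le: "real n / (?N - real (T n) - real (K n)) \<le> y"
      proof -
        have "real n / (?N - real (T n) - real (K n)) \<le> real n / ((1 - \<eta>) * ((real n)\<^sup>2 / 2))"
        proof (rule divide_left_mono[OF rest])
          have "0 < (1 - \<eta>) * ((real n)\<^sup>2 / 2)" using half sq0 by linarith
          moreover from this have "0 < ?N - real (T n) - real (K n)" using rest by linarith
          ultimately show "0 < (?N - real (T n) - real (K n)) * ((1 - \<eta>) * ((real n)\<^sup>2 / 2))"
            by (metis mult_pos_pos)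
        qed (use n0 in simp)
        also have "\<dots> = y" using n0 \<eta> by (simp add: y_def power2_eq_square field_simps)
        finally show ?thesis .
      qed
      have y1: "y \<le> \<eta>"
      proof -
        have "y \<le> 2 / (1 / 2 * real n)" unfolding y_def
          by (rule divide_left_mono) (use \<eta> n0 in auto)
        then show ?thesis using elim(3) by simp
      qed
      have sum: "T n + K n \<le> card (all_edges n)"
      proof -
        have "real (T n) + real (K n) \<le> ?N" using rest half sq0 by linarith
        then show ?thesis by linarith
      qed
      have "measure_pmf.prob (achlioptas n (K n) (A n) (T n)) {h. hamiltonian n (selected h)} \<le>
        exp (y / (1 - y) * (real (K n) * real (T n))) / real n +
          exp (16 * (real (K n) * real (T n)) / (real n)\<^sup>2) - 1"
        by (rule hamiltonian_prob_le[OF A sum elim(4) order_trans[OF half rest] y_le]) (use y1 \<eta> in linarith)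
      also have "\<dots> \<le> b n" unfolding b_def
      proof (intro diff_right_mono add_mono)
        have z: "y / (1 - y) \<le> 2 / ((1 - \<eta>)\<^sup>2 * real n)"
        proof -
          have "y / (1 - y) \<le> y / (1 - \<eta>)" by (rule divide_left_mono) (use y0 y1 \<eta> in auto)
          then show ?thesis by (simp add: y_def power2_eq_square mult_ac)
        qed
        have "y / (1 - y) * (real (K n) * real (T n)) \<le>
            2 / ((1 - \<eta>)\<^sup>2 * real n) * ((1 - \<delta>) * (real n * ln (real n)) / 2)"
          by (rule mult_mono[OF z KT]) (use \<eta> n0 in auto)
        also have "\<dots> = (1 - \<delta>) / (1 - \<eta>)\<^sup>2 * ln (real n)" using n0 \<eta> by (simp add: field_simps)
        also have "\<dots> \<le> (1 - \<delta> / 2) * ln (real n)"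
        proof (rule mult_right_mono)
          have "1 - \<delta> / 4 \<le> (1 - \<eta>)\<^sup>2" using \<delta> by (simp add: \<eta>_def power2_eq_square algebra_simps)
          then have "(1 - \<delta> / 2) * (1 - \<delta> / 4) \<le> (1 - \<delta> / 2) * (1 - \<eta>)\<^sup>2"
            by (rule mult_left_mono) (use \<delta> in simp)
          moreover have "1 - \<delta> \<le> (1 - \<delta> / 2) * (1 - \<delta> / 4)" using \<delta> by (simp add: algebra_simps)
          ultimately have "1 - \<delta> \<le> (1 - \<delta> / 2) * (1 - \<eta>)\<^sup>2" by simp
          then show "(1 - \<delta>) / (1 - \<eta>)\<^sup>2 \<le> 1 - \<delta> / 2" using \<eta> by (simp add: divide_le_eq)
        qed (use ln0 in simp)
        finally have "exp (y / (1 - y) * (real (K n) * real (T n))) / real n \<le>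
            exp ((1 - \<delta> / 2) * ln (real n)) / real n"
          by (intro divide_right_mono) auto
        also have "\<dots> = exp ((1 - \<delta> / 2) * ln (real n) - ln (real n))" using n0 by (simp add: exp_diff)
        also have "\<dots> = real n powr (- (\<delta> / 2))" using n0 by (simp add: powr_def algebra_simps)
        finally show "exp (y / (1 - y) * (real (K n) * real (T n))) / real n \<le> real n powr (- (\<delta> / 2))" .
        have "16 * (real (K n) * real (T n)) / (real n)\<^sup>2 \<le> 16 * (real n * ln (real n) / 2) / (real n)\<^sup>2"
        proof (intro divide_right_mono mult_left_mono)
          show "real (K n) * real (T n) \<le> real n * ln (real n) / 2"
            using KT \<open>(1 - \<delta>) * (real n * ln (real n)) \<le> 1 * (real n * ln (real n))\<close> by simp
        qed auto
        also have "\<dots> = 8 * ln (real n) / real n" using n0 by (simp add: power2_eq_square)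
        finally show "exp (16 * (real (K n) * real (T n)) / (real n)\<^sup>2) \<le> exp (8 * ln (real n) / real n)" by simp
      qed
      finally show ?case by (simp add: Collect_neg_eq[symmetric])
    qed
  qed
  ultimately show ?thesis unfolding T_def by (rule tendsto_one_of_complement)
qed


section \<open>Upper bound: choice of parameters\<close>

lemma length_achlioptas: "h \<in> set_pmf (achlioptas n K A t) \<Longrightarrow> length h \<le> t"
proof (induction t arbitrary: h)
  case (Suc t)
  then obtain g where g: "g \<in> set_pmf (achlioptas n K A t)"
    "h \<in> set_pmf (if offers n K (selected g) = {} then return_pmf g
         else map_pmf (\<lambda>S. g @ [(S, A g S)]) (pmf_of_set (offers n K (selected g))))"
    by auto
  then have "length h \<le> Suc (length g)" by (auto split: if_splits simp: finite_offers)
  then show ?case using Suc.IH[OF g(1)] by simp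
qed simp

lemma hamiltonian_tendsto:
  fixes K :: "nat \<Rightarrow> nat" and \<epsilon> :: real
  assumes K2: "\<And>n. K n \<ge> 2" and o: "(\<lambda>n. real (K n)) \<in> o(\<lambda>n. ln (real n))" and \<epsilon>: "\<epsilon> > 0"
  obtains m d T1 :: "nat \<Rightarrow> nat" where
    "(\<lambda>n. measure_pmf.prob
      (achlioptas n (K n) (strategy n (m n) (d n) (T1 n))
        (nat \<lfloor>(1 + \<epsilon>) * (real n * ln (real n) / (2 * real (K n)))\<rfloor>))
      {h. hamiltonian n (selected h)}) \<longlonglongrightarrow> 1"
proof -
  \<comment> \<open>With \<open>\<eta> = \<delta> / 100\<close> the product
    \<open>(1 - 7 * \<eta>) * (1 + \<delta> / 3)\<close> is still at least
    \<open>1 + \<delta> / 6\<close>; the 7 collects the losses \<eta>, 2 \<eta> and 4 \<eta> in the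
    service rate.\<close>
  define \<delta> where "\<delta> = min \<epsilon> 1"
  define \<eta> where "\<eta> = \<delta> / 100"
  have \<delta>: "0 < \<delta>" "\<delta> \<le> 1" "\<delta> \<le> \<epsilon>" using \<epsilon> by (auto simp: \<delta>_def)
  have \<eta>: "0 < \<eta>" "\<eta> \<le> 1 / 100" using \<delta> by (auto simp: \<eta>_def)
  \<comment> \<open>The first bound is the one demanded by \<open>expansion_sum_le\<close>, the
    second gives \<open>3 * k n < d n\<close>.\<close>
  define \<beta> where "\<beta> = min (1 / 1492992) (\<eta> / 4)"
  have \<beta>: "0 < \<beta>" "\<beta> \<le> 1 / 1492992" "\<beta> \<le> \<eta> / 4" using \<eta> by (auto simp: \<beta>_def)
  define x where "x = (\<lambda>n. real n * ln (real n) / (2 * real (K n)))"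
  define T where "T = (\<lambda>n. nat \<lfloor>(1 + \<epsilon>) * x n\<rfloor>)"
  \<comment> \<open>This length is used twice, for the initial stage and for the boosting stage; up
    to rounding it leaves at least \<open>(1 + \<epsilon> / 2) * x n\<close> rounds for the middle
    stage.\<close>
  define TA where "TA = (\<lambda>n. nat \<lfloor>\<epsilon> / 4 * x n\<rfloor>)"
  define T1 where "T1 = (\<lambda>n. T n - TA n)"
  define m where "m = (\<lambda>n. nat \<lfloor>\<eta> * real n / real (K n)\<rfloor>)"
  define d where "d = (\<lambda>n. nat \<lceil>\<eta> * real n\<rceil>)"
  define k where "k = (\<lambda>n. nat \<lfloor>\<beta> * real n\<rfloor>)"
  define b where "b = (\<lambda>n. exp (1 - real n) + 2985984 / real n + real n powr (- (\<delta> / 6)) / \<eta> ^ 10 + exp (1 - real n))"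
  have "b \<longlonglongrightarrow> 0"
  proof -
    have "(\<lambda>n. exp (1 - real n)) \<longlonglongrightarrow> 0" "(\<lambda>n. 2985984 / real n) \<longlonglongrightarrow> 0" by real_asymp+
    moreover have "(\<lambda>n. real n powr (- (\<delta> / 6))) \<longlonglongrightarrow> 0" using \<delta> by real_asymp
    then have "(\<lambda>n. real n powr (- (\<delta> / 6)) / \<eta> ^ 10) \<longlonglongrightarrow> 0 / \<eta> ^ 10"
      by (rule tendsto_divide[OF _ tendsto_const]) (use \<eta> in simp)
    ultimately have "b \<longlonglongrightarrow> 0 + 0 + 0 / \<eta> ^ 10 + 0" unfolding b_def by (intro tendsto_add)
    then show ?thesis by simp
  qed
  moreover have "\<forall>\<^sub>F n in sequentially. measure_pmf.prob
      (achlioptas n (K n) (strategy n (m n) (d n) (T1 n)) (T n)) (- {h. hamiltonian n (selected h)}) \<le> b n"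
  proof -
    let ?w = "\<lambda>n. ln (real n) / real (K n)"
    have w: "\<forall>\<^sub>F n in sequentially. c < ?w n" for c
      using ln_over_K_at_top[OF K2 o] by (simp add: filterlim_at_top_dense)
    \<comment> \<open>The summand 1 gives \<open>K n \<le> ln n\<close>. In
      \<open>decay_bound\<close> the initial stage needs 11 = 10 + 1 at rate
      \<open>\<eta> / 10\<close> and the boosting stage 4 = 3 + 1 at rate
      \<open>\<beta>\<^sup>2 / 2\<close>, each over about \<open>\<epsilon> / 8 * (n * ?w n)\<close>
      rounds; hence 880 = 11 * 10 * 8 and 64 = 4 * 2 * 8. The last term makes
      \<open>\<delta> * x n / 6\<close> at least 1, which absorbs a rounding loss.\<close>
    have ev1: "\<forall>\<^sub>F n in sequentially. 1 + 880 / (\<eta> * \<epsilon>) + 64 / (\<beta>\<^sup>2 * \<epsilon>) + 12 / \<delta> < ?w n" by (rule w)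
    have "(\<lambda>n. (real n * ln (real n) + ln (real n) + real n) / (real n)\<^sup>2) \<longlonglongrightarrow> 0" by real_asymp
    \<comment> \<open>The constant \<open>4 * (1 + \<epsilon>)\<close> is chosen so that
      \<open>(real n)\<^sup>2 / 4\<close> pairs remain free after all \<open>T n\<close> rounds,
      with room for one more offer.\<close>
    then have ev2: "\<forall>\<^sub>F n in sequentially. (real n * ln (real n) + ln (real n) + real n) / (real n)\<^sup>2 < 1 / (4 * (1 + \<epsilon>))"
      by (rule order_tendstoD(2)) (use \<epsilon> in simp)
    have "(\<lambda>n. ln (real n) / real n) \<longlonglongrightarrow> 0" by real_asymp
    then have ev3: "\<forall>\<^sub>F n in sequentially. ln (real n) / real n < \<eta> / 2"
      by (rule order_tendstoD(2)) (use \<eta> in simp)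
    have "(\<lambda>n. 2 / real n) \<longlonglongrightarrow> 0" by real_asymp
    then have ev4: "\<forall>\<^sub>F n in sequentially. 2 / real n < \<beta>"
      by (rule order_tendstoD(2)) (use \<beta> in simp)
    show ?thesis using ev1 ev2 ev3 ev4 eventually_ge_at_top[of 4]
    proof eventually_elim
      case (elim n)
      have n0: "0 < real n" using elim by simp
      have ln0: "0 < ln (real n)" using elim(5) by simp
      have K0: "0 < real (K n)" "2 \<le> real (K n)" using K2[of n] by auto
      have pos: "0 < 880 / (\<eta> * \<epsilon>)" "0 < 64 / (\<beta>\<^sup>2 * \<epsilon>)" "0 < 12 / \<delta>" using \<eta> \<epsilon> \<beta> \<delta> by auto
      have w1: "1 < ?w n" and w2: "880 / (\<eta> * \<epsilon>) < ?w n" and w3: "64 / (\<beta>\<^sup>2 * \<epsilon>) < ?w n" and w4: "12 / \<delta> < ?w n"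
        using elim(1) pos by linarith+
      have Kln: "real (K n) \<le> ln (real n)" using w1 K0 by (simp add: less_divide_eq)
      have xw: "x n = real n * ?w n / 2" by (simp add: x_def)
      have wx: "real n * ?w n \<ge> ?w n" using elim(5) w1 mult_right_mono[of 1 "real n" "?w n"] by simp
      have x0: "0 < x n" unfolding x_def using n0 ln0 K0 by simp
      have x1: "6 / \<delta> \<le> x n"
      proof -
        have "12 / \<delta> \<le> real n * ?w n" using wx w4 by linarith
        then have "12 / \<delta> / 2 \<le> real n * ?w n / 2" by (rule divide_right_mono) simp
        then show ?thesis unfolding xw by simp
      qed
      have Tle: "real (T n) \<le> (1 + \<epsilon>) * x n" unfolding T_def using x0 \<epsilon> by simp
      have Tge: "(1 + \<epsilon>) * x n - 1 \<le> real (T n)" unfolding T_def by linarith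
      have TAle: "real (TA n) \<le> \<epsilon> / 4 * x n" unfolding TA_def using mult_nonneg_nonneg[of "\<epsilon> / 4" "x n"] x0 \<epsilon> by linarith
      have TAge: "\<epsilon> / 4 * x n - 1 \<le> real (TA n)" unfolding TA_def by linarith
      have e1: "(1 + \<epsilon>) * x n = x n + \<epsilon> * x n" "(1 + \<epsilon> / 2) * x n = x n + \<epsilon> * x n / 2"
        "\<epsilon> / 4 * x n = \<epsilon> * x n / 4" by (simp_all add: algebra_simps)
      have ex0: "0 < \<epsilon> * x n" using \<epsilon> x0 by simp
      have x2: "2 \<le> x n"
      proof -
        have "6 \<le> 6 / \<delta>" using \<delta> by (simp add: le_divide_eq)
        then show ?thesis using x1 by linarith
      qed
      have TAT: "real (TA n) + real (TA n) \<le> real (T n)" using Tge TAle e1 ex0 x2 by linarith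
      then have TA1: "TA n \<le> T1 n" unfolding T1_def by linarith
      have T1T: "T1 n \<le> T n" unfolding T1_def by simp
      have TT1: "T n - T1 n = TA n" using TAT unfolding T1_def by linarith
      have TB: "real (T1 n - TA n) = real (T n) - 2 * real (TA n)" using TAT unfolding T1_def by linarith
      have Tn: "real (T n) \<le> (1 + \<epsilon>) * (real n * ln (real n) / 4)"
      proof -
        have "x n \<le> real n * ln (real n) / 4"
          unfolding x_def by (rule divide_left_mono) (use K0 n0 ln0 in auto)
        then have "(1 + \<epsilon>) * x n \<le> (1 + \<epsilon>) * (real n * ln (real n) / 4)" by (rule mult_left_mono) (use \<epsilon> in simp)
        then show ?thesis using Tle by simp
      qed
      let ?N = "real (card (all_edges n))"
      have N: "?N = (real n)\<^sup>2 / 2 - real n / 2"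
        by (simp add: real_card_all_edges power2_eq_square algebra_simps diff_divide_distrib)
      have small: "(1 + \<epsilon>) * (real n * ln (real n) + ln (real n) + real n) < (real n)\<^sup>2 / 4"
        using elim(2) n0 \<epsilon> by (simp add: field_simps)
      have small': "(1 + \<epsilon>) * (real n * ln (real n)) + ln (real n) + real n < (real n)\<^sup>2 / 4"
      proof -
        have "0 \<le> \<epsilon> * (ln (real n) + real n)" using \<epsilon> ln0 n0 by simp
        then have "(1 + \<epsilon>) * (real n * ln (real n)) + ln (real n) + real n \<le>
            (1 + \<epsilon>) * (real n * ln (real n) + ln (real n) + real n)" by (simp add: algebra_simps)
        then show ?thesis using small by simp
      qed
      have nl: "0 \<le> (1 + \<epsilon>) * (real n * ln (real n))" using \<epsilon> n0 ln0 by simp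
      have rest: "(real n)\<^sup>2 / 4 + real (K n) + real (T n) \<le> ?N"
        using small' N Tn Kln nl n0 ln0 by linarith
      interpret serving n "K n" "m n" "d n" "T1 n" \<eta>
      proof
        show "1 \<le> K n" using K2[of n] by simp
        show "0 < \<eta>" "\<eta> \<le> 1 / 10" using \<eta> by auto
        show "4 \<le> n" by (rule elim)
        have "0 \<le> \<eta> * real n / real (K n)" using \<eta> by simp
        then have "real (m n) \<le> \<eta> * real n / real (K n)" unfolding m_def by simp
        then show "real (m n) * real (K n) \<le> \<eta> * real n" using K0 by (simp add: le_divide_eq)
        have "\<eta> * real n / real (K n) - 1 \<le> real (m n)" unfolding m_def by linarith
        then have "(\<eta> * real n / real (K n) - 1) * real (K n) \<le> real (m n) * real (K n)"
          by (rule mult_right_mono) simp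
        also have "(\<eta> * real n / real (K n) - 1) * real (K n) = \<eta> * real n - real (K n)"
          using K0 by (simp add: left_diff_distrib)
        finally have "\<eta> * real n - real (K n) \<le> real (m n) * real (K n)" .
        moreover have "ln (real n) \<le> \<eta> / 2 * real n" using elim(3) n0 by (simp add: divide_less_eq)
        moreover have "\<eta> * real n = \<eta> / 2 * real n + \<eta> / 2 * real n" by simp
        ultimately show "\<eta> / 2 * real n \<le> real (m n) * real (K n)" using Kln by linarith
        have "real (d n) \<le> \<eta> * real n + 1" unfolding d_def using mult_nonneg_nonneg[of \<eta> "real n"] \<eta> by linarith
        moreover have "2 \<le> \<beta> * real n" using elim(4) n0 by (simp add: divide_less_eq)
        moreover have "\<beta> * real n \<le> \<eta> * real n" by (rule mult_right_mono) (use \<beta> \<eta> in auto)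
        moreover have "(1 - 2 * \<eta>) * real n = real n - \<eta> * real n - \<eta> * real n" by (simp add: algebra_simps)
        ultimately show "(1 - 2 * \<eta>) * real n \<le> real n - 1 - real (d n)" by linarith
        have "real (T1 n) \<le> real (T n)" using T1T by simp
        then have *: "(real n)\<^sup>2 / 4 + real (K n) + real (T1 n) \<le> ?N" using rest by linarith
        have "0 \<le> (real n)\<^sup>2 / 4" by simp
        then show "T1 n + K n \<le> card (all_edges n)" using * by linarith
        have "(real n)\<^sup>2 / 4 \<le> ?N - real (T1 n)" using * K0(1) by linarith
        then have "4 * ((real n)\<^sup>2 / 4) \<le> 4 * (?N - real (T1 n))" by (rule mult_left_mono) simp
        then show "(real n)\<^sup>2 \<le> 4 * (?N - real (T1 n))" by simp
      qed
      have TK: "T n + K n \<le> card (all_edges n)"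
      proof -
        have "0 \<le> (real n)\<^sup>2 / 4" by simp
        then show ?thesis using rest by linarith
      qed
      have bn: "2 \<le> \<beta> * real n" using elim(4) n0 by (simp add: divide_less_eq)
      have kle: "real (k n) \<le> \<beta> * real n" unfolding k_def using bn by simp
      have kge: "\<beta> * real n \<le> real (k n) + 1" unfolding k_def by linarith
      have k1: "1 \<le> k n" using bn kge by linarith
      have k2: "3 * k n < d n"
      proof -
        have "\<beta> * real n \<le> \<eta> / 4 * real n" by (rule mult_right_mono[OF \<beta>(3)]) simp
        moreover have "\<eta> * real n \<le> real (d n)" unfolding d_def by linarith
        moreover have "0 < \<eta> * real n" using \<eta> n0 by simp
        ultimately show ?thesis using kle by linarith
      qed
      have k3: "1492992 * k n \<le> n"
      proof -
        have "\<beta> * real n \<le> 1 / 1492992 * real n" by (rule mult_right_mono[OF \<beta>(2)]) simp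
        then show ?thesis using kle by linarith
      qed
      have \<gamma>: "\<beta>\<^sup>2 * (real n)\<^sup>2 \<le> (real (k n) + 1)\<^sup>2" "0 \<le> \<beta>\<^sup>2" "\<beta>\<^sup>2 \<le> 1"
      proof -
        show "\<beta>\<^sup>2 * (real n)\<^sup>2 \<le> (real (k n) + 1)\<^sup>2"
          unfolding power_mult_distrib[symmetric] by (rule power_mono[OF kge]) (use bn in linarith)
        show "\<beta>\<^sup>2 \<le> 1" by (rule power_le_one) (use \<beta> in auto)
      qed simp
      have "measure_pmf.prob (achlioptas n (K n) alg (T n)) {h. \<not> hamiltonian n (selected h)} \<le>
        (1 - \<beta>\<^sup>2 / 2) ^ (T n - T1 n) * 2 ^ (2 * n + 1) + 2985984 / real n +
        (1 - (1 - \<eta>) * (2 * real (K n) / real n * (1 - 2 * \<eta>) * (1 - 4 * \<eta>))) ^ (T1 n - TA n) * (real n / \<eta> ^ 10) +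
        (1 - \<eta> / 10) ^ TA n * 2 ^ (10 * n)"
        by (rule not_hamiltonian_prob[OF TA1 T1T TK k1 k2 k3 \<gamma>(2,3,1)])
      also have "\<dots> \<le> b n" unfolding b_def
      proof (intro add_mono order_refl)
        have TAw: "c * (\<epsilon> / 8 * (real n * ?w n)) - 1 \<le> c * real (TA n)" if "0 \<le> c" "c \<le> 1" for c
        proof -
          have "c * (\<epsilon> / 4 * x n - 1) \<le> c * real (TA n)" by (rule mult_left_mono[OF TAge that(1)])
          moreover have "c * (\<epsilon> / 4 * x n - 1) = c * (\<epsilon> / 8 * (real n * ?w n)) - c"
            unfolding xw by (simp add: algebra_simps)
          ultimately show ?thesis using that by linarith
        qed
        show "(1 - \<beta>\<^sup>2 / 2) ^ (T n - T1 n) * 2 ^ (2 * n + 1) \<le> exp (1 - real n)"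
          unfolding TT1
        proof (rule decay_bound[where b = 3])
          have "64 < \<beta>\<^sup>2 * \<epsilon> * ?w n" using w3 \<beta> \<epsilon> by (simp add: divide_less_eq mult_ac)
          moreover have "4 \<le> \<beta>\<^sup>2 / 2 * (\<epsilon> / 8) * z" if "64 < \<beta>\<^sup>2 * \<epsilon> * z" for z using that by simp
          ultimately have "4 \<le> \<beta>\<^sup>2 / 2 * (\<epsilon> / 8) * ?w n" by blast
          then have "4 * real n \<le> \<beta>\<^sup>2 / 2 * (\<epsilon> / 8) * ?w n * real n" by (rule mult_right_mono) simp
          also have "\<dots> = \<beta>\<^sup>2 / 2 * (\<epsilon> / 8 * (real n * ?w n))" by (simp only: mult_ac)
          finally have "4 * real n - 1 \<le> \<beta>\<^sup>2 / 2 * (\<epsilon> / 8 * (real n * ?w n)) - 1" by (rule diff_right_mono)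
          also have "\<dots> \<le> \<beta>\<^sup>2 / 2 * real (TA n)" by (rule TAw) (use \<gamma>(2,3) in auto)
          finally show "(3 + 1) * real n - 1 \<le> \<beta>\<^sup>2 / 2 * real (TA n)" by simp
          show "real (2 * n + 1) \<le> 3 * real n" using elim(5) by simp
        qed (use \<gamma> in auto)
        show "(1 - \<eta> / 10) ^ TA n * 2 ^ (10 * n) \<le> exp (1 - real n)"
        proof (rule decay_bound[where b = 10])
          have "880 < \<eta> * \<epsilon> * ?w n" using w2 \<eta> \<epsilon> by (simp add: divide_less_eq mult_ac)
          moreover have "11 \<le> \<eta> / 10 * (\<epsilon> / 8) * z" if "880 < \<eta> * \<epsilon> * z" for z using that by simp
          ultimately have "11 \<le> \<eta> / 10 * (\<epsilon> / 8) * ?w n" by blast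
          then have "11 * real n \<le> \<eta> / 10 * (\<epsilon> / 8) * ?w n * real n" by (rule mult_right_mono) simp
          also have "\<dots> = \<eta> / 10 * (\<epsilon> / 8 * (real n * ?w n))" by (simp only: mult_ac)
          finally have "11 * real n - 1 \<le> \<eta> / 10 * (\<epsilon> / 8 * (real n * ?w n)) - 1" by (rule diff_right_mono)
          also have "\<dots> \<le> \<eta> / 10 * real (TA n)" by (rule TAw) (use \<eta> in auto)
          finally show "(10 + 1) * real n - 1 \<le> \<eta> / 10 * real (TA n)" by simp
        qed (use \<eta> in auto)
        define q where "q = (1 - \<eta>) * (2 * real (K n) / real n * (1 - 2 * \<eta>) * (1 - 4 * \<eta>))"
        \<comment> \<open>The ideal service rate of a single vertex; over \<open>x n\<close> rounds
          it accumulates exactly \<open>ln n\<close>, the threshold for exhausting \<open>n\<close>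
          vertices.\<close>
        define c where "c = 2 * real (K n) / real n"
        have c0: "0 < c" using K0 n0 by (simp add: c_def)
        have cx: "c * x n = ln (real n)" using K0 n0 by (simp add: c_def x_def)
        have qc: "q = c * ((1 - \<eta>) * (1 - 2 * \<eta>) * (1 - 4 * \<eta>))" unfolding q_def c_def[symmetric] by (simp only: mult_ac)
        have "1 - 7 * \<eta> \<le> (1 - \<eta>) * (1 - 2 * \<eta>) * (1 - 4 * \<eta>)"
        proof -
          have "(1 - \<eta>) * (1 - 2 * \<eta>) * (1 - 4 * \<eta>) = 1 - 7 * \<eta> + \<eta> * (\<eta> * (14 - 8 * \<eta>))" by (simp add: algebra_simps)
          moreover have "0 \<le> \<eta> * (\<eta> * (14 - 8 * \<eta>))" using \<eta> by (intro mult_nonneg_nonneg) auto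
          ultimately show ?thesis by linarith
        qed
        then have qge: "c * (1 - 7 * \<eta>) \<le> q" unfolding qc by (rule mult_left_mono) (use c0 in simp)
        have q0: "0 \<le> q" using qge c0 \<eta> mult_nonneg_nonneg[of c "1 - 7 * \<eta>"] by linarith
        have q1: "q \<le> 1"
        proof -
          have "(1 - \<eta>) * (1 - 2 * \<eta>) * (1 - 4 * \<eta>) \<le> 1 * 1 * 1" by (intro mult_mono) (use \<eta> in auto)
          then have "q \<le> c * 1" unfolding qc by (intro mult_left_mono) (use c0 in auto)
          moreover have "c \<le> 1"
          proof -
            have "real (K n) \<le> \<eta> / 2 * real n" using Kln elim(3) n0 by (simp add: divide_less_eq)
            moreover have "\<eta> / 2 * real n \<le> 1 / 2 * real n" by (rule mult_right_mono) (use \<eta> in auto)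
            ultimately have "2 * real (K n) \<le> real n" by linarith
            then show ?thesis using n0 by (simp add: c_def divide_le_eq)
          qed
          ultimately show ?thesis by simp
        qed
        have TBge: "(1 + \<delta> / 3) * x n \<le> real (T1 n - TA n)"
        proof -
          have "(1 + \<epsilon> / 2) * x n - 1 \<le> real (T1 n - TA n)" using TB Tge TAle e1 by linarith
          moreover have "(1 + \<delta> / 2) * x n \<le> (1 + \<epsilon> / 2) * x n" by (rule mult_right_mono) (use \<delta> x0 in auto)
          moreover have "(1 + \<delta> / 2) * x n = (1 + \<delta> / 3) * x n + \<delta> * x n / 6" by (simp add: algebra_simps)
          moreover have "6 \<le> \<delta> * x n" using x1 \<delta> by (simp add: divide_le_eq mult.commute)
          ultimately show ?thesis by linarith
        qed
        have "(1 + \<delta> / 6) * ln (real n) \<le> (1 - 7 * \<eta>) * (1 + \<delta> / 3) * ln (real n)"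
        proof (rule mult_right_mono)
          have "(1 - 7 * \<eta>) * (1 + \<delta> / 3) = 1 + \<delta> / 3 - 7 * \<delta> / 100 - 7 * (\<delta> * \<delta>) / 300"
            by (simp add: \<eta>_def field_simps)
          moreover have "\<delta> * \<delta> \<le> \<delta> * 1" by (rule mult_left_mono) (use \<delta> in auto)
          ultimately show "1 + \<delta> / 6 \<le> (1 - 7 * \<eta>) * (1 + \<delta> / 3)" using \<delta> by linarith
        qed (use ln0 in simp)
        also have "\<dots> = (c * (1 - 7 * \<eta>)) * ((1 + \<delta> / 3) * x n)" unfolding cx[symmetric] by (simp add: mult_ac)
        also have "\<dots> \<le> q * real (T1 n - TA n)"
          by (rule mult_mono[OF qge TBge q0]) (use \<delta> x0 in simp)
        finally have exq: "(1 + \<delta> / 6) * ln (real n) \<le> q * real (T1 n - TA n)" .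
        have "(1 - q) ^ (T1 n - TA n) \<le> exp (- q) ^ (T1 n - TA n)"
          by (rule power_mono) (use q1 exp_ge_add_one_self[of "- q"] in auto)
        also have "\<dots> = exp (- (q * real (T1 n - TA n)))" by (simp add: exp_of_nat_mult[symmetric] mult.commute)
        also have "\<dots> \<le> exp (- ((1 + \<delta> / 6) * ln (real n)))" using exq by simp
        \<comment> \<open>The surplus \<open>\<delta> / 6\<close> in the exponent is what remains
          after paying for the factor \<open>n\<close>, the initial bound on the number of needy
          vertices.\<close>
        finally have "(1 - q) ^ (T1 n - TA n) * real n \<le> exp (- ((1 + \<delta> / 6) * ln (real n))) * real n"
          by (rule mult_right_mono) simp
        also have "\<dots> = exp (- ((1 + \<delta> / 6) * ln (real n)) + ln (real n))"
          using n0 by (simp only: exp_add exp_ln)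
        also have "\<dots> = real n powr (- (\<delta> / 6))" using n0 by (simp add: powr_def algebra_simps)
        finally have "(1 - q) ^ (T1 n - TA n) * real n / \<eta> ^ 10 \<le> real n powr (- (\<delta> / 6)) / \<eta> ^ 10"
          by (rule divide_right_mono) (use \<eta> in simp)
        then show "(1 - (1 - \<eta>) * (2 * real (K n) / real n * (1 - 2 * \<eta>) * (1 - 4 * \<eta>))) ^ (T1 n - TA n) * (real n / \<eta> ^ 10)
            \<le> real n powr (- (\<delta> / 6)) / \<eta> ^ 10" unfolding q_def by simp
      qed
      finally show ?case by (simp add: Collect_neg_eq[symmetric])
    qed
  qed
  ultimately have "(\<lambda>n. measure_pmf.prob (achlioptas n (K n) (strategy n (m n) (d n) (T1 n)) (T n))
      {h. hamiltonian n (selected h)}) \<longlonglongrightarrow> 1"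
    by (rule tendsto_one_of_complement)
  then show thesis unfolding T_def x_def by (rule that)
qed

theorem theorem1p1:
  fixes K :: "nat \<Rightarrow> nat" and \<epsilon> :: real
  assumes "\<And>n. K n \<ge> 2"
    and "(\<lambda>n. real (K n)) \<in> o(\<lambda>n. ln (real n))"
    and "\<epsilon> > 0"
  shows "(\<exists>A :: nat \<Rightarrow> algorithm.
            (\<forall>n. online_algorithm n (K n) (A n)) \<and>
            (\<lambda>n. measure_pmf.prob
                   (achlioptas n (K n) (A n)
                      (nat \<lfloor>(1 + \<epsilon>) * (real n * ln (real n) / (2 * real (K n)))\<rfloor>))
                   {h. \<exists>t. real t \<le> (1 + \<epsilon>) * (real n * ln (real n) / (2 * real (K n))) \<and>
                           hamiltonian n (selected (take t h))})
              \<longlonglongrightarrow> 1) \<and>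
         (\<forall>A :: nat \<Rightarrow> algorithm.
            (\<forall>n. online_algorithm n (K n) (A n)) \<longrightarrow>
            (\<lambda>n. measure_pmf.prob
                   (achlioptas n (K n) (A n)
                      (nat \<lfloor>(1 - \<epsilon>) * (real n * ln (real n) / (2 * real (K n)))\<rfloor>))
                   {h. \<not> hamiltonian n (selected h)})
              \<longlonglongrightarrow> 1)"
proof (intro conjI allI impI)
  obtain m d T1 :: "nat \<Rightarrow> nat" where lim: "(\<lambda>n. measure_pmf.prob
      (achlioptas n (K n) (strategy n (m n) (d n) (T1 n))
        (nat \<lfloor>(1 + \<epsilon>) * (real n * ln (real n) / (2 * real (K n)))\<rfloor>))
      {h. hamiltonian n (selected h)}) \<longlonglongrightarrow> 1"
    using hamiltonian_tendsto[OF assms] by blast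
  let ?b = "\<lambda>n. (1 + \<epsilon>) * (real n * ln (real n) / (2 * real (K n)))"
  let ?A = "\<lambda>n. strategy n (m n) (d n) (T1 n)"
  let ?p = "\<lambda>n. achlioptas n (K n) (?A n) (nat \<lfloor>?b n\<rfloor>)"
  let ?H = "\<lambda>n. {h. \<exists>t. real t \<le> ?b n \<and> hamiltonian n (selected (take t h))}"
  have on: "online_algorithm n (K n) (?A n)" for n
    by (rule online_strategy) (use assms(1)[of n] in simp)
  \<comment> \<open>The event asks for a Hamilton cycle in some prefix of the history. The full
    history is such a prefix: its length is at most the floor of the real bound, and that bound is
    nonnegative for \<open>n \<ge> 1\<close>.\<close>
  have "(\<lambda>n. measure_pmf.prob (?p n) (?H n)) \<longlonglongrightarrow> 1"
  proof (rule tendsto_sandwich[OF _ _ lim tendsto_const])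
    show "\<forall>\<^sub>F n in sequentially. measure_pmf.prob (?p n) {h. hamiltonian n (selected h)} \<le>
        measure_pmf.prob (?p n) (?H n)"
      using eventually_ge_at_top[of 1]
    proof eventually_elim
      case (elim n)
      have b0: "0 \<le> ?b n" using elim assms(3) by (intro mult_nonneg_nonneg divide_nonneg_nonneg) auto
      show ?case
      proof (rule measure_pmf.finite_measure_mono_AE)
        show "AE h in ?p n. h \<in> {h. hamiltonian n (selected h)} \<longrightarrow> h \<in> ?H n"
          unfolding AE_measure_pmf_iff
        proof (intro ballI impI)
          fix h assume h: "h \<in> set_pmf (?p n)" "h \<in> {h. hamiltonian n (selected h)}"
          have "length h \<le> nat \<lfloor>?b n\<rfloor>" by (rule length_achlioptas[OF h(1)])
          then have "take (nat \<lfloor>?b n\<rfloor>) h = h" by simp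
          moreover have "real (nat \<lfloor>?b n\<rfloor>) \<le> ?b n" using b0 by simp
          ultimately show "h \<in> ?H n" using h(2) by (metis (mono_tags, lifting) mem_Collect_eq)
        qed
      qed simp
    qed
  qed simp
  then show "\<exists>A. (\<forall>n. online_algorithm n (K n) (A n)) \<and>
      (\<lambda>n. measure_pmf.prob (achlioptas n (K n) (A n) (nat \<lfloor>?b n\<rfloor>)) (?H n)) \<longlonglongrightarrow> 1"
    by (intro exI[of _ ?A] conjI allI on)
next
  fix A :: "nat \<Rightarrow> algorithm"
  assume "\<forall>n. online_algorithm n (K n) (A n)"
  then show "(\<lambda>n. measure_pmf.prob
      (achlioptas n (K n) (A n) (nat \<lfloor>(1 - \<epsilon>) * (real n * ln (real n) / (2 * real (K n)))\<rfloor>))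
      {h. \<not> hamiltonian n (selected h)}) \<longlonglongrightarrow> 1"
    by (intro not_hamiltonian_tendsto[OF assms]) simp
qed

end
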